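(* Let $\sigma$ be a connected skew Young diagram whose topmost row is row $1$. Then, as formal power series in $\mathbf{x}=(x_1,x_2,\ldots)$, $$G_\sigma \;=\; \sum_{\mu\supseteq \sigma} (-1)^{|B(\mu/\sigma)|}\, a_{\sigma,\mu}\, s_\mu ,$$ where the sum is over all skew Young diagrams $\mu\supseteq\sigma$ (in the sense of the containment convention below), $s_\mu$ is the skew Schur function of $\mu$, and $a_{\sigma,\mu}$ is the nonnegative integer equal to the product of (1) the number of row-weakly-bounded semistandard tableaux of shape $A(\mu/\sigma)$, and (2) the number of row-bounded, reverse row-strict tableaux of shape $B(\mu/\sigma)$.
   Context: Boxes are pairs $(i,j)$ of positive integers, $i$ the row index (increasing downward) and $j$ the column index (increasing to the right); $(i,j)\preceq(i',j')$ iff $i\le i'$ and $j\le j'$. A skew Young diagram (skew shape) is a finite set $\sigma$ of boxes closed under intervals: if $a,c\in\sigma$ and $a\preceq b\preceq c$ then $b\in\sigma$. It is connected if its Hasse diagram under $\preceq$ is connected. $|\sigma|$ is its number of boxes. Rows are numbered so that the top row of $\sigma$ is row $1$. Containment convention: for skew shapes $\mu,\sigma$, $\mu\supseteq\sigma$ means every box of $\sigma$ is in $\mu$ and every box of $\mu$ lies in the same column as some box of $\sigma$. For connected $\sigma$, $\mu\setminus\sigma$ then splits into $A(\mu/\sigma)$, the boxes of $\mu\setminus\sigma$ lying above boxes of $\sigma$ in their column, and $B(\mu/\sigma)$, those lying below; both are skew shapes. A tableau of shape $\mu$ assigns a positive integer $T(i,j)$ to each box. It is semistandard if rows weakly increase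 left to right and columns strictly increase top to bottom. It is reverse row-strict if rows strictly decrease left to right and columns weakly decrease top to bottom. It is row-bounded if $T(i,j)<i$ for every box $(i,j)$, and row-weakly-bounded if $T(i,j)\le i$ for every box. A set-valued tableau assigns a nonempty finite set of positive integers to each box; for sets write $S\le T$ if $\max S\le\min T$ and $S<T$ if $\max S<\min T$; it is semistandard if rows weakly increase and columns strictly increase in this sense. The content $c(T)=(c_1,c_2,\dots)$ has $c_i$ = number of occurrences of label $i$, and $|T|=\sum c_i$; $\mathbf{x}^{c}=\prod x_i^{c_i}$. Skew Schur function: $s_\mu=\sum_T \mathbf{x}^{c(T)}$ over semistandard (ordinary) tableaux $T$ of shape $\mu$. Skew stable Grothendieck polynomial: $G_\sigma=\sum_T(-1)^{|T|-|\sigma|}\mathbf{x}^{c(T)}$ over semistandard set-valued tableaux $T$ of shape $\sigma$. *)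

theory Defs
  imports
    "HOL-Analysis.Analysis"
    "HOL-Library.Poly_Mapping"
    "HOL-Library.Product_Order"
    "HOL-Library.Function_Algebras"
begin

section \<open>Skew shapes\<close>

text \<open>
  The order on boxes is the componentwise order of theory Product_Order, so that
  {a..c} is the set of all boxes between a and c.
\<close>

type_synonym box = "nat \<times> nat"

definition skew_shape :: "box set \<Rightarrow> bool" where
  "skew_shape \<sigma> \<longleftrightarrow>
     finite \<sigma> \<and> (\<forall>(i, j)\<in>\<sigma>. 1 \<le> i \<and> 1 \<le> j) \<and> (\<forall>a\<in>\<sigma>. \<forall>c\<in>\<sigma>. {a..c} \<subseteq> \<sigma>)"

definition hasse :: "box set \<Rightarrow> (box \<times> box) set" where
  "hasse \<sigma> = {(a, b). a \<in> \<sigma> \<and> b \<in> \<sigma> \<and> a < b \<and> \<not> (\<exists>c\<in>\<sigma>. a < c \<and> c < b)}"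

definition connected_shape :: "box set \<Rightarrow> bool" where
  "connected_shape \<sigma> \<longleftrightarrow> (\<forall>a\<in>\<sigma>. \<forall>b\<in>\<sigma>. (a, b) \<in> (hasse \<sigma> \<union> (hasse \<sigma>)\<inverse>)\<^sup>*)"

definition contains_shape :: "box set \<Rightarrow> box set \<Rightarrow> bool" where
  "contains_shape \<mu> \<sigma> \<longleftrightarrow> \<sigma> \<subseteq> \<mu> \<and> snd ` \<mu> \<subseteq> snd ` \<sigma>"

definition above :: "box set \<Rightarrow> box set \<Rightarrow> box set" where
  "above \<mu> \<sigma> = {(i, j). (i, j) \<in> \<mu> - \<sigma> \<and> (\<exists>i'. (i', j) \<in> \<sigma> \<and> i < i')}"

definition below :: "box set \<Rightarrow> box set \<Rightarrow> box set" where
  "below \<mu> \<sigma> = {(i, j). (i, j) \<in> \<mu> - \<sigma> \<and> (\<exists>i'. (i', j) \<in> \<sigma> \<and> i' < i)}"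


section \<open>Tableaux\<close>

text \<open>
  Fillings are extensional functions (undefined off the shape), so that distinct
  functions are distinct tableaux and counting them is meaningful.
\<close>

definition tableaux :: "box set \<Rightarrow> (box \<Rightarrow> nat) set" where
  "tableaux \<mu> = \<mu> \<rightarrow>\<^sub>E {1..}"

definition semistandard :: "box set \<Rightarrow> (box \<Rightarrow> nat) \<Rightarrow> bool" where
  "semistandard \<mu> T \<longleftrightarrow>
     (\<forall>i j j'. (i, j) \<in> \<mu> \<and> (i, j') \<in> \<mu> \<and> j < j' \<longrightarrow> T (i, j) \<le> T (i, j')) \<and>
     (\<forall>i i' j. (i, j) \<in> \<mu> \<and> (i', j) \<in> \<mu> \<and> i < i' \<longrightarrow> T (i, j) < T (i', j))"

definition reverse_row_strict :: "box set \<Rightarrow> (box \<Rightarrow> nat) \<Rightarrow> bool" where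
  "reverse_row_strict \<mu> T \<longleftrightarrow>
     (\<forall>i j j'. (i, j) \<in> \<mu> \<and> (i, j') \<in> \<mu> \<and> j < j' \<longrightarrow> T (i, j) > T (i, j')) \<and>
     (\<forall>i i' j. (i, j) \<in> \<mu> \<and> (i', j) \<in> \<mu> \<and> i < i' \<longrightarrow> T (i, j) \<ge> T (i', j))"

definition row_bounded :: "box set \<Rightarrow> (box \<Rightarrow> nat) \<Rightarrow> bool" where
  "row_bounded \<mu> T \<longleftrightarrow> (\<forall>(i, j)\<in>\<mu>. T (i, j) < i)"

definition row_weakly_bounded :: "box set \<Rightarrow> (box \<Rightarrow> nat) \<Rightarrow> bool" where
  "row_weakly_bounded \<mu> T \<longleftrightarrow> (\<forall>(i, j)\<in>\<mu>. T (i, j) \<le> i)"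

definition sv_tableaux :: "box set \<Rightarrow> (box \<Rightarrow> nat set) set" where
  "sv_tableaux \<sigma> = \<sigma> \<rightarrow>\<^sub>E {S. finite S \<and> S \<noteq> {} \<and> S \<subseteq> {1..}}"

definition sv_semistandard :: "box set \<Rightarrow> (box \<Rightarrow> nat set) \<Rightarrow> bool" where
  "sv_semistandard \<sigma> T \<longleftrightarrow>
     (\<forall>i j j'. (i, j) \<in> \<sigma> \<and> (i, j') \<in> \<sigma> \<and> j < j' \<longrightarrow> Max (T (i, j)) \<le> Min (T (i, j'))) \<and>
     (\<forall>i i' j. (i, j) \<in> \<sigma> \<and> (i', j) \<in> \<sigma> \<and> i < i' \<longrightarrow> Max (T (i, j)) < Min (T (i', j)))"

text \<open>
  A content is an exponent vector: its value at i is the number of occurrences of the label i.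
\<close>

definition tab_content :: "box set \<Rightarrow> (box \<Rightarrow> nat) \<Rightarrow> (nat \<Rightarrow>\<^sub>0 nat)" where
  "tab_content \<mu> T = (\<Sum>b\<in>\<mu>. Poly_Mapping.single (T b) 1)"

definition sv_content :: "box set \<Rightarrow> (box \<Rightarrow> nat set) \<Rightarrow> (nat \<Rightarrow>\<^sub>0 nat)" where
  "sv_content \<sigma> T = (\<Sum>b\<in>\<sigma>. \<Sum>i\<in>T b. Poly_Mapping.single i 1)"

definition sv_size :: "box set \<Rightarrow> (box \<Rightarrow> nat set) \<Rightarrow> nat" where
  "sv_size \<sigma> T = (\<Sum>i\<in>Poly_Mapping.keys (sv_content \<sigma> T). Poly_Mapping.lookup (sv_content \<sigma> T) i)"


section \<open>Formal power series in infinitely many variables\<close>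

text \<open>
  A series is the function giving the coefficient of each monomial; a monomial is its finitely
  supported exponent vector. Labels are positive, so the variable with index 0 never occurs.
  Addition and topology are those of the function space: pointwise addition (Function_Algebras)
  and the product topology over the discrete type int. This is the usual topology of coefficientwise
  stabilisation, see series_has_sum_iff below. The pointwise multiplication from Function_Algebras
  is not the product of series; it is not used.
\<close>

type_synonym series = "(nat \<Rightarrow>\<^sub>0 nat) \<Rightarrow> int"

text \<open>
  The two generating functions are given by their coefficients, collecting for each monomial the
  tableaux with that content; there are only finitely many, see the lemmas below.
\<close>

definition schur :: "box set \<Rightarrow> series" where
  "schur \<mu> = (\<lambda>c. int (card {T \<in> tableaux \<mu>. semistandard \<mu> T \<and> tab_content \<mu> T = c}))"

definition grothendieck :: "box set \<Rightarrow> series" where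
  "grothendieck \<sigma> = (\<lambda>c. \<Sum>T | T \<in> sv_tableaux \<sigma> \<and> sv_semistandard \<sigma> T \<and> sv_content \<sigma> T = c.
      (-1) ^ (sv_size \<sigma> T - card \<sigma>))"

definition expansion_coeff :: "box set \<Rightarrow> box set \<Rightarrow> nat" where
  "expansion_coeff \<sigma> \<mu> =
     card {T \<in> tableaux (above \<mu> \<sigma>).
             semistandard (above \<mu> \<sigma>) T \<and> row_weakly_bounded (above \<mu> \<sigma>) T} *
     card {T \<in> tableaux (below \<mu> \<sigma>).
             reverse_row_strict (below \<mu> \<sigma>) T \<and> row_bounded (below \<mu> \<sigma>) T}"


section \<open>The counting sets are finite\<close>

lemma lookup_sum_pm: "Poly_Mapping.lookup (sum f A) i = (\<Sum>a\<in>A. Poly_Mapping.lookup (f a) i)"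
  by (induction A rule: infinite_finite_induct) (auto simp: lookup_add)

lemma lookup_content:
  "finite \<mu> \<Longrightarrow> Poly_Mapping.lookup (tab_content \<mu> T) i = card {b \<in> \<mu>. T b = i}"
  by (simp add: tab_content_def lookup_sum_pm lookup_single when_def sum.If_cases Int_def)

lemma lookup_sv_content:
  assumes "finite \<sigma>" "\<And>b. b \<in> \<sigma> \<Longrightarrow> finite (T b)"
  shows "Poly_Mapping.lookup (sv_content \<sigma> T) i = card {b \<in> \<sigma>. i \<in> T b}"
proof -
  have "Poly_Mapping.lookup (sv_content \<sigma> T) i = (\<Sum>b\<in>\<sigma>. \<Sum>k\<in>T b. if k = i then Suc 0 else 0)"
    by (simp add: sv_content_def lookup_sum_pm lookup_single when_def)
  also have "\<dots> = (\<Sum>b\<in>\<sigma>. if i \<in> T b then Suc 0 else 0)"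
    using assms by (intro sum.cong) auto
  also have "\<dots> = card {b \<in> \<sigma>. i \<in> T b}"
    using assms by (simp add: sum.If_cases Int_def)
  finally show ?thesis .
qed

lemma finite_tableaux_content:
  assumes "finite \<mu>"
  shows "finite {T \<in> tableaux \<mu>. semistandard \<mu> T \<and> tab_content \<mu> T = c}"
proof (rule finite_subset)
  show "{T \<in> tableaux \<mu>. semistandard \<mu> T \<and> tab_content \<mu> T = c} \<subseteq> \<mu> \<rightarrow>\<^sub>E Poly_Mapping.keys c"
  proof
    fix T assume T: "T \<in> {T \<in> tableaux \<mu>. semistandard \<mu> T \<and> tab_content \<mu> T = c}"
    have "T b \<in> Poly_Mapping.keys c" if "b \<in> \<mu>" for b
    proof -
      have "b \<in> {b' \<in> \<mu>. T b' = T b}" and "finite {b' \<in> \<mu>. T b' = T b}" using assms that by simp_all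
      then have "card {b' \<in> \<mu>. T b' = T b} > 0" by (metis card_gt_0_iff empty_iff)
      then show ?thesis using T lookup_content[OF assms, of T "T b"]
        by (simp add: in_keys_iff)
    qed
    then show "T \<in> \<mu> \<rightarrow>\<^sub>E Poly_Mapping.keys c" using T by (auto simp: tableaux_def PiE_def)
  qed
  show "finite (\<mu> \<rightarrow>\<^sub>E Poly_Mapping.keys c)" using assms by (intro finite_PiE) auto
qed

lemma finite_sv_tableaux_content:
  assumes "finite \<sigma>"
  shows "finite {T \<in> sv_tableaux \<sigma>. sv_semistandard \<sigma> T \<and> sv_content \<sigma> T = c}"
proof (rule finite_subset)
  show "{T \<in> sv_tableaux \<sigma>. sv_semistandard \<sigma> T \<and> sv_content \<sigma> T = c}
          \<subseteq> \<sigma> \<rightarrow>\<^sub>E Pow (Poly_Mapping.keys c)"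
  proof
    fix T assume T: "T \<in> {T \<in> sv_tableaux \<sigma>. sv_semistandard \<sigma> T \<and> sv_content \<sigma> T = c}"
    have fin: "finite (T b)" if "b \<in> \<sigma>" for b
      using T that by (auto simp: sv_tableaux_def)
    have "i \<in> Poly_Mapping.keys c" if "b \<in> \<sigma>" "i \<in> T b" for b i
    proof -
      have "b \<in> {b' \<in> \<sigma>. i \<in> T b'}" and "finite {b' \<in> \<sigma>. i \<in> T b'}" using assms that by simp_all
      then have "card {b' \<in> \<sigma>. i \<in> T b'} > 0" by (metis card_gt_0_iff empty_iff)
      then show ?thesis using T lookup_sv_content[where T = T and i = i, OF assms fin]
        by (simp add: in_keys_iff)
    qed
    then show "T \<in> \<sigma> \<rightarrow>\<^sub>E Pow (Poly_Mapping.keys c)" using T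
      by (auto simp: sv_tableaux_def PiE_def Pi_def)
  qed
  show "finite (\<sigma> \<rightarrow>\<^sub>E Pow (Poly_Mapping.keys c))" using assms by (intro finite_PiE) auto
qed

lemma finite_bounded_tableaux:
  assumes "finite \<mu>" and "\<And>T. P T \<Longrightarrow> row_weakly_bounded \<mu> T"
  shows "finite {T \<in> tableaux \<mu>. P T}"
proof (rule finite_subset)
  show "{T \<in> tableaux \<mu>. P T} \<subseteq> (\<Pi>\<^sub>E b\<in>\<mu>. {1..fst b})"
  proof
    fix T assume T: "T \<in> {T \<in> tableaux \<mu>. P T}"
    then have "T (i, j) \<le> i" if "(i, j) \<in> \<mu>" for i j
      using assms(2)[of T] that by (auto simp: row_weakly_bounded_def)
    then show "T \<in> (\<Pi>\<^sub>E b\<in>\<mu>. {1..fst b})"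
      using T by (simp add: tableaux_def PiE_def Pi_def)
  qed
  show "finite (\<Pi>\<^sub>E b\<in>\<mu>. {1..fst b})" using assms by (intro finite_PiE) auto
qed

lemma row_bounded_imp_weakly: "row_bounded \<mu> T \<Longrightarrow> row_weakly_bounded \<mu> T"
  unfolding row_bounded_def row_weakly_bounded_def by (auto intro: less_imp_le)


section \<open>Infinite sums of series\<close>

lemma sum_series_apply: "(sum f A :: series) c = (\<Sum>a\<in>A. f a c)"
  by (induction A rule: infinite_finite_induct) auto

lemma int_has_sum_iff:
  fixes f :: "'a \<Rightarrow> int"
  shows "(f has_sum s) I \<longleftrightarrow>
    finite {i \<in> I. f i \<noteq> 0} \<and> s = (\<Sum>i | i \<in> I \<and> f i \<noteq> 0. f i)"
    (is "?L \<longleftrightarrow> ?R")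
proof
  assume ?L
  then have "eventually (\<lambda>F. sum f F = s) (finite_subsets_at_top I)"
    by (auto simp: has_sum_def tendsto_discrete)
  then obtain X where X: "finite X" "X \<subseteq> I"
    and eq: "\<And>Y. finite Y \<Longrightarrow> X \<subseteq> Y \<Longrightarrow> Y \<subseteq> I \<Longrightarrow> sum f Y = s"
    by (auto simp: eventually_finite_subsets_at_top)
  have zero: "f i = 0" if "i \<in> I" "i \<notin> X" for i
  proof -
    have "sum f (insert i X) = s" using X that by (intro eq) auto
    moreover have "sum f X = s" using X by (intro eq) auto
    ultimately show ?thesis using X that by simp
  qed
  have sub: "{i \<in> I. f i \<noteq> 0} \<subseteq> X" using zero by auto
  then have fin: "finite {i \<in> I. f i \<noteq> 0}" using X finite_subset by blast
  have "s = sum f X" using eq[of X] X by auto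
  also have "\<dots> = (\<Sum>i | i \<in> I \<and> f i \<noteq> 0. f i)"
    using X sub by (intro sum.mono_neutral_right) auto
  finally show ?R using fin by simp
next
  assume R: ?R
  define J where "J = {i \<in> I. f i \<noteq> 0}"
  have "(f has_sum s) J"
    using has_sum_finite[of J f] R unfolding J_def by simp
  moreover have "(f has_sum s) J \<longleftrightarrow> (f has_sum s) I"
    by (rule has_sum_cong_neutral) (auto simp: J_def)
  ultimately show ?L by simp
qed

lemma series_has_sum_iff:
  fixes f :: "'a \<Rightarrow> series"
  shows "(f has_sum g) I \<longleftrightarrow>
    (\<forall>c. finite {i \<in> I. f i c \<noteq> 0} \<and> g c = (\<Sum>i | i \<in> I \<and> f i c \<noteq> 0. f i c))"
proof -
  have "(f has_sum g) I \<longleftrightarrow> (\<forall>c. ((\<lambda>i. f i c) has_sum g c) I)"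
    unfolding has_sum_def limitin_canonical_iff[symmetric]
      euclidean_product_topology[symmetric] limitin_componentwise
    by (simp add: sum_series_apply)
  then show ?thesis by (simp add: int_has_sum_iff)
qed

end

theory Submission
  imports Defs
begin

text \<open>
  Encode a tableau by the chain of shapes occupied by the labels at most \<open>k\<close>. Consider hybrid tableaux in which
  only the rows \<open>1, \<dots>, r\<close> may carry several labels per box; their signed generating function is a product of
  transfer matrices \<open>W\<^sub>r(x\<^sub>k)\<close> between row-length vectors, horizontal strips with an extra factor
  \<open>1 - x\<^sub>k\<close> for each row up to \<open>r\<close> whose last box may receive the additional label \<open>k\<close>. The case \<open>r = 0\<close> is a Schur function,
  and \<open>r\<close> large is \<open>G\<^sub>\<sigma>\<close>.

  Let \<open>E\<close> be the signed removal of vertical strips from the rows below \<open>r\<close> and let \<open>D\<close> remove horizontal strips from the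
  rows \<open>\<ge> r\<close>. Then \<open>E W\<^bsub>r-1\<^esub>(x) = W'(x) E\<close>, where \<open>W'\<close> has the extra factor in row \<open>r\<close>, and \<open>E D\<close> only shortens
  row \<open>r\<close>; a telescoping sum absorbs that remaining sum, so that
  \<open>E W\<^bsub>r-1\<^esub>(x\<^sub>K) \<cdots> W\<^bsub>r-1\<^esub>(x\<^sub>1) D = W\<^sub>r(x\<^sub>K) \<cdots> W\<^sub>r(x\<^sub>1)\<close>.
  Passing from \<open>r\<close> to \<open>r - 1\<close> thus adds a vertical strip at the right ends of the rows below \<open>r\<close>, with sign, and
  a horizontal strip at the left ends of the rows \<open>\<ge> r\<close>. Labelling both strips by \<open>r\<close> and iterating down to
  \<open>r = 0\<close> builds the tableaux on \<open>B(\<mu>/\<sigma>)\<close> and \<open>A(\<mu>/\<sigma>)\<close> with their row bounds.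
\<close>

section \<open>Strip weights and their exchange relation\<close>

text \<open>The two strips start in different rows: \<open>E\<close> acts strictly below row
  \<open>r\<close>, \<open>D\<close> from row \<open>r\<close> on. This mismatch gives the strict
  row bound on \<open>B\<close> and the weak one on \<open>A\<close>, and it is why
  \<open>E D\<close> fails to be the identity in one row. The failure is needed: the factor that
  \<open>E\<close> creates in row \<open>r\<close> is charged even if that row is still empty,
  although a missing box cannot take a second label. Summing over the lengths of row
  \<open>r\<close> up to \<open>l r\<close> removes exactly the unwanted factors.

  Strips are split off for decreasing \<open>r\<close>, so labels grow towards \<sigma> on both
  sides; hence the opposite orders in the two kinds of tableaux.

  The rows need no limit argument. For a monomial in labels up to \<open>K\<close>, a shape with
  \<open>n\<close> rows reaches at most row \<open>n + K\<close>, since each label descends by at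
  most one row. With \<open>N = n + K\<close> the bottom row is still empty whenever the exchange
  relation is applied, so no boundary term arises, and shapes \<mu> reaching below row
  \<open>N\<close> have coefficient 0.\<close>

lemma sum_Pow_prod:
  fixes f g :: "'b \<Rightarrow> 'a::comm_ring_1"
  assumes "finite I"
  shows "(\<Sum>B\<in>Pow I. \<Prod>i\<in>I. if i \<in> B then f i else g i) = (\<Prod>i\<in>I. f i + g i)"
proof -
  have "(\<Prod>i\<in>I. if i \<in> B then f i else g i) = (\<Prod>i\<in>B. f i) * (\<Prod>i\<in>I - B. g i)" if "B \<in> Pow I" for B
  proof -
    have "I \<inter> {i. i \<in> B} = B" "I \<inter> - {i. i \<in> B} = I - B" using that by auto
    then show ?thesis using assms by (simp add: prod.If_cases)
  qed
  then show ?thesis using assms by (simp add: prod_add)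
qed

definition raise_rows :: "nat set \<Rightarrow> (nat \<Rightarrow> nat) \<Rightarrow> nat \<Rightarrow> nat" where
  "raise_rows B \<gamma> = (\<lambda>i. if i \<in> B then Suc (\<gamma> i) else \<gamma> i)"

definition lower_rows :: "nat set \<Rightarrow> (nat \<Rightarrow> nat) \<Rightarrow> nat \<Rightarrow> nat" where
  "lower_rows B \<kappa> = (\<lambda>i. if i \<in> B then \<kappa> i - 1 else \<kappa> i)"

text \<open>
  Row \<open>i\<close> of the transfer matrix from \<open>\<kappa>\<close> to \<open>\<nu>\<close>. Row \<open>i\<close> of a shape occupies the columns from \<open>l i\<close> up to, but not including, \<open>\<kappa> i\<close>.
  The last factor accounts for the new label joining box \<open>(i, \<kappa> i - 1)\<close>, which must exist and have no box of \<open>\<nu>\<close> below it.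
\<close>

definition row_wt :: "(nat \<Rightarrow> nat) \<Rightarrow> (nat \<Rightarrow> 'a::comm_ring_1) \<Rightarrow> (nat \<Rightarrow> 'a) \<Rightarrow>
    (nat \<Rightarrow> nat) \<Rightarrow> (nat \<Rightarrow> nat) \<Rightarrow> nat \<Rightarrow> 'a" where
  "row_wt l x z \<kappa> \<nu> i =
     (if \<kappa> i \<le> \<nu> i \<and> \<nu> i \<le> \<kappa> (i - 1) then x i ^ (\<nu> i - \<kappa> i) else 0) *
     (if l i < \<kappa> i \<and> \<nu> (Suc i) < \<kappa> i then 1 + z i else 1)"

locale strips =
  fixes M c N :: nat
  assumes c_pos: "0 < c"
begin

text \<open>
  The artificial row 0 of length \<open>M\<close> bounds all columns, and the value \<open>c\<close> marks empty rows at the bottom.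
  Positivity of \<open>c\<close> keeps the subtraction in \<open>lower_rows\<close> from truncating.
\<close>

definition states :: "nat \<Rightarrow> (nat \<Rightarrow> nat) set" where
  "states n = {\<kappa>. (\<forall>i. \<kappa> (Suc i) \<le> \<kappa> i) \<and> \<kappa> 0 = M \<and> (\<forall>i>n. \<kappa> i = c)}"

definition step_wt :: "(nat \<Rightarrow> nat) \<Rightarrow> (nat \<Rightarrow> 'a::comm_ring_1) \<Rightarrow> (nat \<Rightarrow> 'a) \<Rightarrow>
    (nat \<Rightarrow> nat) \<Rightarrow> (nat \<Rightarrow> nat) \<Rightarrow> 'a" where
  "step_wt l x z \<kappa> \<nu> = (\<Prod>i\<in>{1..N}. row_wt l x z \<kappa> \<nu> i)"

text \<open>The value of \<open>z\<close> for hybrid tableaux: a further label in a box costs a sign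
  in the rows up to \<open>r\<close> and is forbidden in the others.\<close>

definition excess :: "nat \<Rightarrow> 'a::comm_ring_1 \<Rightarrow> nat \<Rightarrow> 'a" where
  "excess r x i = (if i \<le> r then - x else 0)"

lemma states_mono: "\<kappa> \<in> states n \<Longrightarrow> i \<le> j \<Longrightarrow> \<kappa> j \<le> \<kappa> i"
  using lift_Suc_antimono_le[of \<kappa> i j] by (auto simp: states_def)

lemma states_ge: assumes "\<kappa> \<in> states n" shows "c \<le> \<kappa> i"
proof -
  have "\<kappa> (max i (Suc n)) \<le> \<kappa> i" by (rule states_mono[OF assms]) simp
  then show ?thesis using assms by (simp add: states_def)
qed

lemma states_le: "\<kappa> \<in> states n \<Longrightarrow> \<kappa> i \<le> M"
  using states_mono[of \<kappa> n 0 i] by (simp add: states_def)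

lemma states_const: "\<kappa> \<in> states n \<Longrightarrow> n < i \<Longrightarrow> \<kappa> i = c"
  by (simp add: states_def)

lemma states_0: "\<kappa> \<in> states n \<Longrightarrow> \<kappa> 0 = M"
  by (simp add: states_def)

lemma states_subset: "m \<le> n \<Longrightarrow> states m \<subseteq> states n"
  by (auto simp: states_def)

lemma finite_states: "finite (states n)"
proof (rule finite_subset)
  let ?e = "\<lambda>f i. if i \<le> n then f i else c"
  show "states n \<subseteq> ?e ` ({..n} \<rightarrow>\<^sub>E {..M})"
  proof
    fix \<kappa> assume k: "\<kappa> \<in> states n"
    have "\<kappa> = ?e (restrict \<kappa> {..n})" using k by (auto simp: states_def)
    moreover have "restrict \<kappa> {..n} \<in> {..n} \<rightarrow>\<^sub>E {..M}" using states_le[OF k] by auto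
    ultimately show "\<kappa> \<in> ?e ` ({..n} \<rightarrow>\<^sub>E {..M})" by blast
  qed
  show "finite (?e ` ({..n} \<rightarrow>\<^sub>E {..M}))" by (intro finite_imageI finite_PiE) auto
qed

text \<open>
  The weights of the two sides of the exchange relation differ row by row only by the factor \<open>s\<close>, which moves down by one row.
\<close>

lemma row_exchange:
  fixes x :: "'a::comm_ring_1"
  defines "s \<equiv> \<lambda>a b. if a < (b::nat) then 1 - x else if a = b then 1 else 0"
  assumes "k \<le> k'" "g' \<le> g" "0 < k"
  shows "s g k' * ((if g' \<le> k \<and> k \<le> g then x ^ (g - k) else 0) -
           (if g' \<le> k - 1 \<and> k - 1 \<le> g then x ^ (g - (k - 1)) else 0)) =
         ((if k \<le> g \<and> g \<le> k' then x ^ (g - k) else 0) -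
           (if k \<le> Suc g \<and> Suc g \<le> k' then x ^ (Suc g - k) else 0)) * s g' k"
proof (cases "k \<le> g")
  case True
  \<comment> \<open>The difference on the left is \<open>x ^ d * s g' k\<close>, the one on the
    right is \<open>x ^ d * s g k'\<close>, so both sides are the same triple product.\<close>
  then obtain d where d: "g = k + d" using le_Suc_ex by blast
  have [simp]: "g - (k - 1) = Suc d" "Suc g - k = Suc d" "g - k = d" using d assms by auto
  show ?thesis using assms True d unfolding s_def
    by (auto simp: algebra_simps)
next
  case False
  \<comment> \<open>Only \<open>k = Suc g\<close> leaves anything: both differences are then -1 and
    both values of \<open>s\<close> are \<open>1 - x\<close>.\<close>
  then show ?thesis using assms unfolding s_def
    by (cases "k = Suc g") (auto simp: algebra_simps)
qed

text \<open>The entries of \<open>E W = W' E\<close> for \<open>r = q + 1\<close>. Rows up to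
  \<open>q + 1\<close> contribute equally to both sides. In the rows below, summing over subsets
  turns each side into a product of differences, and \<open>row_exchange\<close> carries
  \<open>s\<close> from row \<open>q + 2\<close> to the bottom. The factor \<open>1 - x\<close> on
  the right ignores whether row \<open>q + 1\<close> is empty; \<open>strip_collapse\<close> repairs
  this.\<close>

lemma strip_commute:
  fixes x :: "'a::comm_ring_1"
  assumes k: "\<kappa> \<in> states N" "\<kappa> N = c" and g: "\<gamma> \<in> states N" and q: "q < N"
  shows "(\<Sum>B\<in>Pow {q+2..N}. (-1) ^ card B *
            (if raise_rows B \<gamma> \<in> states N then step_wt l (\<lambda>_. x) (excess q x) \<kappa> (raise_rows B \<gamma>) else 0)) =
         (\<Sum>B\<in>Pow {q+2..N}. (-1) ^ card B *
            (if lower_rows B \<kappa> \<in> states N then step_wt l (\<lambda>_. x) (excess q x) (lower_rows B \<kappa>) \<gamma> *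
               (if \<gamma> (q+2) < \<kappa> (q+1) then 1 - x else 1) else 0))"
    (is "(\<Sum>B\<in>_. ?l B) = (\<Sum>B\<in>_. ?r B)")
proof -
  define I where "I = {q+2..N}"
  define J where "J = {1..q+1}"
  have IJ: "{1..N} = J \<union> I" "J \<inter> I = {}" "finite I" "finite J" using q by (auto simp: I_def J_def)
  let ?w = "row_wt l (\<lambda>_. x) (excess q x)"
  define base where "base = (\<Prod>i\<in>J. ?w \<kappa> \<gamma> i)"
  define s where "s i = (if \<gamma> i < \<kappa> (i-1) then 1 - x else if \<gamma> i = \<kappa> (i-1) then 1 else 0)" for i
  \<comment> \<open>\<open>Ls\<close> and \<open>Lr\<close> are the weights of row \<open>i\<close>
    with \<gamma> kept or raised, \<open>Rs\<close> and \<open>Rr\<close> those with \<kappa> kept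
    or lowered. For the latter pair the interlacing condition of row \<open>i + 1\<close> is booked
    on row \<open>i\<close>; only then does each factor depend on a single choice.\<close>
  define Ls where "Ls i = (if \<kappa> i \<le> \<gamma> i \<and> \<gamma> i \<le> \<kappa> (i-1) then x ^ (\<gamma> i - \<kappa> i) else 0)" for i
  define Lr where "Lr i = (if \<kappa> i \<le> Suc (\<gamma> i) \<and> Suc (\<gamma> i) \<le> \<kappa> (i-1) then x ^ (Suc (\<gamma> i) - \<kappa> i) else 0)" for i
  define Rs where "Rs i = (if \<gamma> (Suc i) \<le> \<kappa> i \<and> \<kappa> i \<le> \<gamma> i then x ^ (\<gamma> i - \<kappa> i) else 0)" for i
  define Rr where "Rr i = (if \<gamma> (Suc i) \<le> \<kappa> i - 1 \<and> \<kappa> i - 1 \<le> \<gamma> i then x ^ (\<gamma> i - (\<kappa> i - 1)) else 0)" for i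
  have base_ok: "\<kappa> i \<le> \<gamma> i \<and> \<gamma> i \<le> \<kappa> (i-1)" if "base \<noteq> 0" "i \<in> J" for i
  proof (rule ccontr)
    assume "\<not> ?thesis"
    then have "?w \<kappa> \<gamma> i = 0" by (auto simp: row_wt_def)
    then show False using that IJ unfolding base_def by (metis prod_zero)
  qed
  have sgn: "(\<Prod>i\<in>I. if i \<in> B then - f i else h i) = (-1) ^ card B * (\<Prod>i\<in>I. if i \<in> B then f i else h i)"
    if "B \<in> Pow I" for B and f h :: "nat \<Rightarrow> 'a"
  proof -
    have "(\<Prod>i\<in>I. if i \<in> B then - f i else h i) =
        (\<Prod>i\<in>I. (if i \<in> B then -1 else 1) * (if i \<in> B then f i else h i))"
      by (rule prod.cong) auto
    also have "\<dots> = (\<Prod>i\<in>I. if i \<in> B then -1 else 1) * (\<Prod>i\<in>I. if i \<in> B then f i else h i)"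
      by (rule prod.distrib)
    also have "(\<Prod>i\<in>I. if i \<in> B then -1 else (1::'a)) = (-1) ^ card B"
      using that IJ(3) by (simp add: prod.If_cases Int_absorb1)
    finally show ?thesis .
  qed
  have L: "?l B = base * (\<Prod>i\<in>I. if i \<in> B then - Lr i else Ls i)" if B: "B \<in> Pow I" for B
  proof -
    let ?n = "raise_rows B \<gamma>"
    have JB: "?n i = \<gamma> i" if "i \<notin> I" for i using that B by (auto simp: raise_rows_def)
    have "?w \<kappa> ?n i = ?w \<kappa> \<gamma> i" if "i \<in> J" for i
    proof -
      have "i \<notin> I" "i \<noteq> q+1 \<Longrightarrow> Suc i \<notin> I" using that by (auto simp: I_def J_def)
      then show ?thesis using JB by (cases "i = q+1") (auto simp: row_wt_def excess_def)
    qed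
    then have p1: "(\<Prod>i\<in>J. ?w \<kappa> ?n i) = base" unfolding base_def by simp
    have "?w \<kappa> ?n i = (if i \<in> B then Lr i else Ls i)" if "i \<in> I" for i
      using that by (auto simp: row_wt_def excess_def I_def Lr_def Ls_def raise_rows_def)
    then have p2: "(\<Prod>i\<in>I. ?w \<kappa> ?n i) = (\<Prod>i\<in>I. if i \<in> B then Lr i else Ls i)" by simp
    have p3: "step_wt l (\<lambda>_. x) (excess q x) \<kappa> ?n = base * (\<Prod>i\<in>I. if i \<in> B then Lr i else Ls i)"
      unfolding step_wt_def IJ(1) using IJ by (simp add: prod.union_disjoint p1 p2)
    have st: "?n \<in> states N" if nz: "base * (\<Prod>i\<in>I. if i \<in> B then Lr i else Ls i) \<noteq> 0"
    proof -
      have b: "base \<noteq> 0" using nz by auto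
      have *: "(if i \<in> B then Lr i else Ls i) \<noteq> 0" if "i \<in> I" for i
      proof
        assume "(if i \<in> B then Lr i else Ls i) = 0"
        then have "(\<Prod>i\<in>I. if i \<in> B then Lr i else Ls i) = 0"
          using that IJ(3) by (intro prod_zero bexI[of _ i])
        then show False using nz by simp
      qed
      have inter: "\<kappa> i \<le> ?n i \<and> ?n i \<le> \<kappa> (i-1)" if "i \<in> {1..N}" for i
      proof (cases "i \<in> I")
        case True
        then show ?thesis using *[OF True]
          by (auto simp: Lr_def Ls_def raise_rows_def split: if_splits)
      next
        case False
        then have "i \<in> J" using that IJ(1) by blast
        then show ?thesis using base_ok[OF b, of i] JB[OF False] \<open>i \<notin> I\<close> JB[of "i-1"]
          by simp
      qed
      have n0: "?n 0 = M" using JB[of 0] states_0[OF g] by (simp add: I_def)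
      have nN: "?n i = c" if "i > N" for i using JB[of i] states_const[OF g] that by (simp add: I_def)
      have "?n (Suc i) \<le> ?n i" for i
      proof -
        consider "i = 0" "N > 0" | "i > 0" "i < N" | "i = N" | "i > N" using q by linarith
        then show ?thesis
        proof cases
          case 1 then show ?thesis using inter[of 1] n0 states_0[OF k(1)] by auto
        next
          case 2 then show ?thesis using inter[of "Suc i"] inter[of i] by auto
        next
          case 3 then show ?thesis using inter[of N] nN[of "Suc i"] k(2) q by auto
        next
          case 4 then show ?thesis using nN by auto
        qed
      qed
      then show ?thesis using n0 nN by (auto simp: states_def)
    qed
    define P where "P = (\<Prod>i\<in>I. if i \<in> B then Lr i else Ls i)"
    have "base * ((-1) ^ card B * P) = (-1) ^ card B * (base * P)" by (rule mult.left_commute)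
    then show ?thesis unfolding p3 sgn[OF B] using st unfolding P_def[symmetric]
      by (cases "base * P = 0") simp_all
  qed
  have R: "?r B = base * (s (q+2) * (\<Prod>i\<in>I. if i \<in> B then - Rr i else Rs i))" if B: "B \<in> Pow I" for B
  proof -
    let ?d = "lower_rows B \<kappa>"
    have JB: "?d i = \<kappa> i" if "i \<notin> I" for i using that B by (auto simp: lower_rows_def)
    have "?w ?d \<gamma> i = ?w \<kappa> \<gamma> i" if "i \<in> J" for i
    proof -
      have "i \<notin> I" "i - 1 \<notin> I" using that by (auto simp: I_def J_def)
      then show ?thesis using JB by (auto simp: row_wt_def)
    qed
    then have p1: "(\<Prod>i\<in>J. ?w ?d \<gamma> i) = base" unfolding base_def by simp
    have wI: "?w ?d \<gamma> i = (if ?d i \<le> \<gamma> i \<and> \<gamma> i \<le> ?d (i-1) then x ^ (\<gamma> i - ?d i) else 0)" if "i \<in> I" for i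
      using that by (auto simp: row_wt_def excess_def I_def)
    have RI: "(if i \<in> B then Rr i else Rs i) = (if \<gamma> (Suc i) \<le> ?d i \<and> ?d i \<le> \<gamma> i then x ^ (\<gamma> i - ?d i) else 0)" for i
      by (auto simp: Rr_def Rs_def lower_rows_def)
    have p3: "step_wt l (\<lambda>_. x) (excess q x) ?d \<gamma> = base * (\<Prod>i\<in>I. ?w ?d \<gamma> i)"
      unfolding step_wt_def IJ(1) using IJ by (simp add: prod.union_disjoint p1)
    \<comment> \<open>\<open>A\<close> keeps the interlacing conditions where they arise,
      \<open>A'\<close> has them moved up by one row. The topmost one becomes a condition on the
      unchanged row \<open>q + 1\<close>, which \<open>s (q+2)\<close> absorbs.\<close>
    define A where "A \<longleftrightarrow> ?d \<in> states N \<and> (\<forall>i\<in>I. ?d i \<le> \<gamma> i \<and> \<gamma> i \<le> ?d (i-1))"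
    define A' where "A' \<longleftrightarrow> \<gamma> (q+2) \<le> \<kappa> (q+1) \<and> (\<forall>i\<in>I. \<gamma> (Suc i) \<le> ?d i \<and> ?d i \<le> \<gamma> i)"
    have kd: "?d (q+1) = \<kappa> (q+1)" by (rule JB) (simp add: I_def)
    have AA: "A \<longleftrightarrow> A'" if b: "base \<noteq> 0"
    proof
      assume A: A
      have "\<gamma> (q+2) \<le> \<kappa> (q+1)"
      proof (cases "q+2 \<in> I")
        case True then show ?thesis using A kd unfolding A_def by fastforce
      next
        case False
        then have "q+2 > N" by (auto simp: I_def)
        then show ?thesis using states_const[OF g, of "q+2"] states_ge[OF k(1)] by auto
      qed
      moreover have "\<gamma> (Suc i) \<le> ?d i" if "i \<in> I" for i
      proof (cases "Suc i \<in> I")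
        case True then show ?thesis using A unfolding A_def by fastforce
      next
        case False
        then have "Suc i > N" using that by (auto simp: I_def)
        then show ?thesis using A states_const[OF g, of "Suc i"] states_ge[of ?d N i] by (auto simp: A_def)
      qed
      ultimately show A' using A unfolding A_def A'_def by blast
    next
      assume A': A'
      have bnd: "\<gamma> (Suc i) \<le> ?d i" if "i > q" for i
      proof -
        have "i = q+1 \<or> i \<in> I \<or> i > N" using that by (auto simp: I_def)
        then consider "i = q+1" | "i \<in> I" | "i > N" by blast
        then show ?thesis
        proof cases
          case 1 then show ?thesis using A' kd by (simp add: A'_def)
        next
          case 2 then show ?thesis using A' by (simp add: A'_def)
        next
          case 3 then show ?thesis using states_const[OF g, of "Suc i"] states_const[OF k(1), of i] JB[of i]
            by (simp add: I_def)
        qed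
      qed
      have "?d (Suc i) \<le> ?d i" for i
      proof (cases "i > q")
        case True
        show ?thesis
        proof (cases "Suc i \<in> I")
          case True then show ?thesis using A' bnd[OF \<open>i > q\<close>] by (force simp: A'_def)
        next
          case False
          then have N: "Suc i > N" using \<open>i > q\<close> by (auto simp: I_def)
          have "?d (Suc i) = \<gamma> (Suc i)" using JB[OF False] states_const[OF k(1) N] states_const[OF g N] by simp
          then show ?thesis using bnd[OF \<open>i > q\<close>] by simp
        qed
      next
        case False
        then have "i \<notin> I" "Suc i \<notin> I" by (auto simp: I_def)
        then show ?thesis using JB states_mono[OF k(1), of i "Suc i"] by simp
      qed
      moreover have "?d 0 = M" "\<And>i. i > N \<Longrightarrow> ?d i = c"
        using JB states_0[OF k(1)] states_const[OF k(1)] by (auto simp: I_def)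
      ultimately have "?d \<in> states N" by (simp add: states_def)
      moreover have "\<gamma> i \<le> ?d (i-1)" if "i \<in> I" for i
        using bnd[of "i-1"] that by (auto simp: I_def)
      ultimately show A using A' by (auto simp: A_def A'_def)
    qed
    have v1: "(if ?d \<in> states N then \<Prod>i\<in>I. ?w ?d \<gamma> i else 0) = (if A then \<Prod>i\<in>I. x ^ (\<gamma> i - ?d i) else 0)"
    proof (cases A)
      case True
      then have "(\<Prod>i\<in>I. ?w ?d \<gamma> i) = (\<Prod>i\<in>I. x ^ (\<gamma> i - ?d i))"
        by (intro prod.cong refl) (simp only: wI A_def, simp)
      then show ?thesis using True by (simp add: A_def)
    next
      case False
      show ?thesis
      proof (cases "?d \<in> states N")
        case True
        then obtain i where "i \<in> I" "\<not> (?d i \<le> \<gamma> i \<and> \<gamma> i \<le> ?d (i-1))" using False by (auto simp: A_def)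
        then have "(\<Prod>i\<in>I. ?w ?d \<gamma> i) = 0" using IJ(3) wI by (intro prod_zero) auto
        then show ?thesis using False by simp
      qed (use False in simp)
    qed
    have v2: "(if \<gamma> (q+2) \<le> \<kappa> (q+1) then \<Prod>i\<in>I. if i \<in> B then Rr i else Rs i else 0) =
         (if A' then \<Prod>i\<in>I. x ^ (\<gamma> i - ?d i) else 0)"
    proof (cases A')
      case True
      then have "(\<Prod>i\<in>I. if i \<in> B then Rr i else Rs i) = (\<Prod>i\<in>I. x ^ (\<gamma> i - ?d i))"
        by (intro prod.cong refl) (simp only: RI A'_def, simp)
      then show ?thesis using True by (simp add: A'_def)
    next
      case False
      show ?thesis
      proof (cases "\<gamma> (q+2) \<le> \<kappa> (q+1)")
        case True
        then obtain i where "i \<in> I" "\<not> (\<gamma> (Suc i) \<le> ?d i \<and> ?d i \<le> \<gamma> i)" using False by (auto simp: A'_def)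
        then have "(\<Prod>i\<in>I. if i \<in> B then Rr i else Rs i) = 0" using IJ(3) RI by (intro prod_zero) auto
        then show ?thesis using False by simp
      qed (use False in simp)
    qed
    define t where "t = (if \<gamma> (q+2) < \<kappa> (q+1) then 1 - x else 1)"
    have ts: "s (q+2) * y = t * (if \<gamma> (q+2) \<le> \<kappa> (q+1) then y else 0)" for y
      by (auto simp: s_def t_def)
    have "?r B = (-1) ^ card B * (base * t * (if ?d \<in> states N then \<Prod>i\<in>I. ?w ?d \<gamma> i else 0))"
      by (simp add: p3 t_def algebra_simps)
    also have "\<dots> = (-1) ^ card B * (base * t *
        (if \<gamma> (q+2) \<le> \<kappa> (q+1) then \<Prod>i\<in>I. if i \<in> B then Rr i else Rs i else 0))"
    proof (cases "base = 0")
      case False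
      then show ?thesis by (simp only: v1 v2 AA[OF False])
    qed simp
    also have "\<dots> = base * (s (q+2) * (\<Prod>i\<in>I. if i \<in> B then - Rr i else Rs i))"
      unfolding sgn[OF B] ts by (simp add: algebra_simps)
    finally show ?thesis .
  qed
  have tele: "s (q+2) * (\<Prod>i\<in>{q+2..m}. Rs i - Rr i) = (\<Prod>i\<in>{q+2..m}. Ls i - Lr i) * s (Suc m)"
    if "q+1 \<le> m" for m
    using that
  proof (induction m rule: dec_induct)
    case base then show ?case by simp
  next
    case (step m)
    have ss: "s (Suc m) * (Rs (Suc m) - Rr (Suc m)) = (Ls (Suc m) - Lr (Suc m)) * s (Suc (Suc m))"
      unfolding s_def Rs_def Rr_def Ls_def Lr_def diff_Suc_1
      by (rule row_exchange) (use states_mono[OF k(1), of m "Suc m"] c_pos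
        states_mono[OF g, of "Suc m" "Suc (Suc m)"] states_ge[OF k(1), of "Suc m"] in auto)
    have iv: "{q+2..Suc m} = insert (Suc m) {q+2..m}" using step by auto
    have "s (q+2) * (\<Prod>i\<in>{q+2..Suc m}. Rs i - Rr i) =
        (s (q+2) * (\<Prod>i\<in>{q+2..m}. Rs i - Rr i)) * (Rs (Suc m) - Rr (Suc m))"
      unfolding iv by (simp add: algebra_simps)
    also have "\<dots> = (\<Prod>i\<in>{q+2..m}. Ls i - Lr i) * (s (Suc m) * (Rs (Suc m) - Rr (Suc m)))"
      by (simp only: step.IH mult.assoc)
    also have "\<dots> = (\<Prod>i\<in>{q+2..Suc m}. Ls i - Lr i) * s (Suc (Suc m))"
      unfolding ss iv by (simp add: algebra_simps)
    finally show ?case .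
  qed
  \<comment> \<open>The factor that reaches the bottom compares \<open>\<gamma> (Suc N)\<close> with
    \<open>\<kappa> N\<close>. Both are \<open>c\<close>, which is the purpose of the hypothesis
    \<open>\<kappa> N = c\<close>.\<close>
  have sN: "s (Suc N) = 1" using k(2) states_const[OF g, of "Suc N"] by (simp add: s_def)
  have "(\<Sum>B\<in>Pow I. ?l B) = base * (\<Prod>i\<in>I. - Lr i + Ls i)"
    using IJ(3) by (simp only: L sum_Pow_prod flip: sum_distrib_left cong: sum.cong)
  also have "\<dots> = base * (s (q+2) * (\<Prod>i\<in>I. - Rr i + Rs i))"
    using tele[of N] q unfolding I_def sN by simp
  also have "\<dots> = (\<Sum>B\<in>Pow I. ?r B)"
    using IJ(3) by (simp only: R sum_Pow_prod flip: sum_distrib_left cong: sum.cong)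
  finally show ?thesis unfolding I_def .
qed

text \<open>Identifies all lengths of row \<open>r\<close> up to \<open>a\<close>. For
  \<open>a = l r\<close> these are the lengths at which the row has no box, and by
  \<open>strip_inverse\<close> the composite \<open>E D\<close> sees a vector only up to this
  identification.\<close>

definition raise_to :: "nat \<Rightarrow> nat \<Rightarrow> (nat \<Rightarrow> nat) \<Rightarrow> nat \<Rightarrow> nat" where
  "raise_to r a \<gamma> = \<gamma>(r := max (\<gamma> r) a)"

text \<open>A term with \<open>g < t \<le> b\<close> is
  \<open>x ^ (b - t) - x ^ (b - t + 1)\<close>, so the sum telescopes from its first term
  \<open>x ^ (b - g)\<close>. Because of \<open>k \<le> g\<close> the range starts early enough to
  contain that term, and what precedes it is 0.\<close>

lemma collapse_telescope:
  fixes x :: "'a::comm_ring_1"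
  assumes "g \<le> b" "k \<le> g"
  shows "(\<Sum>t\<in>{k..a}. (if t \<le> b \<and> g \<le> t then x ^ (b - t) else 0) * (if g < t then 1 - x else 1)) =
         (if g \<le> a then x ^ (b - min a b) else 0)"
proof (cases "g \<le> a")
  case True
  have tele: "(\<Sum>t\<in>{g..m}. x ^ (b - t) * (if g < t then 1 - x else 1)) = x ^ (b - m)"
    if "g \<le> m" "m \<le> b" for m
    using that
  proof (induction m rule: dec_induct)
    case base then show ?case by simp
  next
    case (step m)
    have e: "b - m = Suc (b - Suc m)" using step by simp
    have "(\<Sum>t\<in>{g..Suc m}. x ^ (b - t) * (if g < t then 1 - x else 1)) =
        x ^ (b - m) + x ^ (b - Suc m) * (1 - x)"
      using step by (simp add: le_SucI)
    then show ?case unfolding e by (simp add: algebra_simps)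
  qed
  have "(\<Sum>t\<in>{k..a}. (if t \<le> b \<and> g \<le> t then x ^ (b - t) else 0) * (if g < t then 1 - x else 1)) =
      (\<Sum>t\<in>{g..min a b}. x ^ (b - t) * (if g < t then 1 - x else 1))"
    using assms by (intro sum.mono_neutral_cong_right) auto
  also have "\<dots> = x ^ (b - min a b)" using True assms by (intro tele) auto
  finally show ?thesis using True by simp
next
  case False
  then show ?thesis by (auto intro!: sum.neutral)
qed

text \<open>
  Summing over the lengths of row \<open>q + 1\<close> below its initial length \<open>l (q + 1)\<close> telescopes; the result is the weight
  without an additional label in that row as long as it is empty.
\<close>

lemma strip_collapse:
  fixes x :: "'a::comm_ring_1"
  assumes l: "l \<in> states N" and d: "\<delta> \<in> states N" "\<And>i. l i \<le> \<delta> i" and g: "\<gamma> \<in> states N" and q: "q < N"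
  shows "(\<Sum>\<beta> | \<beta> \<in> states N \<and> raise_to (q+1) (l (q+1)) \<beta> = \<delta>.
            step_wt l (\<lambda>_. x) (excess q x) \<beta> \<gamma> * (if \<gamma> (q+2) < \<beta> (q+1) then 1 - x else 1)) =
         (if raise_to (q+1) (l (q+1)) \<gamma> \<in> states N
          then step_wt l (\<lambda>_. x) (excess (q+1) x) \<delta> (raise_to (q+1) (l (q+1)) \<gamma>) else 0)"
    (is "(\<Sum>\<beta> | \<beta> \<in> states N \<and> ?up \<beta> = \<delta>. ?f \<beta>) = ?R")
proof -
  let ?r = "q+1"
  let ?w = "row_wt l (\<lambda>_. x) (excess q x)"
  let ?w' = "row_wt l (\<lambda>_. x) (excess (q+1) x)"
  have r: "?r \<in> {1..N}" using q by simp
  have zero: "step_wt l (\<lambda>_. x) z \<kappa> \<nu> = 0"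
    if "i \<in> {1..N}" "\<not> (\<kappa> i \<le> \<nu> i \<and> \<nu> i \<le> \<kappa> (i-1))" for i z \<kappa> \<nu>
    unfolding step_wt_def using that by (intro prod_zero bexI[of _ i]) (auto simp: row_wt_def)
  show ?thesis
  proof (cases "l ?r < \<delta> ?r")
    case True
    have "{\<beta>. \<beta> \<in> states N \<and> ?up \<beta> = \<delta>} = {\<delta>}"
      using True d(1) by (auto simp: raise_to_def fun_eq_iff max_def split: if_splits)
    then have L: "(\<Sum>\<beta> | \<beta> \<in> states N \<and> ?up \<beta> = \<delta>. ?f \<beta>) = ?f \<delta>" by simp
    show ?thesis
    proof (cases "l ?r \<le> \<gamma> ?r")
      case le: True
      then have up: "?up \<gamma> = \<gamma>" by (auto simp: raise_to_def max_def)
      have "(\<Prod>i\<in>{1..N} - {?r}. ?w' \<delta> \<gamma> i) = (\<Prod>i\<in>{1..N} - {?r}. ?w \<delta> \<gamma> i)"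
        by (rule prod.cong) (auto simp: row_wt_def excess_def)
      moreover have "?w' \<delta> \<gamma> ?r = ?w \<delta> \<gamma> ?r * (if \<gamma> (q+2) < \<delta> ?r then 1 - x else 1)"
        using True by (auto simp: row_wt_def excess_def)
      ultimately have "step_wt l (\<lambda>_. x) (excess (q+1) x) \<delta> \<gamma> = ?f \<delta>"
        unfolding step_wt_def prod.remove[OF finite_atLeastAtMost r] by (simp add: algebra_simps)
      then show ?thesis using L up g by simp
    next
      case False
      have "?f \<delta> = 0" using zero[OF r, of \<delta> \<gamma>] True False by simp
      moreover have "?R = 0" using zero[OF r, of \<delta> "?up \<gamma>"] True False
        by (auto simp: raise_to_def max_def)
      ultimately show ?thesis using L by simp
    qed
  next
    case False
    then have dr: "\<delta> ?r = l ?r" using d(2)[of ?r] by simp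
    define b where "b t = \<delta>(?r := t)" for t
    have set: "{\<beta>. \<beta> \<in> states N \<and> ?up \<beta> = \<delta>} = b ` {\<delta> (q+2)..l ?r}"
    proof safe
      fix \<beta> assume b: "\<beta> \<in> states N" "\<delta> = ?up \<beta>"
      have "\<beta> = b (\<beta> ?r)" using b by (auto simp: b_def raise_to_def)
      moreover have "\<beta> ?r \<in> {\<delta> (q+2)..l ?r}"
        using b dr states_mono[OF b(1), of ?r "q+2"] by (auto simp: raise_to_def)
      ultimately show "\<beta> \<in> b ` {(?up \<beta>) (q+2)..l ?r}" using b(2) by blast
    next
      fix t assume t: "t \<in> {\<delta> (q+2)..l ?r}"
      have "b t (Suc i) \<le> b t i" for i
        using t dr states_mono[OF d(1), of i "Suc i"] by (auto simp: b_def)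
      then show "b t \<in> states N" using q states_const[OF d(1)] states_0[OF d(1)]
        by (auto simp: states_def b_def)
      show "?up (b t) = \<delta>" using t dr by (auto simp: raise_to_def b_def max_def)
    qed
    have inj: "inj_on b {\<delta> (q+2)..l ?r}" by (rule inj_onI) (metis b_def fun_upd_same)
    have L: "(\<Sum>\<beta> | \<beta> \<in> states N \<and> ?up \<beta> = \<delta>. ?f \<beta>) = (\<Sum>t\<in>{\<delta> (q+2)..l ?r}. ?f (b t))"
      unfolding set by (rule sum.reindex_cong[OF inj]) auto
    show ?thesis
    proof (cases "?up \<gamma> \<in> states N")
      case up: False
      \<comment> \<open>Raising can break monotonicity only against row \<open>q\<close>. Then
        \<open>\<gamma> q < l (q+1) \<le> l q \<le> \<delta> q\<close>, so row \<open>q\<close>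
        already makes every summand on the left 0.\<close>
      have "\<gamma> q < l ?r"
      proof (rule ccontr)
        assume a: "\<not> ?thesis"
        have "?up \<gamma> (Suc i) \<le> ?up \<gamma> i" for i
          using a states_mono[OF g, of i "Suc i"] by (auto simp: raise_to_def)
        then have "?up \<gamma> \<in> states N" using q states_const[OF g] states_0[OF g]
          by (auto simp: states_def raise_to_def)
        then show False using up by simp
      qed
      then have gq: "\<gamma> q < \<delta> q" using states_mono[OF l, of q ?r] d(2)[of q] by simp
      moreover have "q \<noteq> 0"
        using gq states_0[OF g] states_0[OF d(1)] by (metis less_irrefl)
      ultimately have "?f (b t) = 0" for t using q zero[of q "b t" \<gamma>] by (simp add: b_def)
      then show ?thesis using L up by simp
    next
      case up: True
      let ?u = "?up \<gamma>"
      have rows: "row_wt l (\<lambda>_. x) (excess q x) (b t) \<gamma> i = row_wt l (\<lambda>_. x) (excess (q+1) x) \<delta> ?u i"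
        if "i \<in> {1..N} - {?r, q+2}" for i t
      proof (cases "i = q")
        case True
        \<comment> \<open>Row \<open>q\<close> can take a further label only if it is nonempty, and
          then \<open>l (q+1) \<le> l q < \<delta> q\<close>; raising row \<open>q + 1\<close> to
          \<open>l (q+1)\<close> cannot affect the comparison.\<close>
        have "\<gamma> ?r < \<delta> q \<longleftrightarrow> ?u ?r < \<delta> q" if "l q < \<delta> q"
          using that states_mono[OF l, of q ?r] by (auto simp: raise_to_def)
        then show ?thesis using that True
          by (auto simp: row_wt_def b_def raise_to_def excess_def)
      next
        case False
        then show ?thesis using that
          by (auto simp: row_wt_def b_def raise_to_def excess_def)
      qed
      define P where "P = (\<Prod>i\<in>{1..N} - {?r, q+2}. ?w' \<delta> ?u i)"
      \<comment> \<open>\<open>h\<close> and \<open>e\<close> are the parts of the weights of rows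
        \<open>q + 1\<close> and \<open>q + 2\<close> that do not depend on the summation variable;
        \<open>e\<close> is 1 if row \<open>q + 2\<close> lies beyond \<open>N\<close>.\<close>
      define h where "h = (if \<gamma> ?r \<le> \<delta> q then 1 else (0::'a))"
      define e where "e = (if q+2 \<le> N then if \<delta> (q+2) \<le> \<gamma> (q+2) then x ^ (\<gamma> (q+2) - \<delta> (q+2)) else 0 else (1::'a))"
      have split: "(\<Prod>i\<in>{1..N}. F i) = F ?r * (if q+2 \<le> N then F (q+2) else 1) * (\<Prod>i\<in>{1..N} - {?r, q+2}. F i)"
        for F :: "nat \<Rightarrow> 'a"
      proof (cases "q+2 \<le> N")
        case True
        then have "{1..N} = insert ?r (insert (q+2) ({1..N} - {?r, q+2}))" by auto
        then have "(\<Prod>i\<in>{1..N}. F i) = (\<Prod>i\<in>insert ?r (insert (q+2) ({1..N} - {?r, q+2})). F i)" by simp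
        also have "\<dots> = F ?r * F (q+2) * (\<Prod>i\<in>{1..N} - {?r, q+2}. F i)"
          by (simp add: algebra_simps)
        finally show ?thesis using True by simp
      next
        case False
        then have "{1..N} - {?r, q+2} = {1..N} - {?r}" by auto
        then show ?thesis using False prod.remove[OF finite_atLeastAtMost r, of F] by simp
      qed
      have g2: "\<gamma> (q+2) = c" "\<delta> (q+2) = c" if "\<not> q+2 \<le> N"
        using that states_const[OF g] states_const[OF d(1)] by auto
      have ft: "?f (b t) = P * h * e *
          ((if t \<le> \<gamma> ?r \<and> \<gamma> (q+2) \<le> t then x ^ (\<gamma> ?r - t) else 0) * (if \<gamma> (q+2) < t then 1 - x else 1))"
        if "\<delta> (q+2) \<le> t" for t
      proof -
        have "(\<Prod>i\<in>{1..N} - {?r, q+2}. ?w (b t) \<gamma> i) = P"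
          unfolding P_def by (rule prod.cong[OF refl rows])
        moreover have "?w (b t) \<gamma> ?r = h * (if t \<le> \<gamma> ?r then x ^ (\<gamma> ?r - t) else 0)"
          by (auto simp: row_wt_def b_def excess_def h_def)
        moreover have "(if q+2 \<le> N then ?w (b t) \<gamma> (q+2) else 1) = e * (if \<gamma> (q+2) \<le> t then 1 else 0)"
          using g2 that by (cases "q+2 \<le> N") (auto simp: row_wt_def b_def excess_def e_def)
        ultimately have "step_wt l (\<lambda>_. x) (excess q x) (b t) \<gamma> =
            h * (if t \<le> \<gamma> ?r then x ^ (\<gamma> ?r - t) else 0) * (e * (if \<gamma> (q+2) \<le> t then 1 else 0)) * P"
          unfolding step_wt_def split by simp
        then show ?thesis by (simp add: b_def algebra_simps)
      qed
      have R: "step_wt l (\<lambda>_. x) (excess (q+1) x) \<delta> ?u =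
         P * h * e * (if \<gamma> (q+2) \<le> l ?r then x ^ (\<gamma> ?r - min (l ?r) (\<gamma> ?r)) else 0)"
      proof -
        have "?w' \<delta> ?u ?r = h * x ^ (\<gamma> ?r - min (l ?r) (\<gamma> ?r))"
          using dr states_mono[OF d(1), of q ?r] by (auto simp: row_wt_def raise_to_def h_def max_def min_def)
        moreover have "(if q+2 \<le> N then ?w' \<delta> ?u (q+2) else 1) = e * (if \<gamma> (q+2) \<le> l ?r then 1 else 0)"
          using dr g2 states_ge[OF l, of ?r]
          by (cases "q+2 \<le> N") (auto simp: row_wt_def raise_to_def e_def excess_def)
        ultimately show ?thesis unfolding step_wt_def split P_def by (simp add: algebra_simps)
      qed
      define T where "T = (\<Sum>t\<in>{\<delta> (q+2)..l ?r}.
          (if t \<le> \<gamma> ?r \<and> \<gamma> (q+2) \<le> t then x ^ (\<gamma> ?r - t) else 0) * (if \<gamma> (q+2) < t then 1 - x else 1))"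
      have L': "(\<Sum>t\<in>{\<delta> (q+2)..l ?r}. ?f (b t)) = P * h * e * T"
        unfolding T_def sum_distrib_left by (rule sum.cong[OF refl ft]) simp
      \<comment> \<open>Telescoping needs a lower limit of at most \<open>\<gamma> (q+2)\<close>.
        Where this fails, the weight of row \<open>q + 2\<close> is 0; beyond \<open>N\<close> both
        lengths equal \<open>c\<close>.\<close>
      have "e = 0 \<or> \<delta> (q+2) \<le> \<gamma> (q+2)" using g2 by (auto simp: e_def)
      then have "e * T = e * (if \<gamma> (q+2) \<le> l ?r then x ^ (\<gamma> ?r - min (l ?r) (\<gamma> ?r)) else 0)"
        using collapse_telescope[of "\<gamma> (q+2)" "\<gamma> ?r" "\<delta> (q+2)" x "l ?r"]
          states_mono[OF g, of ?r "q+2"] by (auto simp: T_def)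
      then show ?thesis unfolding L L' R using up by (simp add: mult.assoc)
    qed
  qed
qed

end

section \<open>Chains of strips\<close>

context strips
begin

text \<open>The value is forced to 0 outside \<open>states N\<close>, so that raised vectors that
  are no longer decreasing need no separate treatment.\<close>

primrec chain :: "(nat \<Rightarrow> (nat \<Rightarrow> nat) \<Rightarrow> (nat \<Rightarrow> nat) \<Rightarrow> 'a::comm_ring_1) \<Rightarrow>
    ((nat \<Rightarrow> nat) \<Rightarrow> 'a) \<Rightarrow> nat \<Rightarrow> (nat \<Rightarrow> nat) \<Rightarrow> 'a" where
  "chain w f 0 \<nu> = (if \<nu> \<in> states N then f \<nu> else 0)"
| "chain w f (Suc k) \<nu> = (if \<nu> \<in> states N then \<Sum>\<kappa>\<in>states N. w (Suc k) \<kappa> \<nu> * chain w f k \<kappa> else 0)"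

text \<open>The operator \<open>D\<close>. Lowering the left boundary adds boxes to the skew region,
  so the boundaries \<open>l'\<close> are those obtained by attaching a horizontal strip on the
  left.\<close>

definition drops :: "nat \<Rightarrow> (nat \<Rightarrow> nat) \<Rightarrow> (nat \<Rightarrow> nat) set" where
  "drops r l = {l' \<in> states N. \<forall>i. l' i \<le> l i \<and> (if r \<le> i then l (Suc i) \<le> l' i else l' i = l i)}"

definition strip_wt :: "nat \<Rightarrow> (nat \<Rightarrow> nat) \<Rightarrow> (nat \<Rightarrow> 'a::comm_ring_1) \<Rightarrow>
    nat \<Rightarrow> (nat \<Rightarrow> nat) \<Rightarrow> (nat \<Rightarrow> nat) \<Rightarrow> 'a" where
  "strip_wt r l X k = step_wt l (\<lambda>_. X k) (excess r (X k))"

lemma chain_outside: "\<nu> \<notin> states N \<Longrightarrow> chain w f k \<nu> = 0"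
  by (cases k) auto

lemma chain_sum: "chain w (\<lambda>\<nu>. \<Sum>a\<in>A. f a \<nu>) k \<nu> = (\<Sum>a\<in>A. chain w (f a) k \<nu>)"
proof (induction k arbitrary: \<nu>)
  case 0
  then show ?case by simp
next
  case (Suc k)
  then show ?case by (simp add: sum_distrib_left sum.swap[of _ A])
qed

lemma step_wt_interlace:
  assumes "step_wt l x z \<kappa> \<nu> \<noteq> 0" "i \<in> {1..N}"
  shows "\<kappa> i \<le> \<nu> i" "\<nu> i \<le> \<kappa> (i - 1)"
proof -
  have "row_wt l x z \<kappa> \<nu> i \<noteq> 0"
    using assms unfolding step_wt_def by (metis finite_atLeastAtMost prod_zero)
  then show "\<kappa> i \<le> \<nu> i" "\<nu> i \<le> \<kappa> (i - 1)" by (auto simp: row_wt_def split: if_splits)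
qed

lemma step_wt_mono:
  assumes "step_wt l x z \<kappa> \<nu> \<noteq> 0" "\<kappa> \<in> states N" "\<nu> \<in> states N"
  shows "\<kappa> i \<le> \<nu> i"
  using step_wt_interlace(1)[OF assms(1), of i] assms(2,3)
  by (cases "i \<in> {1..N}") (auto simp: states_def not_le)

text \<open>Since \<open>\<nu> i \<le> \<kappa> (i - 1)\<close>, a horizontal strip enters at most
  one new row, so \<open>k\<close> of them reach at most row \<open>n + k\<close>. This keeps row
  \<open>N\<close> free for \<open>strip_commute\<close>.\<close>

lemma chain_support:
  assumes w: "\<And>k. w k = step_wt (l' k) (x k) (z k)"
    and f: "\<And>\<nu>. f \<nu> \<noteq> 0 \<Longrightarrow> \<nu> \<in> states n \<and> (\<forall>i. l i \<le> \<nu> i)"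
    and nz: "chain w f k \<nu> \<noteq> 0"
  shows "\<nu> \<in> states (n + k)" "l i \<le> \<nu> i"
proof -
  have "\<nu> \<in> states (n + k) \<and> (\<forall>i. l i \<le> \<nu> i)"
    using nz
  proof (induction k arbitrary: \<nu>)
    case 0
    then show ?case using f by (auto split: if_splits)
  next
    case (Suc k)
    then have nu: "\<nu> \<in> states N" and "(\<Sum>\<kappa>\<in>states N. w (Suc k) \<kappa> \<nu> * chain w f k \<kappa>) \<noteq> 0"
      by (auto split: if_splits)
    then obtain \<kappa> where k: "\<kappa> \<in> states N" "w (Suc k) \<kappa> \<nu> * chain w f k \<kappa> \<noteq> 0"
      by (meson sum.neutral)
    then have w0: "step_wt (l' (Suc k)) (x (Suc k)) (z (Suc k)) \<kappa> \<nu> \<noteq> 0" and "chain w f k \<kappa> \<noteq> 0"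
      by (auto simp: w)
    then have ih: "\<kappa> \<in> states (n + k)" "\<And>i. l i \<le> \<kappa> i" using Suc.IH by auto
    have "\<nu> i = c" if "n + Suc k < i" for i
    proof (cases "i \<in> {1..N}")
      case True
      have "\<nu> i \<le> \<kappa> (i - 1)" by (rule step_wt_interlace(2)[OF w0 True])
      also have "\<dots> = c" using states_const[OF ih(1)] that by simp
      finally show ?thesis using states_ge[OF nu, of i] by simp
    next
      case False
      then show ?thesis using that states_const[OF nu, of i] by auto
    qed
    then have "\<nu> \<in> states (n + Suc k)" using nu by (auto simp: states_def)
    moreover have "l i \<le> \<nu> i" for i
      using ih(2)[of i] step_wt_mono[OF w0 k(1) nu, of i] by simp
    ultimately show ?case by blast
  qed
  then show "\<nu> \<in> states (n + k)" "l i \<le> \<nu> i" by auto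
qed

text \<open>The cancellation behind the vanishing of the alternating sum of
  \<open>e_j h_(m-j)\<close>: signed vertical strips invert horizontal strips in the rows below
  \<open>q + 1\<close>. Row \<open>q + 1\<close> belongs to the horizontal strip only, so its
  shortening survives.\<close>

lemma strip_inverse:
  assumes l: "l \<in> states N" and g: "\<gamma> \<in> states N" and q: "q < N"
  shows "(\<Sum>B\<in>Pow {q+2..N}. (-1) ^ card B * (if raise_rows B \<gamma> \<in> drops (q+1) l then 1 else 0)) =
         (if raise_to (q+1) (l (q+1)) \<gamma> = l then 1 else (0::'a::comm_ring_1))"
proof -
  define I where "I = {q+2..N}"
  have fin: "finite I" by (simp add: I_def)
  define b where "b \<longleftrightarrow> (\<forall>i\<le>q. \<gamma> i = l i) \<and> l (q+2) \<le> \<gamma> (q+1) \<and> \<gamma> (q+1) \<le> l (q+1)"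
  define h where "h i t = (if l (Suc i) \<le> t \<and> t \<le> l i then 1 else (0::'a))" for i t
  have tm: "(-1) ^ card B * (if raise_rows B \<gamma> \<in> drops (q+1) l then 1 else 0) =
      (if b then \<Prod>i\<in>I. if i \<in> B then - h i (Suc (\<gamma> i)) else h i (\<gamma> i) else 0)" if B: "B \<in> Pow I" for B
  proof -
    let ?n = "raise_rows B \<gamma>"
    have nI: "?n i = \<gamma> i" if "i \<notin> I" for i using that B by (auto simp: raise_rows_def)
    have iff: "?n \<in> drops (q+1) l \<longleftrightarrow> b \<and> (\<forall>i\<in>I. l (Suc i) \<le> ?n i \<and> ?n i \<le> l i)"
    proof
      assume D: "?n \<in> drops (q+1) l"
      have "?n i \<le> l i" "if q+1 \<le> i then l (Suc i) \<le> ?n i else ?n i = l i" for i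
        using D unfolding drops_def by blast+
      note D' = this
      have "\<gamma> i = l i" if "i \<le> q" for i
        using D'(2)[of i] nI[of i] that by (simp add: I_def)
      moreover have "l (q+2) \<le> \<gamma> (q+1)" "\<gamma> (q+1) \<le> l (q+1)"
        using D'[of "q+1"] nI[of "q+1"] by (simp_all add: I_def)
      moreover have "l (Suc i) \<le> ?n i \<and> ?n i \<le> l i" if "i \<in> I" for i
        using D'[of i] that by (simp add: I_def)
      ultimately show "b \<and> (\<forall>i\<in>I. l (Suc i) \<le> ?n i \<and> ?n i \<le> l i)" by (auto simp: b_def)
    next
      assume A: "b \<and> (\<forall>i\<in>I. l (Suc i) \<le> ?n i \<and> ?n i \<le> l i)"
      have c: "?n i = l i \<and> \<not> q+1 \<le> i \<or> l (Suc i) \<le> ?n i \<and> ?n i \<le> l i \<and> q+1 \<le> i" for i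
      proof -
        have "i \<le> q \<or> i = q+1 \<or> i \<in> I \<or> N < i" by (auto simp: I_def)
        then show ?thesis
          using A nI[of i] states_const[OF l, of i] states_const[OF l, of "Suc i"] states_const[OF g, of i] q
          by (auto simp: b_def I_def)
      qed
      have "?n (Suc i) \<le> ?n i" for i
        using c[of i] c[of "Suc i"] states_mono[OF l, of i "Suc i"] by auto
      moreover have "?n 0 = M" "\<And>i. N < i \<Longrightarrow> ?n i = c"
        using nI states_0[OF g] states_const[OF g] by (auto simp: I_def)
      ultimately have "?n \<in> states N" by (simp add: states_def)
      moreover have "?n i \<le> l i \<and> (if q+1 \<le> i then l (Suc i) \<le> ?n i else ?n i = l i)" for i
        using c[of i] by auto
      ultimately show "?n \<in> drops (q+1) l" unfolding drops_def by blast
    qed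
    have "(\<Prod>i\<in>I. if i \<in> B then - h i (Suc (\<gamma> i)) else h i (\<gamma> i)) =
        (\<Prod>i\<in>I. (if i \<in> B then -1 else 1) * h i (?n i))"
      by (rule prod.cong) (auto simp: raise_rows_def)
    also have "\<dots> = (-1) ^ card B * (\<Prod>i\<in>I. h i (?n i))"
      using B fin by (simp add: prod.distrib prod.If_cases Int_absorb1)
    also have "(\<Prod>i\<in>I. h i (?n i)) = (if \<forall>i\<in>I. l (Suc i) \<le> ?n i \<and> ?n i \<le> l i then 1 else 0)"
      using fin by (auto simp: h_def intro!: prod_zero)
    finally show ?thesis using iff by auto
  qed
  \<comment> \<open>Rows are treated from the bottom upwards. The difference is 1 at
    \<open>\<gamma> i = l i\<close> and -1 at \<open>\<gamma> i = l (Suc i) - 1\<close>; once row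
    \<open>i + 1\<close> agrees with \<open>l\<close>, monotonicity of \<gamma> excludes the second
    case.\<close>
  have pr: "(\<Prod>i\<in>{m..N}. - h i (Suc (\<gamma> i)) + h i (\<gamma> i)) = (if \<forall>i\<in>{m..N}. \<gamma> i = l i then 1 else 0)"
    if "m \<le> Suc N" for m
    using that
  proof (induction m rule: inc_induct)
    case base then show ?case by simp
  next
    case (step m)
    have iv: "{m..N} = insert m {Suc m..N}" using step by auto
    show ?case
    proof (cases "\<forall>i\<in>{Suc m..N}. \<gamma> i = l i")
      case True
      have "l (Suc m) \<le> \<gamma> m"
      proof (cases "m < N")
        case less: True
        then have "\<gamma> (Suc m) = l (Suc m)" using True by simp
        then show ?thesis using states_mono[OF g, of m "Suc m"] by simp
      next
        case False
        then show ?thesis using states_const[OF l, of "Suc m"] states_ge[OF g] step by simp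
      qed
      then have "- h m (Suc (\<gamma> m)) + h m (\<gamma> m) = (if \<gamma> m = l m then 1 else 0)"
        by (auto simp: h_def)
      then show ?thesis unfolding iv using step.IH True by simp
    next
      case False
      then show ?thesis unfolding iv using step.IH by auto
    qed
  qed
  have fin_iff: "raise_to (q+1) (l (q+1)) \<gamma> = l \<longleftrightarrow> b \<and> (\<forall>i\<in>I. \<gamma> i = l i)"
  proof
    assume e: "raise_to (q+1) (l (q+1)) \<gamma> = l"
    have ne: "\<gamma> i = l i" if "i \<noteq> q+1" for i using fun_cong[OF e, of i] that by (simp add: raise_to_def)
    have "\<gamma> (q+1) \<le> l (q+1)" using fun_cong[OF e, of "q+1"] by (simp add: raise_to_def)
    then show "b \<and> (\<forall>i\<in>I. \<gamma> i = l i)"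
      using ne ne[of "q+2"] states_mono[OF g, of "q+1" "q+2"] by (auto simp: b_def I_def)
  next
    assume A: "b \<and> (\<forall>i\<in>I. \<gamma> i = l i)"
    show "raise_to (q+1) (l (q+1)) \<gamma> = l"
    proof
      fix i
      have "i \<le> q \<or> i = q+1 \<or> i \<in> I \<or> N < i" by (auto simp: I_def)
      then show "raise_to (q+1) (l (q+1)) \<gamma> i = l i"
        using A states_const[OF l, of i] states_const[OF g, of i]
        by (auto simp: raise_to_def b_def I_def max_def)
    qed
  qed
  have "(\<Sum>B\<in>Pow I. (-1) ^ card B * (if raise_rows B \<gamma> \<in> drops (q+1) l then 1 else (0::'a))) =
      (\<Sum>B\<in>Pow I. if b then \<Prod>i\<in>I. if i \<in> B then - h i (Suc (\<gamma> i)) else h i (\<gamma> i) else 0)"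
    by (rule sum.cong[OF refl tm])
  also have "\<dots> = (if b then \<Prod>i\<in>I. - h i (Suc (\<gamma> i)) + h i (\<gamma> i) else 0)"
    using sum_Pow_prod[OF fin, of "\<lambda>i. - h i (Suc (\<gamma> i))" "\<lambda>i. h i (\<gamma> i)"] by simp
  also have "\<dots> = (if raise_to (q+1) (l (q+1)) \<gamma> = l then 1 else 0)"
  proof -
    have "(\<Prod>i\<in>I. - h i (Suc (\<gamma> i)) + h i (\<gamma> i)) = (if \<forall>i\<in>I. \<gamma> i = l i then 1 else 0)"
      unfolding I_def by (rule pr) (use q in simp)
    then show ?thesis unfolding fin_iff by (cases b) (simp_all only: simp_thms if_True if_False)
  qed
  finally show ?thesis unfolding I_def .
qed

text \<open>The operator \<open>E\<close>, acting on functions of the right boundary.\<close>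

definition strip_sum :: "nat \<Rightarrow> ((nat \<Rightarrow> nat) \<Rightarrow> 'a::comm_ring_1) \<Rightarrow> (nat \<Rightarrow> nat) \<Rightarrow> 'a" where
  "strip_sum r f \<gamma> = (\<Sum>B\<in>Pow {Suc r..N}. (-1) ^ card B * f (raise_rows B \<gamma>))"

lemma strip_sum_step:
  fixes x :: "'a::comm_ring_1"
  assumes f: "\<And>\<kappa>. f \<kappa> \<noteq> 0 \<Longrightarrow> \<kappa> \<in> states N \<and> \<kappa> N = c" and g: "\<gamma> \<in> states N" and q: "q < N"
  shows "strip_sum (q+1) (\<lambda>\<nu>. if \<nu> \<in> states N
              then \<Sum>\<kappa>\<in>states N. step_wt l (\<lambda>_. x) (excess q x) \<kappa> \<nu> * f \<kappa> else 0) \<gamma> =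
         (\<Sum>\<beta>\<in>states N. step_wt l (\<lambda>_. x) (excess q x) \<beta> \<gamma> *
            (if \<gamma> (q+2) < \<beta> (q+1) then 1 - x else 1) * strip_sum (q+1) f \<beta>)"
proof -
  let ?w = "step_wt l (\<lambda>_. x) (excess q x)"
  let ?w' = "\<lambda>\<beta>. ?w \<beta> \<gamma> * (if \<gamma> (q+2) < \<beta> (q+1) then 1 - x else 1)"
  let ?I = "Pow {q+2..N}"
  \<comment> \<open>Substitute \<kappa> for \<open>raise_rows B \<beta>\<close>; lowering inverts
    raising because all lengths are at least \<open>c > 0\<close>. Vectors outside
    \<open>states N\<close> drop out since \<open>f\<close> vanishes there.\<close>
  have re: "(\<Sum>\<beta>\<in>states N. ?w' \<beta> * f (raise_rows B \<beta>)) =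
      (\<Sum>\<kappa>\<in>states N. (if lower_rows B \<kappa> \<in> states N then ?w' (lower_rows B \<kappa>) else 0) * f \<kappa>)" for B
  proof -
    have rl: "raise_rows B (lower_rows B \<kappa>) = \<kappa>" if "\<kappa> \<in> states N" for \<kappa>
    proof
      fix i show "raise_rows B (lower_rows B \<kappa>) i = \<kappa> i"
        using states_ge[OF that, of i] c_pos by (simp add: raise_rows_def lower_rows_def)
    qed
    have f0: "\<kappa> \<notin> states N \<Longrightarrow> f \<kappa> = 0" for \<kappa> using f by blast
    have lr: "lower_rows B (raise_rows B \<kappa>) = \<kappa>" for \<kappa>
      by (simp add: raise_rows_def lower_rows_def fun_eq_iff)
    have "(\<Sum>\<beta>\<in>states N. ?w' \<beta> * f (raise_rows B \<beta>)) =
        (\<Sum>\<beta>\<in>{\<beta> \<in> states N. raise_rows B \<beta> \<in> states N}. ?w' \<beta> * f (raise_rows B \<beta>))"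
      by (intro sum.mono_neutral_right finite_states) (auto simp: f0)
    also have "\<dots> = (\<Sum>\<kappa>\<in>{\<kappa> \<in> states N. lower_rows B \<kappa> \<in> states N}. ?w' (lower_rows B \<kappa>) * f \<kappa>)"
      by (rule sum.reindex_bij_witness[of _ "lower_rows B" "raise_rows B"]) (auto simp: rl lr)
    also have "\<dots> = (\<Sum>\<kappa>\<in>states N. (if lower_rows B \<kappa> \<in> states N then ?w' (lower_rows B \<kappa>) else 0) * f \<kappa>)"
      by (intro sum.mono_neutral_cong_left finite_states) auto
    finally show ?thesis .
  qed
  have "strip_sum (q+1) (\<lambda>\<nu>. if \<nu> \<in> states N then \<Sum>\<kappa>\<in>states N. ?w \<kappa> \<nu> * f \<kappa> else 0) \<gamma> =
      (\<Sum>B\<in>?I. \<Sum>\<kappa>\<in>states N. f \<kappa> * ((-1) ^ card B * (if raise_rows B \<gamma> \<in> states N then ?w \<kappa> (raise_rows B \<gamma>) else 0)))"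
    unfolding strip_sum_def by (intro sum.cong) (auto simp: sum_distrib_left mult_ac)
  also have "\<dots> = (\<Sum>\<kappa>\<in>states N. f \<kappa> * (\<Sum>B\<in>?I. (-1) ^ card B * (if raise_rows B \<gamma> \<in> states N then ?w \<kappa> (raise_rows B \<gamma>) else 0)))"
    by (subst sum.swap) (simp only: sum_distrib_left)
  also have "\<dots> = (\<Sum>\<kappa>\<in>states N. f \<kappa> * (\<Sum>B\<in>?I. (-1) ^ card B *
       (if lower_rows B \<kappa> \<in> states N then ?w' (lower_rows B \<kappa>) else 0)))"
  proof (intro sum.cong refl)
    fix \<kappa> assume k: "\<kappa> \<in> states N"
    show "f \<kappa> * (\<Sum>B\<in>?I. (-1) ^ card B * (if raise_rows B \<gamma> \<in> states N then ?w \<kappa> (raise_rows B \<gamma>) else 0)) =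
      f \<kappa> * (\<Sum>B\<in>?I. (-1) ^ card B * (if lower_rows B \<kappa> \<in> states N then ?w' (lower_rows B \<kappa>) else 0))"
    proof (cases "f \<kappa> = 0")
      case False
      then have kN: "\<kappa> N = c" using f by blast
      have lw: "lower_rows B \<kappa> (q+1) = \<kappa> (q+1)" if "B \<in> ?I" for B
        using that by (auto simp: lower_rows_def)
      show ?thesis unfolding strip_commute[OF k kN g q]
        by (rule arg_cong[where f = "(*) (f \<kappa>)"], rule sum.cong[OF refl]) (simp only: lw)
    qed simp
  qed
  also have "\<dots> = (\<Sum>B\<in>?I. (-1) ^ card B * (\<Sum>\<kappa>\<in>states N. (if lower_rows B \<kappa> \<in> states N then ?w' (lower_rows B \<kappa>) else 0) * f \<kappa>))"
    unfolding sum_distrib_left by (subst sum.swap) (simp only: mult_ac)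
  also have "\<dots> = (\<Sum>B\<in>?I. (-1) ^ card B * (\<Sum>\<beta>\<in>states N. ?w' \<beta> * f (raise_rows B \<beta>)))"
    by (simp only: re)
  also have "\<dots> = (\<Sum>\<beta>\<in>states N. ?w' \<beta> * strip_sum (q+1) f \<beta>)"
    unfolding strip_sum_def sum_distrib_left by (subst sum.swap) (simp add: mult_ac)
  finally show ?thesis .
qed

text \<open>Induction along the chain with \<open>raise_to\<close> as the invariant:
  \<open>strip_inverse\<close> starts it, \<open>strip_sum_step\<close> moves \<open>E\<close> past
  one transfer matrix, and \<open>strip_collapse\<close> sums over the vectors with the same raised
  image, which adds the missing factor in row \<open>q + 1\<close>.\<close>

lemma strip_sum_chain:
  fixes X :: "nat \<Rightarrow> 'a::comm_ring_1"
  assumes l: "l \<in> states n" and q: "q < N" and nk: "n + k \<le> N" and g: "\<gamma> \<in> states N"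
  shows "strip_sum (q+1) (chain (strip_wt q l X) (\<lambda>\<nu>. if \<nu> \<in> drops (q+1) l then 1 else 0) k) \<gamma> =
         chain (strip_wt (q+1) l X) (\<lambda>\<nu>. if \<nu> = l then 1 else 0) k (raise_to (q+1) (l (q+1)) \<gamma>)"
  using nk g
proof (induction k arbitrary: \<gamma>)
  case 0
  have lN: "l \<in> states N" using l 0 states_subset[of n N] by auto
  have "strip_sum (q+1) (chain (strip_wt q l X) (\<lambda>\<nu>. if \<nu> \<in> drops (q+1) l then 1 else 0) 0) \<gamma> =
     (\<Sum>B\<in>Pow {q+2..N}. (-1) ^ card B * (if raise_rows B \<gamma> \<in> drops (q+1) l then 1 else 0))"
    unfolding strip_sum_def by (rule sum.cong) (auto simp: drops_def)
  also have "\<dots> = (if raise_to (q+1) (l (q+1)) \<gamma> = l then 1 else 0)"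
    by (rule strip_inverse[OF lN 0(2) q])
  also have "\<dots> = chain (strip_wt (q+1) l X) (\<lambda>\<nu>. if \<nu> = l then 1 else 0) 0 (raise_to (q+1) (l (q+1)) \<gamma>)"
    using lN by simp
  finally show ?case .
next
  case (Suc k)
  let ?up = "raise_to (q+1) (l (q+1))"
  let ?x = "X (Suc k)"
  let ?w = "step_wt l (\<lambda>_. ?x) (excess q ?x)"
  let ?Y = "chain (strip_wt q l X) (\<lambda>\<nu>. if \<nu> \<in> drops (q+1) l then 1 else 0) k"
  let ?Z = "chain (strip_wt (q+1) l X) (\<lambda>\<nu>. if \<nu> = l then 1 else 0) k"
  have lN: "l \<in> states N" using l Suc.prems(1) states_subset[of n N] by auto
  have wY: "strip_wt q l X j = step_wt l (\<lambda>_. X j) (excess q (X j))"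
    and wZ: "strip_wt (q+1) l X j = step_wt l (\<lambda>_. X j) (excess (q+1) (X j))" for j
    by (simp_all add: strip_wt_def)
  \<comment> \<open>After \<open>k\<close> steps at most \<open>n + k < N\<close> rows are occupied,
    so row \<open>N\<close> still has length \<open>c\<close>, as \<open>strip_sum_step\<close>
    requires.\<close>
  have Y: "\<kappa> \<in> states N \<and> \<kappa> N = c" if nz: "?Y \<kappa> \<noteq> 0" for \<kappa>
  proof -
    have "\<kappa> \<in> states (n + k)"
    proof (rule chain_support(1)[OF wY _ nz])
      fix \<nu> assume "(if \<nu> \<in> drops (q+1) l then 1 else 0) \<noteq> (0::'a)"
      then have D: "\<nu> \<in> drops (q+1) l" by (auto split: if_splits)
      have "\<nu> i = c" if "n < i" for i
        using D states_const[OF l that] states_ge[of \<nu> N i] unfolding drops_def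
        by (metis (mono_tags, lifting) le_antisym mem_Collect_eq)
      then show "\<nu> \<in> states n \<and> (\<forall>i. 0 \<le> \<nu> i)" using D by (auto simp: drops_def states_def)
    qed
    then show ?thesis using Suc.prems(1) states_const[of \<kappa> "n + k" N] states_subset[of "n+k" N] by auto
  qed
  have Z: "l i \<le> \<kappa> i" if nz: "?Z \<kappa> \<noteq> 0" for \<kappa> i
    by (rule chain_support(2)[OF wZ _ nz, where n = n and l = l]) (use l in \<open>auto split: if_splits\<close>)
  have "strip_sum (q+1) (chain (strip_wt q l X) (\<lambda>\<nu>. if \<nu> \<in> drops (q+1) l then 1 else 0) (Suc k)) \<gamma> =
      strip_sum (q+1) (\<lambda>\<nu>. if \<nu> \<in> states N then \<Sum>\<kappa>\<in>states N. ?w \<kappa> \<nu> * ?Y \<kappa> else 0) \<gamma>"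
    unfolding strip_sum_def by (simp only: chain.simps wY)
  also have "\<dots> = (\<Sum>\<beta>\<in>states N. ?w \<beta> \<gamma> * (if \<gamma> (q+2) < \<beta> (q+1) then 1 - ?x else 1) * strip_sum (q+1) ?Y \<beta>)"
    by (rule strip_sum_step[OF Y Suc.prems(2) q])
  also have "\<dots> = (\<Sum>\<beta>\<in>states N. ?w \<beta> \<gamma> * (if \<gamma> (q+2) < \<beta> (q+1) then 1 - ?x else 1) * ?Z (?up \<beta>))"
    using Suc.IH Suc.prems(1) by (intro sum.cong refl) simp
  \<comment> \<open>The induction hypothesis depends on \<beta> only through its raised vector
    \<delta>, so the sum is regrouped by \<delta>. Nonzero terms have
    \<open>l i \<le> \<delta> i\<close>, and \<open>strip_collapse\<close> applies to each
    class.\<close>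
  also have "\<dots> = (\<Sum>\<beta>\<in>states N. \<Sum>\<delta>\<in>states N. if ?up \<beta> = \<delta>
      then ?w \<beta> \<gamma> * (if \<gamma> (q+2) < \<beta> (q+1) then 1 - ?x else 1) * ?Z \<delta> else 0)"
    by (intro sum.cong refl) (simp add: finite_states chain_outside)
  also have "\<dots> = (\<Sum>\<delta>\<in>states N. \<Sum>\<beta>\<in>states N. if ?up \<beta> = \<delta>
      then ?w \<beta> \<gamma> * (if \<gamma> (q+2) < \<beta> (q+1) then 1 - ?x else 1) * ?Z \<delta> else 0)"
    by (rule sum.swap)
  also have "\<dots> = (\<Sum>\<delta>\<in>states N. (\<Sum>\<beta> | \<beta> \<in> states N \<and> ?up \<beta> = \<delta>.
      ?w \<beta> \<gamma> * (if \<gamma> (q+2) < \<beta> (q+1) then 1 - ?x else 1)) * ?Z \<delta>)"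
    unfolding sum_distrib_right
    by (intro sum.cong refl sum.mono_neutral_cong_right finite_states) auto
  also have "\<dots> = (\<Sum>\<delta>\<in>states N. (if ?up \<gamma> \<in> states N then step_wt l (\<lambda>_. ?x) (excess (q+1) ?x) \<delta> (?up \<gamma>) else 0) * ?Z \<delta>)"
  proof (intro sum.cong refl)
    fix \<delta> assume d: "\<delta> \<in> states N"
    show "(\<Sum>\<beta> | \<beta> \<in> states N \<and> ?up \<beta> = \<delta>.
      ?w \<beta> \<gamma> * (if \<gamma> (q+2) < \<beta> (q+1) then 1 - ?x else 1)) * ?Z \<delta> =
      (if ?up \<gamma> \<in> states N then step_wt l (\<lambda>_. ?x) (excess (q+1) ?x) \<delta> (?up \<gamma>) else 0) * ?Z \<delta>"
    proof (cases "?Z \<delta> = 0")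
      case False
      show ?thesis by (subst strip_collapse[OF lN d Z[OF False] Suc.prems(2) q]) simp
    qed simp
  qed
  also have "\<dots> = chain (strip_wt (q+1) l X) (\<lambda>\<nu>. if \<nu> = l then 1 else 0) (Suc k) (?up \<gamma>)"
    using wZ[of "Suc k"] by simp
  finally show ?case .
qed

lemma step_wt_cong:
  assumes "\<And>i. i \<in> {1..r} \<Longrightarrow> l i = l' i"
  shows "step_wt l x (excess r y) = step_wt l' x (excess r y)"
proof (intro ext)
  fix \<kappa> \<nu> :: "nat \<Rightarrow> nat"
  show "step_wt l x (excess r y) \<kappa> \<nu> = step_wt l' x (excess r y) \<kappa> \<nu>"
    unfolding step_wt_def by (rule prod.cong) (use assms in \<open>auto simp: row_wt_def excess_def\<close>)
qed

text \<open>As \<open>u\<close> lies to the right of \<open>l\<close>, raising does nothing to it.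
  The weights for \<open>q\<close> see the left boundary only in rows up to \<open>q\<close>, where
  \<open>l'\<close> and \<open>l\<close> agree; hence each summand may use its own \<open>l'\<close>
  and is again a hybrid generating function.\<close>

lemma uncrowd_row:
  fixes X :: "nat \<Rightarrow> 'a::comm_ring_1"
  assumes l: "l \<in> states n" and q: "q < N" and nk: "n + k \<le> N" and u: "u \<in> states N"
    and lu: "\<And>i. l i \<le> u i"
  shows "chain (strip_wt (q+1) l X) (\<lambda>\<nu>. if \<nu> = l then 1 else 0) k u =
         (\<Sum>B\<in>Pow {q+2..N}. (-1) ^ card B * (\<Sum>l'\<in>drops (q+1) l.
            chain (strip_wt q l' X) (\<lambda>\<nu>. if \<nu> = l' then 1 else 0) k (raise_rows B u)))"
proof -
  have fin: "finite (drops (q+1) l)"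
    using finite_subset[OF _ finite_states[of N]] by (auto simp: drops_def)
  have up: "raise_to (q+1) (l (q+1)) u = u" using lu[of "q+1"] by (auto simp: raise_to_def max_def)
  have ind: "(\<lambda>\<nu>. if \<nu> \<in> drops (q+1) l then 1 else 0) = (\<lambda>\<nu>. \<Sum>l'\<in>drops (q+1) l. if \<nu> = l' then 1 else (0::'a))"
    by (rule ext) (use fin in simp)
  have "chain (strip_wt q l X) f k \<nu> = chain (strip_wt q l' X) f k \<nu>" if "l' \<in> drops (q+1) l" for l' f \<nu>
  proof -
    have "strip_wt q l X = strip_wt q l' X"
      unfolding strip_wt_def
      by (intro ext, subst step_wt_cong[where l' = l']) (use that in \<open>auto simp: drops_def\<close>)
    then show ?thesis by simp
  qed
  then show ?thesis
    using strip_sum_chain[OF l q nk u, of X]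
    unfolding up ind chain_sum strip_sum_def by (simp cong: sum.cong)
qed

end

section \<open>Removing the largest label from a tableau\<close>

text \<open>
  Set-valued tableaux for arbitrary weak (\<open>R\<close>) and strict (\<open>Q\<close>) order conditions. The smallest label \<open>k\<close> of a box \<open>b\<close>
  has weight \<open>x k b\<close>, every other one \<open>z k b\<close>; so \<open>z = 0\<close> leaves the ordinary tableaux and \<open>z = -x\<close> gives the signs of \<open>G\<^sub>\<sigma>\<close>.
\<close>

definition svtab :: "(box \<Rightarrow> box \<Rightarrow> bool) \<Rightarrow> (box \<Rightarrow> box \<Rightarrow> bool) \<Rightarrow> nat \<Rightarrow> box set \<Rightarrow> (box \<Rightarrow> nat set) set" where
  "svtab R Q k D = {T \<in> D \<rightarrow>\<^sub>E {A. A \<noteq> {} \<and> A \<subseteq> {1..k}}.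
     \<forall>b\<in>D. \<forall>b'\<in>D. (R b b' \<longrightarrow> (\<forall>i\<in>T b. \<forall>j\<in>T b'. i \<le> j)) \<and> (Q b b' \<longrightarrow> (\<forall>i\<in>T b. \<forall>j\<in>T b'. i < j))}"

definition tab_wt :: "(nat \<Rightarrow> box \<Rightarrow> 'a::comm_ring_1) \<Rightarrow> (nat \<Rightarrow> box \<Rightarrow> 'a) \<Rightarrow> box set \<Rightarrow> (box \<Rightarrow> nat set) \<Rightarrow> 'a" where
  "tab_wt x z D T = (\<Prod>b\<in>D. x (Min (T b)) b * (\<Prod>i\<in>T b - {Min (T b)}. z i b))"

definition tab_sum :: "(box \<Rightarrow> box \<Rightarrow> bool) \<Rightarrow> (box \<Rightarrow> box \<Rightarrow> bool) \<Rightarrow> (nat \<Rightarrow> box \<Rightarrow> 'a::comm_ring_1) \<Rightarrow>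
    (nat \<Rightarrow> box \<Rightarrow> 'a) \<Rightarrow> nat \<Rightarrow> box set \<Rightarrow> 'a" where
  "tab_sum R Q x z k D = (\<Sum>T\<in>svtab R Q k D. tab_wt x z D T)"

text \<open>
  \<open>U\<close> is the set of boxes containing only the largest label and \<open>F\<close> the set of boxes containing it besides smaller ones.
\<close>

definition peelable :: "(box \<Rightarrow> box \<Rightarrow> bool) \<Rightarrow> (box \<Rightarrow> box \<Rightarrow> bool) \<Rightarrow> box set \<Rightarrow> box set \<Rightarrow> box set \<Rightarrow> bool" where
  "peelable R Q D U F \<longleftrightarrow> F \<subseteq> D - U \<and>
     (\<forall>b\<in>D. \<forall>b'\<in>D. (R b b' \<and> b \<in> U \<union> F \<longrightarrow> b' \<in> U) \<and> (Q b b' \<longrightarrow> b \<notin> U \<union> F))"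

lemma finite_svtab: "finite D \<Longrightarrow> finite (svtab R Q k D)"
  by (rule finite_subset[of _ "D \<rightarrow>\<^sub>E Pow {1..k}"], force simp: svtab_def PiE_def Pi_def)
    (intro finite_PiE, auto)

lemma svtabD:
  assumes "T \<in> svtab R Q k D"
  shows "b \<in> D \<Longrightarrow> T b \<noteq> {}" "b \<in> D \<Longrightarrow> T b \<subseteq> {1..k}" "b \<notin> D \<Longrightarrow> T b = undefined"
    "\<lbrakk>b \<in> D; b' \<in> D; R b b'; i \<in> T b; j \<in> T b'\<rbrakk> \<Longrightarrow> i \<le> j"
    "\<lbrakk>b \<in> D; b' \<in> D; Q b b'; i \<in> T b; j \<in> T b'\<rbrakk> \<Longrightarrow> i < j"
proof -
  have T: "T \<in> D \<rightarrow>\<^sub>E {A. A \<noteq> {} \<and> A \<subseteq> {1..k}}" using assms by (simp add: svtab_def)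
  show "b \<in> D \<Longrightarrow> T b \<noteq> {}" "b \<in> D \<Longrightarrow> T b \<subseteq> {1..k}" using PiE_mem[OF T, of b] by auto
  show "b \<notin> D \<Longrightarrow> T b = undefined" using PiE_arb[OF T] .
qed (use assms in \<open>auto simp: svtab_def\<close>)

lemma svtabI:
  assumes "\<And>b. b \<in> D \<Longrightarrow> T b \<noteq> {}" "\<And>b. b \<in> D \<Longrightarrow> T b \<subseteq> {1..k}" "\<And>b. b \<notin> D \<Longrightarrow> T b = undefined"
    "\<And>b b' i j. \<lbrakk>b \<in> D; b' \<in> D; R b b'; i \<in> T b; j \<in> T b'\<rbrakk> \<Longrightarrow> i \<le> j"
    "\<And>b b' i j. \<lbrakk>b \<in> D; b' \<in> D; Q b b'; i \<in> T b; j \<in> T b'\<rbrakk> \<Longrightarrow> i < j"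
  shows "T \<in> svtab R Q k D"
  using assms unfolding svtab_def PiE_def Pi_def extensional_def by blast

text \<open>The order conditions involving the largest label say only where it may sit, which is
  \<open>peelable\<close>; the others are the conditions on \<open>D - U\<close>. A box of
  \<open>F\<close> keeps its smaller minimum when the largest label joins, so it gains a factor
  \<open>z\<close>, whereas in a box of \<open>U\<close> that label is the minimum and costs
  \<open>x\<close>.\<close>

lemma tab_sum_peel:
  fixes x z :: "nat \<Rightarrow> box \<Rightarrow> 'a::comm_ring_1"
  assumes D: "finite D"
  shows "tab_sum R Q x z (Suc k) D =
    (\<Sum>U\<in>Pow D. \<Sum>F | peelable R Q D U F.
       (\<Prod>b\<in>U. x (Suc k) b) * (\<Prod>b\<in>F. z (Suc k) b) * tab_sum R Q x z k (D - U))"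
proof -
  let ?K = "Suc k"
  let ?P = "\<lambda>U. {F. peelable R Q D U F}"
  let ?S = "Sigma (Pow D) (\<lambda>U. ?P U \<times> svtab R Q k (D - U))"
  define join where "join = (\<lambda>(U :: box set, F :: box set, T :: box \<Rightarrow> nat set) (b :: box). if b \<in> U then {?K} else if b \<in> F then insert ?K (T b) else T b)"
  define top where "top T = {b \<in> D. T b = {?K}}" for T :: "box \<Rightarrow> nat set"
  define sp where "sp T = (top T, {b \<in> D. ?K \<in> T b \<and> T b \<noteq> {?K}}, restrict (\<lambda>b. T b - {?K}) (D - top T))" for T
  have finP: "finite (?P U)" for U
    by (rule finite_subset[of _ "Pow D"]) (use D in \<open>auto simp: peelable_def\<close>)
  have "(\<Sum>U\<in>Pow D. \<Sum>F | peelable R Q D U F.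
       (\<Prod>b\<in>U. x ?K b) * (\<Prod>b\<in>F. z ?K b) * tab_sum R Q x z k (D - U)) =
     (\<Sum>U\<in>Pow D. \<Sum>(F, T)\<in>?P U \<times> svtab R Q k (D - U).
       (\<Prod>b\<in>U. x ?K b) * (\<Prod>b\<in>F. z ?K b) * tab_wt x z (D - U) T)"
    by (simp add: tab_sum_def sum_distrib_left sum.cartesian_product)
  also have "\<dots> = (\<Sum>(U, F, T)\<in>?S. (\<Prod>b\<in>U. x ?K b) * (\<Prod>b\<in>F. z ?K b) * tab_wt x z (D - U) T)"
    using D finP finite_svtab by (subst sum.Sigma) auto
  also have "\<dots> = tab_sum R Q x z (Suc k) D"
    unfolding tab_sum_def
  proof (rule sum.reindex_bij_witness[of _ sp join])
    fix p assume p: "p \<in> ?S"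
    obtain U F T where pe: "p = (U, F, T)" by (cases p) auto
    have U: "U \<subseteq> D" and pl: "peelable R Q D U F" and T: "T \<in> svtab R Q k (D - U)"
      using p pe by auto
    have F: "F \<subseteq> D" "F \<inter> U = {}" using pl by (auto simp: peelable_def)
    have v: "\<lbrakk>b \<in> D; b' \<in> D; R b b'; b \<in> U \<union> F\<rbrakk> \<Longrightarrow> b' \<in> U"
      "\<lbrakk>b \<in> D; b' \<in> D; Q b b'\<rbrakk> \<Longrightarrow> b \<notin> U \<union> F" for b b'
      using pl unfolding peelable_def by blast+
    note T = svtabD[OF T]
    let ?T = "join p"
    have jT: "?T b = (if b \<in> U then {?K} else if b \<in> F then insert ?K (T b) else T b)" for b
      by (simp add: pe join_def)
    have small: "i \<le> k" if "b \<in> D" "b \<notin> U" "i \<in> T b" for b i using T(2)[of b] that by auto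
    have noK: "?K \<notin> T b" if "b \<in> D" "b \<notin> U" for b using small[OF that] by fastforce
    show jn: "?T \<in> svtab R Q ?K D"
    proof (rule svtabI)
      fix b assume b: "b \<in> D"
      show "?T b \<noteq> {}" using T(1)[of b] b by (auto simp: jT)
      show "?T b \<subseteq> {1..?K}" using T(2)[of b] b by (auto simp: jT subset_iff le_Suc_eq)
    next
      fix b assume "b \<notin> D" then show "?T b = undefined" using T(3)[of b] U F by (auto simp: jT)
    next
      fix b b' i j assume a: "b \<in> D" "b' \<in> D" "R b b'" "i \<in> ?T b" "j \<in> ?T b'"
      show "i \<le> j"
      proof (cases "i = ?K")
        case True
        then have "b \<in> U \<union> F" using a noK by (auto simp: jT split: if_splits)
        then have "b' \<in> U" using v(1) a by blast
        then show ?thesis using a True by (simp add: jT)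
      next
        case False
        then have i: "b \<notin> U" "i \<in> T b" using a by (auto simp: jT split: if_splits)
        show ?thesis
        proof (cases "j = ?K")
          case True then show ?thesis using small[OF a(1) i] by simp
        next
          case False
          then have "b' \<notin> U" "j \<in> T b'" using a by (auto simp: jT split: if_splits)
          then show ?thesis using T(4)[of b b' i j] a i by blast
        qed
      qed
    next
      fix b b' i j assume a: "b \<in> D" "b' \<in> D" "Q b b'" "i \<in> ?T b" "j \<in> ?T b'"
      have bn: "b \<notin> U \<union> F" using v(2) a by blast
      then have i: "b \<notin> U" "i \<in> T b" using a by (auto simp: jT split: if_splits)
      show "i < j"
      proof (cases "j = ?K")
        case True then show ?thesis using small[OF a(1) i] by simp
      next
        case False
        then have "b' \<notin> U" "j \<in> T b'" using a by (auto simp: jT split: if_splits)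
        then show ?thesis using T(5)[of b b' i j] a i by blast
      qed
    qed
    have ins: "insert ?K (T b) \<noteq> {?K}" "T b \<noteq> {?K}" if "b \<in> D" "b \<notin> U" for b
      using noK[OF that] T(1)[of b] that by auto
    have "b \<in> top ?T \<longleftrightarrow> b \<in> U" for b
      using U ins[of b] unfolding top_def jT by (cases "b \<in> D"; cases "b \<in> U"; cases "b \<in> F") auto
    then have top: "top ?T = U" by blast
    have "b \<in> D \<and> ?K \<in> ?T b \<and> ?T b \<noteq> {?K} \<longleftrightarrow> b \<in> F" for b
      using F U ins[of b] noK[of b] unfolding jT by (cases "b \<in> D"; cases "b \<in> U"; cases "b \<in> F") auto
    then have "{b \<in> D. ?K \<in> ?T b \<and> ?T b \<noteq> {?K}} = F" by blast
    moreover have "restrict (\<lambda>b. ?T b - {?K}) (D - U) = T"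
    proof
      fix b show "restrict (\<lambda>b. ?T b - {?K}) (D - U) b = T b"
        using noK[of b] T(3)[of b] by (cases "b \<in> D - U") (auto simp: jT)
    qed
    ultimately show "sp (join p) = p" unfolding sp_def top by (simp add: pe)
    have fT: "finite (T b)" if "b \<in> D" "b \<notin> U" for b
      using T(2)[of b] that finite_subset by auto
    have MinF: "Min (insert ?K (T b)) = Min (T b)" if "b \<in> D" "b \<notin> U" for b
    proof -
      have ne: "T b \<noteq> {}" using T(1) that by auto
      have "Min (T b) \<le> k" using small[OF that] fT[OF that] ne by (meson Min_in)
      then show ?thesis unfolding Min_insert[OF fT[OF that] ne] by simp
    qed
    have "tab_wt x z D ?T =
       (\<Prod>b\<in>U. x ?K b) * (\<Prod>b\<in>D - U. x (Min (T b)) b * (\<Prod>i\<in>?T b - {Min (T b)}. z i b))"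
    proof -
      have "(\<Prod>b\<in>U. x (Min (?T b)) b * (\<Prod>i\<in>?T b - {Min (?T b)}. z i b)) = (\<Prod>b\<in>U. x ?K b)"
        by (rule prod.cong) (auto simp: jT)
      moreover have "(\<Prod>b\<in>D - U. x (Min (?T b)) b * (\<Prod>i\<in>?T b - {Min (?T b)}. z i b)) =
          (\<Prod>b\<in>D - U. x (Min (T b)) b * (\<Prod>i\<in>?T b - {Min (T b)}. z i b))"
        by (rule prod.cong) (auto simp: jT MinF)
      ultimately show ?thesis
        unfolding tab_wt_def by (simp only: prod.subset_diff[OF U D] mult.commute)
    qed
    also have "(\<Prod>b\<in>D - U. x (Min (T b)) b * (\<Prod>i\<in>?T b - {Min (T b)}. z i b)) =
        (\<Prod>b\<in>D - U. (if b \<in> F then z ?K b else 1) * (x (Min (T b)) b * (\<Prod>i\<in>T b - {Min (T b)}. z i b)))"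
    proof (rule prod.cong[OF refl])
      fix b assume b: "b \<in> D - U"
      show "x (Min (T b)) b * (\<Prod>i\<in>?T b - {Min (T b)}. z i b) =
          (if b \<in> F then z ?K b else 1) * (x (Min (T b)) b * (\<Prod>i\<in>T b - {Min (T b)}. z i b))"
      proof (cases "b \<in> F")
        case True
        have nk: "?K \<noteq> Min (T b)" using fT[of b] T(1)[of b] noK[of b] b Min_in by (metis DiffE)
        then have "?T b - {Min (T b)} = insert ?K (T b - {Min (T b)})"
          using True b by (auto simp: jT)
        then show ?thesis using True b noK[of b] fT[of b] by (simp add: mult_ac)
      next
        case False
        then show ?thesis using b by (simp add: jT)
      qed
    qed
    also have "\<dots> = (\<Prod>b\<in>F. z ?K b) * tab_wt x z (D - U) T"
    proof -
      have "(D - U) \<inter> {b. b \<in> F} = F" using F by auto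
      then show ?thesis using D by (simp add: prod.distrib prod.If_cases tab_wt_def)
    qed
    finally show "tab_wt x z D (join p) =
      (case p of (U, F, T) \<Rightarrow> (\<Prod>b\<in>U. x ?K b) * (\<Prod>b\<in>F. z ?K b) * tab_wt x z (D - U) T)"
      by (simp add: pe mult_ac)
  next
    fix T assume T0: "T \<in> svtab R Q ?K D"
    note T = svtabD[OF T0]
    have leK: "i \<le> ?K" if "b \<in> D" "i \<in> T b" for b i using T(2)[OF that(1)] that(2) by auto
    have topD: "b \<in> top T \<longleftrightarrow> b \<in> D \<and> T b = {?K}" for b by (auto simp: top_def)
    show "join (sp T) = T"
    proof
      fix b show "join (sp T) b = T b"
        using T(3)[of b] by (cases "b \<in> D"; cases "T b = {?K}") (auto simp: join_def sp_def topD)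
    qed
    have "peelable R Q D (top T) {b \<in> D. ?K \<in> T b \<and> T b \<noteq> {?K}}"
      unfolding peelable_def
    proof (intro conjI ballI impI)
      fix b b' assume b: "b \<in> D" "b' \<in> D" "R b b' \<and> b \<in> top T \<union> {b \<in> D. ?K \<in> T b \<and> T b \<noteq> {?K}}"
      then have K: "?K \<in> T b" by (auto simp: topD)
      have "j = ?K" if "j \<in> T b'" for j
        using T(4)[OF b(1,2) _ K that] b leK[OF b(2) that] by auto
      then show "b' \<in> top T" using T(1)[OF b(2)] b(2) by (auto simp: topD)
    next
      fix b b' assume b: "b \<in> D" "b' \<in> D" "Q b b'"
      show "b \<notin> top T \<union> {b \<in> D. ?K \<in> T b \<and> T b \<noteq> {?K}}"
      proof
        assume "b \<in> top T \<union> {b \<in> D. ?K \<in> T b \<and> T b \<noteq> {?K}}"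
        then have K: "?K \<in> T b" by (auto simp: topD)
        obtain j where j: "j \<in> T b'" using T(1)[OF b(2)] by auto
        show False using T(5)[OF b K j] leK[OF b(2) j] by simp
      qed
    qed (auto simp: topD)
    moreover have "restrict (\<lambda>b. T b - {?K}) (D - top T) \<in> svtab R Q k (D - top T)"
    proof (rule svtabI)
      fix b assume b: "b \<in> D - top T"
      show "restrict (\<lambda>b. T b - {?K}) (D - top T) b \<noteq> {}" using b T(1)[of b] by (auto simp: topD)
      show "restrict (\<lambda>b. T b - {?K}) (D - top T) b \<subseteq> {1..k}"
        using b T(2)[of b] by (auto simp: subset_iff le_Suc_eq)
    qed (use T(4,5) in auto)
    ultimately show "sp T \<in> ?S" by (auto simp: sp_def topD)
  qed
  finally show ?thesis ..
qed

section \<open>Tableaux on skew regions as chains\<close>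

definition skew_region :: "(nat \<Rightarrow> nat) \<Rightarrow> (nat \<Rightarrow> nat) \<Rightarrow> box set" where
  "skew_region l u = {(i, j). 1 \<le> i \<and> l i \<le> j \<and> j < u i}"

definition left_of :: "box \<Rightarrow> box \<Rightarrow> bool" where
  "left_of b b' \<longleftrightarrow> fst b = fst b' \<and> snd b < snd b'"

definition over :: "box \<Rightarrow> box \<Rightarrow> bool" where
  "over b b' \<longleftrightarrow> snd b = snd b' \<and> fst b < fst b'"

abbreviation row_sum :: "(nat \<Rightarrow> nat \<Rightarrow> 'a::comm_ring_1) \<Rightarrow> (nat \<Rightarrow> nat \<Rightarrow> 'a) \<Rightarrow> nat \<Rightarrow> box set \<Rightarrow> 'a" where
  "row_sum x z \<equiv> tab_sum left_of over (\<lambda>k b. x k (fst b)) (\<lambda>k b. z k (fst b))"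

lemma tab_sum_0: "tab_sum R Q x z 0 D = (if D = {} then 1 else 0)"
proof -
  have "svtab R Q 0 D = (if D = {} then {\<lambda>_. undefined} else {})"
    by (auto simp: svtab_def PiE_def extensional_def)
  then show ?thesis by (simp add: tab_sum_def tab_wt_def)
qed

lemma sum_Pow_prod_1:
  fixes f :: "'b \<Rightarrow> 'a::comm_ring_1"
  shows "finite C \<Longrightarrow> (\<Sum>F\<in>Pow C. \<Prod>b\<in>F. f b) = (\<Prod>b\<in>C. 1 + f b)"
  using prod_add[of C f "\<lambda>_. 1"] by (simp add: add.commute)

context strips
begin

section \<open>Skew regions described by the ends of their rows\<close>

lemma skew_region_Sigma:
  assumes "l \<in> states N" "u \<in> states N"
  shows "skew_region l u = Sigma {1..N} (\<lambda>i. {l i..<u i})"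
  using states_const[OF assms(1)] states_const[OF assms(2)]
  by (auto simp: skew_region_def) (metis leD le_less_trans not_le_imp_less)

lemma finite_skew_region: "l \<in> states N \<Longrightarrow> u \<in> states N \<Longrightarrow> finite (skew_region l u)"
  by (simp add: skew_region_Sigma)

lemma prod_skew_region:
  fixes f :: "nat \<Rightarrow> 'a::comm_ring_1"
  assumes "l \<in> states N" "u \<in> states N"
  shows "(\<Prod>b\<in>skew_region l u. f (fst b)) = (\<Prod>i\<in>{1..N}. f i ^ (u i - l i))"
  unfolding skew_region_Sigma[OF assms]
  by (subst prod.Sigma[symmetric, where g = "\<lambda>i j. f i", simplified split_def]) auto

lemma skew_region_empty_iff:
  assumes "l \<in> states N" "u \<in> states N" "\<And>i. l i \<le> u i"
  shows "skew_region l u = {} \<longleftrightarrow> u = l"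
proof
  assume e: "skew_region l u = {}"
  show "u = l"
  proof
    fix i
    have "(i, l i) \<notin> skew_region l u" using e by simp
    then show "u i = l i" using assms(3)[of i] states_0[OF assms(1)] states_0[OF assms(2)]
      by (cases "i = 0") (auto simp: skew_region_def)
  qed
qed (auto simp: skew_region_def)

definition interlaced :: "(nat \<Rightarrow> nat) \<Rightarrow> (nat \<Rightarrow> nat) \<Rightarrow> (nat \<Rightarrow> nat) set" where
  "interlaced l u = {\<kappa> \<in> states N. \<forall>i. l i \<le> \<kappa> i \<and> \<kappa> i \<le> u i \<and> u (Suc i) \<le> \<kappa> i}"

text \<open>The row condition makes \<open>U\<close> closed to the right, so each of its rows is
  known from its starting column. The column condition forbids a box of the region below a box of
  \<open>U\<close>, which is the inequality \<open>u (Suc i) \<le> \<kappa> i\<close>.\<close>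

lemma peelable_imp_interlaced:
  assumes l: "l \<in> states N" and u: "u \<in> states N" and lu: "\<And>i. l i \<le> u i"
    and U: "U \<subseteq> skew_region l u" and pl: "peelable left_of over (skew_region l u) U F"
  shows "U \<in> (\<lambda>\<kappa>. skew_region \<kappa> u) ` interlaced l u"
proof -
  let ?D = "skew_region l u"
  have R: "b' \<in> U" if "b \<in> U" "b' \<in> ?D" "left_of b b'" for b b'
    using pl U that unfolding peelable_def by blast
  have Q: "b \<notin> U" if "b \<in> ?D" "b' \<in> ?D" "over b b'" for b b'
    using pl that unfolding peelable_def by blast
  \<comment> \<open>The alternative \<open>u i \<le> j\<close> guarantees that a least column exists
    and yields the start \<open>u i\<close> for rows that \<open>U\<close> does not meet.\<close>
  define P where "P i j \<longleftrightarrow> l i \<le> j \<and> (u i \<le> j \<or> (i, j) \<in> U)" for i j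
  define \<kappa> where "\<kappa> i = (LEAST j. P i j)" for i
  have Pu: "P i (u i)" for i using lu by (simp add: P_def)
  have Pk: "P i (\<kappa> i)" for i unfolding \<kappa>_def by (rule LeastI[of "P i", OF Pu])
  have ku: "\<kappa> i \<le> u i" for i unfolding \<kappa>_def by (rule Least_le[of "P i", OF Pu])
  have lk: "l i \<le> \<kappa> i" for i using Pk[of i] by (simp add: P_def)
  have below: "\<not> P i j" if "j < \<kappa> i" for i j using that unfolding \<kappa>_def by (rule not_less_Least)
  have kU: "(i, \<kappa> i) \<in> U" if "\<kappa> i < u i" for i using Pk[of i] that by (auto simp: P_def)
  have k0: "\<kappa> 0 = M" using lk[of 0] ku[of 0] states_0[OF l] states_0[OF u] by simp
  have kN: "\<kappa> i = c" if "N < i" for i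
    using lk[of i] ku[of i] states_const[OF l that] states_const[OF u that] by simp
  have uk: "u (Suc i) \<le> \<kappa> i" for i
  proof (rule ccontr)
    assume "\<not> ?thesis"
    then have lt: "\<kappa> i < u (Suc i)" by simp
    also have le: "u (Suc i) \<le> u i" using states_mono[OF u] by simp
    finally have inU: "(i, \<kappa> i) \<in> U" by (rule kU)
    have "(Suc i, \<kappa> i) \<in> ?D"
      using lt lk[of i] states_mono[OF l, of i "Suc i"] by (simp add: skew_region_def)
    then show False using Q[of "(i, \<kappa> i)" "(Suc i, \<kappa> i)"] inU U by (auto simp: over_def)
  qed
  have "\<kappa> (Suc i) \<le> \<kappa> i" for i using ku[of "Suc i"] uk[of i] by simp
  then have "\<kappa> \<in> interlaced l u" using k0 kN lk ku uk by (auto simp: interlaced_def states_def)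
  moreover have "U = skew_region \<kappa> u"
  proof (intro set_eqI iffI)
    fix b assume b: "b \<in> U"
    then obtain i j where ij: "b = (i, j)" "1 \<le> i" "l i \<le> j" "j < u i" using U by (auto simp: skew_region_def)
    then have "P i j" using b by (simp add: P_def)
    then have "\<kappa> i \<le> j" using below[of j i] by (meson not_le)
    then show "b \<in> skew_region \<kappa> u" using ij by (simp add: skew_region_def)
  next
    fix b assume "b \<in> skew_region \<kappa> u"
    then obtain i j where ij: "b = (i, j)" "1 \<le> i" "\<kappa> i \<le> j" "j < u i" by (auto simp: skew_region_def)
    have inU: "(i, \<kappa> i) \<in> U" using ij by (intro kU) simp
    have "b \<in> ?D" using ij lk[of i] by (simp add: skew_region_def)
    then show "b \<in> U" using R[OF inU, of b] inU ij by (cases "j = \<kappa> i") (auto simp: left_of_def)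
  qed
  ultimately show ?thesis by blast
qed

definition corners :: "(nat \<Rightarrow> nat) \<Rightarrow> (nat \<Rightarrow> nat) \<Rightarrow> (nat \<Rightarrow> nat) \<Rightarrow> box set" where
  "corners l u \<kappa> = (\<lambda>i. (i, \<kappa> i - 1)) ` {i \<in> {1..N}. l i < \<kappa> i \<and> u (Suc i) < \<kappa> i}"

text \<open>To the right of a box in \<open>F\<close> there are only boxes of \<open>U\<close>, and
  below it none of the region; so it is the last box of its row before the strip. Corners do not
  constrain each other, so all subsets occur, and the sum over \<open>F\<close> becomes a product
  over rows.\<close>

lemma peelable_iff_corners:
  assumes l: "l \<in> states N" and u: "u \<in> states N" and k: "\<kappa> \<in> interlaced l u"
  shows "peelable left_of over (skew_region l u) (skew_region \<kappa> u) F \<longleftrightarrow> F \<subseteq> corners l u \<kappa>"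
proof -
  have ks: "\<kappa> \<in> states N" and kb: "l i \<le> \<kappa> i" "\<kappa> i \<le> u i" "u (Suc i) \<le> \<kappa> i" for i
    using k by (auto simp: interlaced_def)
  let ?D = "skew_region l u" and ?U = "skew_region \<kappa> u"
  have D: "(i, j) \<in> ?D \<longleftrightarrow> 1 \<le> i \<and> l i \<le> j \<and> j < u i" for i j by (simp add: skew_region_def)
  have U: "(i, j) \<in> ?U \<longleftrightarrow> 1 \<le> i \<and> \<kappa> i \<le> j \<and> j < u i" for i j by (simp add: skew_region_def)
  have C: "(i, j) \<in> corners l u \<kappa> \<longleftrightarrow> 1 \<le> i \<and> i \<le> N \<and> j = \<kappa> i - 1 \<and> l i < \<kappa> i \<and> u (Suc i) < \<kappa> i" for i j
    by (auto simp: corners_def)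
  show ?thesis
  proof
    assume pl: "peelable left_of over ?D ?U F"
    show "F \<subseteq> corners l u \<kappa>"
    proof (rule subrelI)
      fix i j assume F: "(i, j) \<in> F"
      have in_DU: "(i, j) \<in> ?D" "(i, j) \<notin> ?U" using pl F unfolding peelable_def by blast+
      then have ij: "1 \<le> i" "l i \<le> j" "j < \<kappa> i" using D U by auto
      have j: "j = \<kappa> i - 1"
      proof (rule ccontr)
        assume "j \<noteq> \<kappa> i - 1"
        then have lt: "j < \<kappa> i - 1" using ij by simp
        then have "(i, \<kappa> i - 1) \<in> ?D" using ij kb[of i] unfolding D by auto
        moreover have "left_of (i, j) (i, \<kappa> i - 1)" using lt by (simp add: left_of_def)
        ultimately have "(i, \<kappa> i - 1) \<in> ?U" using pl F in_DU unfolding peelable_def by blast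
        then show False using ij unfolding U by arith
      qed
      have u': "u (Suc i) < \<kappa> i"
      proof (rule ccontr)
        assume "\<not> ?thesis"
        then have "(Suc i, j) \<in> ?D" using ij states_mono[OF l, of i "Suc i"] unfolding D by simp
        moreover have "over (i, j) (Suc i, j)" by (simp add: over_def)
        ultimately show False using pl F in_DU unfolding peelable_def by blast
      qed
      have "i \<le> N"
      proof (rule ccontr)
        assume "\<not> i \<le> N"
        then show False using ij states_const[OF ks, of i] states_const[OF l, of i] by simp
      qed
      then show "(i, j) \<in> corners l u \<kappa>" using ij j u' unfolding C by simp
    qed
  next
    assume F: "F \<subseteq> corners l u \<kappa>"
    have FD: "F \<subseteq> ?D - ?U"
    proof (rule subrelI)
      fix i j assume "(i, j) \<in> F"
      then have "(i, j) \<in> corners l u \<kappa>" using F by blast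
      then show "(i, j) \<in> ?D - ?U" using kb[of i] unfolding C Diff_iff D U by auto
    qed
    have rr: "b' \<in> ?U" if "b \<in> ?D" "b' \<in> ?D" "left_of b b'" "b \<in> ?U \<union> F" for b b'
    proof -
      obtain i j j' where b: "b = (i, j)" "b' = (i, j')" "j < j'"
        using \<open>left_of b b'\<close> by (cases b; cases b') (auto simp: left_of_def)
      have "b \<in> ?U \<or> b \<in> corners l u \<kappa>" using that F by blast
      then show ?thesis using that(2) b(3) unfolding b C U D by auto
    qed
    moreover have "b \<notin> ?U \<union> F" if "b \<in> ?D" "b' \<in> ?D" "over b b'" for b b'
    proof
      obtain i i' j where b: "b = (i, j)" "b' = (i', j)" "i < i'"
        using \<open>over b b'\<close> by (cases b; cases b') (auto simp: over_def)
      have "j < u i'" using that(2) unfolding b D by simp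
      also have "\<dots> \<le> u (Suc i)" using states_mono[OF u] b(3) by simp
      finally have j: "j < u (Suc i)" .
      assume "b \<in> ?U \<union> F"
      then have "b \<in> ?U \<or> b \<in> corners l u \<kappa>" using F by blast
      then show False using j kb[of i] unfolding b C U by auto
    qed
    ultimately show "peelable left_of over ?D ?U F" using FD unfolding peelable_def by blast
  qed
qed

lemma prod_corners:
  fixes z :: "nat \<Rightarrow> 'a::comm_ring_1"
  shows "(\<Prod>b\<in>corners l u \<kappa>. 1 + z (fst b)) =
    (\<Prod>i\<in>{1..N}. if l i < \<kappa> i \<and> u (Suc i) < \<kappa> i then 1 + z i else 1)"
proof -
  have "(\<Prod>b\<in>corners l u \<kappa>. 1 + z (fst b)) = (\<Prod>i\<in>{i \<in> {1..N}. l i < \<kappa> i \<and> u (Suc i) < \<kappa> i}. 1 + z i)"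
    unfolding corners_def by (subst prod.reindex) (auto simp: inj_on_def)
  then show ?thesis unfolding prod.inter_filter[OF finite_atLeastAtMost] .
qed

lemma row_sum_peel:
  fixes x z :: "nat \<Rightarrow> nat \<Rightarrow> 'a::comm_ring_1"
  assumes l: "l \<in> states N" and u: "u \<in> states N" and lu: "\<And>i. l i \<le> u i"
  shows "row_sum x z (Suc k) (skew_region l u) =
    (\<Sum>\<kappa> | \<kappa> \<in> states N \<and> (\<forall>i. l i \<le> \<kappa> i). step_wt l (x (Suc k)) (z (Suc k)) \<kappa> u * row_sum x z k (skew_region l \<kappa>))"
proof -
  let ?D = "skew_region l u"
  let ?I = "interlaced l u"
  let ?x = "x (Suc k)" and ?z = "z (Suc k)"
  let ?S = "row_sum x z k"
  have fin: "finite ?D" using l u by (rule finite_skew_region)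
  have dif: "?D - skew_region \<kappa> u = skew_region l \<kappa>" if "\<kappa> \<in> ?I" for \<kappa>
  proof (rule set_eqI)
    fix b :: box
    have "l (fst b) \<le> \<kappa> (fst b)" "\<kappa> (fst b) \<le> u (fst b)" using that by (auto simp: interlaced_def)
    then show "b \<in> ?D - skew_region \<kappa> u \<longleftrightarrow> b \<in> skew_region l \<kappa>"
      by (cases b) (auto simp: skew_region_def)
  qed
  have sub: "skew_region \<kappa> u \<subseteq> ?D" if "\<kappa> \<in> ?I" for \<kappa>
  proof
    fix b assume b: "b \<in> skew_region \<kappa> u"
    have "l (fst b) \<le> \<kappa> (fst b)" using that by (auto simp: interlaced_def)
    then show "b \<in> ?D" using b by (cases b) (auto simp: skew_region_def)
  qed
  have inj: "inj_on (\<lambda>\<kappa>. skew_region \<kappa> u) ?I"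
  proof (rule inj_onI)
    fix \<kappa> \<kappa>' assume k: "\<kappa> \<in> ?I" "\<kappa>' \<in> ?I" and eq: "skew_region \<kappa> u = skew_region \<kappa>' u"
    have le: "\<alpha> i \<le> \<beta> i" if "\<alpha> \<in> ?I" "\<beta> \<in> ?I" "skew_region \<alpha> u = skew_region \<beta> u" for \<alpha> \<beta> i
    proof -
      have st: "\<alpha> \<in> states N" "\<beta> \<in> states N" "\<alpha> i \<le> u i" "\<beta> i \<le> u i"
        using that(1,2) by (auto simp: interlaced_def)
      show ?thesis
      proof (cases "i = 0 \<or> \<beta> i = u i")
        case True
        then show ?thesis using st(3) states_0[OF st(1)] states_0[OF st(2)] by auto
      next
        case False
        then have "(i, \<beta> i) \<in> skew_region \<beta> u" using st(4) by (simp add: skew_region_def)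
        then have "(i, \<beta> i) \<in> skew_region \<alpha> u" by (simp only: that(3))
        then show ?thesis by (simp add: skew_region_def)
      qed
    qed
    show "\<kappa> = \<kappa>'" using le[OF k eq] le[OF k(2,1) eq[symmetric]] by (intro ext order.antisym)
  qed
  have inner: "(\<Sum>F | peelable left_of over ?D (skew_region \<kappa> u) F.
       (\<Prod>b\<in>skew_region \<kappa> u. ?x (fst b)) * (\<Prod>b\<in>F. ?z (fst b)) * ?S (?D - skew_region \<kappa> u)) =
     step_wt l ?x ?z \<kappa> u * ?S (skew_region l \<kappa>)" if k: "\<kappa> \<in> ?I" for \<kappa>
  proof -
    have ks: "\<kappa> \<in> states N" using k by (simp add: interlaced_def)
    have finC: "finite (corners l u \<kappa>)" by (simp add: corners_def)
    have "(\<Sum>F | peelable left_of over ?D (skew_region \<kappa> u) F.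
       (\<Prod>b\<in>skew_region \<kappa> u. ?x (fst b)) * (\<Prod>b\<in>F. ?z (fst b)) * ?S (?D - skew_region \<kappa> u)) =
      (\<Prod>b\<in>skew_region \<kappa> u. ?x (fst b)) * (\<Sum>F\<in>Pow (corners l u \<kappa>). \<Prod>b\<in>F. ?z (fst b)) * ?S (skew_region l \<kappa>)"
      unfolding peelable_iff_corners[OF l u k] dif[OF k]
      by (simp add: Pow_def sum_distrib_left sum_distrib_right)
    also have "\<dots> = (\<Prod>i\<in>{1..N}. ?x i ^ (u i - \<kappa> i)) *
        (\<Prod>i\<in>{1..N}. if l i < \<kappa> i \<and> u (Suc i) < \<kappa> i then 1 + ?z i else 1) * ?S (skew_region l \<kappa>)"
      unfolding sum_Pow_prod_1[OF finC] prod_corners prod_skew_region[OF ks u] ..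
    also have "(\<Prod>i\<in>{1..N}. ?x i ^ (u i - \<kappa> i)) *
        (\<Prod>i\<in>{1..N}. if l i < \<kappa> i \<and> u (Suc i) < \<kappa> i then 1 + ?z i else 1) = step_wt l ?x ?z \<kappa> u"
      unfolding step_wt_def prod.distrib[symmetric]
    proof (rule prod.cong[OF refl])
      fix i assume i: "i \<in> {1..N}"
      then have "u i \<le> \<kappa> (i - 1)" "\<kappa> i \<le> u i" using k by (auto simp: interlaced_def dest: spec[of _ "i - 1"])
      then show "?x i ^ (u i - \<kappa> i) * (if l i < \<kappa> i \<and> u (Suc i) < \<kappa> i then 1 + ?z i else 1) = row_wt l ?x ?z \<kappa> u i"
        by (simp add: row_wt_def)
    qed
    finally show ?thesis .
  qed
  have "row_sum x z (Suc k) ?D = (\<Sum>U\<in>(\<lambda>\<kappa>. skew_region \<kappa> u) ` ?I. \<Sum>F | peelable left_of over ?D U F.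
       (\<Prod>b\<in>U. ?x (fst b)) * (\<Prod>b\<in>F. ?z (fst b)) * ?S (?D - U))"
    unfolding tab_sum_peel[OF fin]
  proof (rule sum.mono_neutral_right)
    show "finite (Pow ?D)" using fin by simp
    show "(\<lambda>\<kappa>. skew_region \<kappa> u) ` ?I \<subseteq> Pow ?D" using sub by blast
    show "\<forall>U\<in>Pow ?D - (\<lambda>\<kappa>. skew_region \<kappa> u) ` ?I. (\<Sum>F | peelable left_of over ?D U F.
       (\<Prod>b\<in>U. ?x (fst b)) * (\<Prod>b\<in>F. ?z (fst b)) * ?S (?D - U)) = 0"
    proof
      fix U assume U: "U \<in> Pow ?D - (\<lambda>\<kappa>. skew_region \<kappa> u) ` ?I"
      have "{F. peelable left_of over ?D U F} = {}"
        using peelable_imp_interlaced[OF l u lu, of U] U by blast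
      then show "(\<Sum>F | peelable left_of over ?D U F.
       (\<Prod>b\<in>U. ?x (fst b)) * (\<Prod>b\<in>F. ?z (fst b)) * ?S (?D - U)) = 0" by simp
    qed
  qed
  also have "\<dots> = (\<Sum>\<kappa>\<in>?I. step_wt l ?x ?z \<kappa> u * ?S (skew_region l \<kappa>))"
    unfolding sum.reindex[OF inj] by (rule sum.cong) (simp_all add: inner)
  \<comment> \<open>The sum is extended to all boundaries to the right of \<open>l\<close>, the form
    a chain needs: a nonzero weight already implies interlacing.\<close>
  also have "\<dots> = (\<Sum>\<kappa> | \<kappa> \<in> states N \<and> (\<forall>i. l i \<le> \<kappa> i). step_wt l ?x ?z \<kappa> u * ?S (skew_region l \<kappa>))"
  proof (rule sum.mono_neutral_left)
    show "finite {\<kappa> \<in> states N. \<forall>i. l i \<le> \<kappa> i}" using finite_states by simp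
    show "?I \<subseteq> {\<kappa> \<in> states N. \<forall>i. l i \<le> \<kappa> i}" by (auto simp: interlaced_def)
    show "\<forall>\<kappa>\<in>{\<kappa> \<in> states N. \<forall>i. l i \<le> \<kappa> i} - ?I. step_wt l ?x ?z \<kappa> u * ?S (skew_region l \<kappa>) = 0"
    proof
      fix \<kappa> assume k: "\<kappa> \<in> {\<kappa> \<in> states N. \<forall>i. l i \<le> \<kappa> i} - ?I"
      have "step_wt l ?x ?z \<kappa> u = 0"
      proof (rule ccontr)
        assume nz: "step_wt l ?x ?z \<kappa> u \<noteq> 0"
        have ks: "\<kappa> \<in> states N" using k by simp
        have "u (Suc i) \<le> \<kappa> i" for i
          using step_wt_interlace(2)[OF nz, of "Suc i"] states_const[OF u, of "Suc i"] states_ge[OF ks, of i]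
          by (cases "Suc i \<in> {1..N}") auto
        then have "\<kappa> \<in> ?I" using k step_wt_mono[OF nz ks u] by (auto simp: interlaced_def)
        then show False using k by blast
      qed
      then show "step_wt l ?x ?z \<kappa> u * ?S (skew_region l \<kappa>) = 0" by simp
    qed
  qed
  finally show ?thesis .
qed

text \<open>Weights may depend on label and row, because three cases are needed: hybrid tableaux
  with signs, Schur functions, and the count of row-weakly-bounded tableaux.\<close>

lemma chain_eq_row_sum:
  fixes x z :: "nat \<Rightarrow> nat \<Rightarrow> 'a::comm_ring_1"
  assumes l: "l \<in> states N" and u: "u \<in> states N"
  shows "chain (\<lambda>k. step_wt l (x k) (z k)) (\<lambda>\<nu>. if \<nu> = l then 1 else 0) k u =
         (if \<forall>i. l i \<le> u i then row_sum x z k (skew_region l u) else 0)"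
  using u
proof (induction k arbitrary: u)
  case 0
  then show ?case using skew_region_empty_iff[OF l, of u] by (auto simp: tab_sum_0)
next
  case (Suc k)
  let ?c = "chain (\<lambda>k. step_wt l (x k) (z k)) (\<lambda>\<nu>. if \<nu> = l then 1 else 0)"
  show ?case
  proof (cases "\<forall>i. l i \<le> u i")
    case True
    have "?c (Suc k) u = (\<Sum>\<kappa>\<in>states N. step_wt l (x (Suc k)) (z (Suc k)) \<kappa> u *
        (if \<forall>i. l i \<le> \<kappa> i then row_sum x z k (skew_region l \<kappa>) else 0))"
      using Suc by simp
    also have "\<dots> = (\<Sum>\<kappa> | \<kappa> \<in> states N \<and> (\<forall>i. l i \<le> \<kappa> i). step_wt l (x (Suc k)) (z (Suc k)) \<kappa> u *
        row_sum x z k (skew_region l \<kappa>))"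
      by (intro sum.mono_neutral_cong_right finite_states) auto
    finally show ?thesis using row_sum_peel[OF l Suc.prems, of x z k] True by simp
  next
    case False
    have "?c (Suc k) u = 0"
    proof (rule ccontr)
      assume "?c (Suc k) u \<noteq> 0"
      moreover have "\<nu> \<in> states N \<and> (\<forall>i. l i \<le> \<nu> i)" if "(if \<nu> = l then 1 else (0::'a)) \<noteq> 0" for \<nu>
        using that l by (auto split: if_splits)
      ultimately have "l i \<le> u i" for i by (intro chain_support(2)[OF refl])
      then show False using False by blast
    qed
    then show ?thesis using False by (simp only: if_False)
  qed
qed

end

section \<open>Expansion of the hybrid generating functions\<close>

text \<open>Reversing both relations, and taking the column relation as the weak one, makes reverse
  row-strict tableaux increasing, so that \<open>tab_sum_peel\<close> covers them.\<close>

definition beneath :: "box \<Rightarrow> box \<Rightarrow> bool" where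
  "beneath b b' \<longleftrightarrow> over b' b"

definition right_of :: "box \<Rightarrow> box \<Rightarrow> bool" where
  "right_of b b' \<longleftrightarrow> left_of b' b"

abbreviation column_sum :: "(nat \<Rightarrow> nat \<Rightarrow> 'a::comm_ring_1) \<Rightarrow> nat \<Rightarrow> box set \<Rightarrow> 'a" where
  "column_sum x \<equiv> tab_sum beneath right_of (\<lambda>k b. x k (fst b)) (\<lambda>_ _. 0)"

text \<open>Row bound and sign are put into the weight: a filling that breaks the bound contributes
  0, any other one -1 for each box.\<close>

definition signed_flag :: "nat \<Rightarrow> nat \<Rightarrow> 'a::comm_ring_1" where
  "signed_flag k i = (if k < i then - 1 else 0)"

definition flag :: "nat \<Rightarrow> nat \<Rightarrow> 'a::comm_ring_1" where
  "flag k i = (if k \<le> i then 1 else 0)"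

context strips
begin

text \<open>Raising rows can lead outside \<open>states N\<close>; the guard gives such boundaries
  the value 0, in agreement with \<open>chain\<close>.\<close>

definition below_sum :: "nat \<Rightarrow> (nat \<Rightarrow> nat) \<Rightarrow> (nat \<Rightarrow> nat) \<Rightarrow> 'a::comm_ring_1" where
  "below_sum k u u' = (if u \<in> states N \<and> (\<forall>i. u i \<le> u' i) then column_sum signed_flag k (skew_region u u') else 0)"

definition above_sum :: "nat \<Rightarrow> (nat \<Rightarrow> nat) \<Rightarrow> (nat \<Rightarrow> nat) \<Rightarrow> 'a::comm_ring_1" where
  "above_sum k l' l = chain (\<lambda>k. step_wt l' (flag k) (\<lambda>_. 0)) (\<lambda>\<nu>. if \<nu> = l' then 1 else 0) k l"

text \<open>The largest label \<open>k + 1\<close> can only stand in the first box of a row, and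
  with a box it fills all boxes of the region above it. Such sets correspond to raising
  \<open>u\<close> by a vertical strip, and the row bound \<open>k + 1 < i\<close> leaves the rows
  from \<open>k + 2\<close> on.\<close>

lemma below_sum_Suc:
  assumes u: "u \<in> states N" and u': "u' \<in> states N"
  shows "below_sum (Suc k) u u' =
    (\<Sum>B\<in>Pow {k+2..N}. (-1) ^ card B * (below_sum k (raise_rows B u) u' :: 'a::comm_ring_1))"
proof (cases "\<forall>i. u i \<le> u' i")
  case False
  then obtain i where i: "u' i < u i" by (meson not_le)
  have "below_sum k (raise_rows B u) u' = (0::'a)" for B
  proof -
    have "\<not> raise_rows B u i \<le> u' i" using i by (simp add: raise_rows_def)
    then show ?thesis unfolding below_sum_def by meson
  qed
  moreover have "below_sum (Suc k) u u' = (0::'a)" using False unfolding below_sum_def by meson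
  ultimately show ?thesis by simp
next
  case True
  then have uu: "u i \<le> u' i" for i by blast
  let ?D = "skew_region u u'"
  let ?x = "signed_flag (Suc k) :: nat \<Rightarrow> 'a"
  let ?S = "column_sum signed_flag k :: box set \<Rightarrow> 'a"
  define h where "h B = (\<lambda>i. (i, u i)) ` B" for B
  define G where "G = {B \<in> Pow {k+2..N}. raise_rows B u \<in> states N \<and> (\<forall>i. raise_rows B u i \<le> u' i)}"
  have fin: "finite ?D" using u u' by (rule finite_skew_region)
  have D: "(i, j) \<in> ?D \<longleftrightarrow> 1 \<le> i \<and> u i \<le> j \<and> j < u' i" for i j by (simp add: skew_region_def)
  have h: "(i, j) \<in> h B \<longleftrightarrow> i \<in> B \<and> j = u i" for i j B by (auto simp: h_def)
  have inj: "inj_on h G" unfolding h_def by (rule inj_on_subset[OF inj_on_image_Pow]) (auto simp: inj_on_def)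
  have hD: "h B \<subseteq> ?D" if B: "B \<in> G" for B
  proof (rule subrelI)
    fix i j assume ij: "(i, j) \<in> h B"
    have "raise_rows B u i \<le> u' i" using B by (simp add: G_def)
    moreover have "i \<in> {k+2..N}" using B ij h by (auto simp: G_def)
    ultimately show "(i, j) \<in> ?D" using ij unfolding h D by (simp add: raise_rows_def)
  qed
  have dif: "?D - h B = skew_region (raise_rows B u) u'" if "B \<in> G" for B
    by (auto simp: D h skew_region_def raise_rows_def split: if_splits)
  have wt: "(\<Prod>b\<in>h B. ?x (fst b)) = (-1) ^ card B" if "B \<in> G" for B
  proof -
    have B: "B \<subseteq> {k+2..N}" using that by (simp add: G_def)
    have "(\<Prod>b\<in>h B. ?x (fst b)) = (\<Prod>i\<in>B. ?x i)"
      unfolding h_def by (subst prod.reindex) (auto simp: inj_on_def)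
    also have "\<dots> = (\<Prod>i\<in>B. -1)" using B by (intro prod.cong) (auto simp: signed_flag_def)
    finally show ?thesis by simp
  qed
  have good: "peelable beneath right_of ?D (h B) {}" if B: "B \<in> G" for B
    unfolding peelable_def
  proof (intro conjI ballI impI)
    fix b b' assume b: "b \<in> ?D" "b' \<in> ?D" "beneath b b' \<and> b \<in> h B \<union> {}"
    then obtain i i' j where ij: "b = (i, j)" "b' = (i', j)" "i' < i"
      by (cases b; cases b') (auto simp: beneath_def over_def)
    then have iB: "i \<in> B" "j = u i" using b h by auto
    have "u i' \<le> u i" using b(2) iB(2) unfolding ij D by simp
    moreover have "u i \<le> u i'" using states_mono[OF u] ij(3) by simp
    ultimately have e: "u i' = u i" by simp
    have "raise_rows B u i \<le> raise_rows B u i'" 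
      by (rule states_mono[of _ N]) (use B ij(3) in \<open>simp_all add: G_def\<close>)
    then have "i' \<in> B" using iB e by (auto simp: raise_rows_def split: if_splits)
    then show "b' \<in> h B" using iB e unfolding ij h by simp
  next
    fix b b' assume b: "b \<in> ?D" "b' \<in> ?D" "right_of b b'"
    then obtain i j j' where ij: "b = (i, j)" "b' = (i, j')" "j' < j"
      by (cases b; cases b') (auto simp: right_of_def left_of_def)
    show "b \<notin> h B \<union> {}" using b(2) ij(3) unfolding ij D by (auto simp: h)
  qed simp
  have im: "U \<in> h ` G" if U: "U \<subseteq> ?D" and pl: "peelable beneath right_of ?D U {}"
    and nz: "(\<Prod>b\<in>U. ?x (fst b)) \<noteq> 0" for U
  proof -
    have R: "b' \<in> U" if "b \<in> U" "b' \<in> ?D" "beneath b b'" for b b'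
      using pl U that unfolding peelable_def by blast
    have Q: "b \<notin> U" if "b \<in> ?D" "b' \<in> ?D" "right_of b b'" for b b'
      using pl that unfolding peelable_def by blast
    define B where "B = {i. (i, u i) \<in> U}"
    have first: "j = u i" if "(i, j) \<in> U" for i j
    proof (rule ccontr)
      assume "j \<noteq> u i"
      have ij: "(i, j) \<in> ?D" using U that by blast
      then have "u i < j" using \<open>j \<noteq> u i\<close> unfolding D by simp
      then have "(i, u i) \<in> ?D" "right_of (i, j) (i, u i)" using ij unfolding D by (auto simp: right_of_def left_of_def)
      then show False using Q[OF ij] that by blast
    qed
    have UB: "U = h B"
    proof (rule set_eqI)
      fix b show "b \<in> U \<longleftrightarrow> b \<in> h B" using first[of "fst b" "snd b"] by (cases b) (auto simp: h B_def)
    qed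
    have fU: "finite U" using U fin finite_subset by blast
    have BD: "i \<le> N" "1 \<le> i" "u i < u' i" "Suc k < i" if i: "i \<in> B" for i
    proof -
      have iU: "(i, u i) \<in> U" using i by (simp add: B_def)
      then have "(i, u i) \<in> ?D" using U by blast
      then show d: "1 \<le> i" "u i < u' i" unfolding D by auto
      show "i \<le> N"
      proof (rule ccontr)
        assume "\<not> i \<le> N"
        then show False using d states_const[OF u, of i] states_const[OF u', of i] by simp
      qed
      show "Suc k < i"
      proof (rule ccontr)
        assume "\<not> Suc k < i"
        then have "?x (fst (i, u i)) = 0" by (simp add: signed_flag_def)
        then have "(\<Prod>b\<in>U. ?x (fst b)) = 0" using fU iU by (intro prod_zero bexI[of _ "(i, u i)"])
        then show False using nz by simp
      qed
    qed
    have le: "raise_rows B u i \<le> u' i" for i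
      using uu[of i] BD(3)[of i] by (auto simp: raise_rows_def)
    have "raise_rows B u (Suc i) \<le> raise_rows B u i" for i
    \<comment> \<open>The one way to lose monotonicity is to raise row \<open>i + 1\<close> but not
      row \<open>i\<close> when their lengths agree. Then \<open>(i, u i)\<close> lies in the region
      above a box of \<open>U\<close>, so it is in \<open>U\<close> after all.\<close>
    proof (cases "Suc i \<in> B \<and> i \<notin> B \<and> u (Suc i) = u i")
      case True
      then have sU: "(Suc i, u i) \<in> U" by (metis B_def mem_Collect_eq)
      \<comment> \<open>Row 0 has the maximal length \<open>M\<close>, so equality with row 1 leaves
        no room for a box of row 1.\<close>
      have "i \<noteq> 0"
      proof
        assume "i = 0"
        then show False using True BD(3)[of 1] states_0[OF u] states_le[OF u', of 1] by simp
      qed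
      moreover have "u (Suc i) < u' (Suc i)" using BD(3) True by blast
      ultimately have "(i, u i) \<in> ?D" using True states_mono[OF u', of i "Suc i"] unfolding D by simp
      then have "(i, u i) \<in> U" using R[OF sU, of "(i, u i)"] by (simp add: beneath_def over_def)
      then show ?thesis using True by (simp add: B_def)
    next
      case False
      then show ?thesis using states_mono[OF u, of i "Suc i"] by (auto simp: raise_rows_def)
    qed
    moreover have "0 \<notin> B" "\<And>i. N < i \<Longrightarrow> i \<notin> B" using BD(1)[of _] BD(2)[of 0] by fastforce+
    ultimately have "raise_rows B u \<in> states N"
      using states_0[OF u] states_const[OF u] by (auto simp: states_def raise_rows_def)
    then have "B \<in> G" using le BD(1,4) by (fastforce simp: G_def)
    then show ?thesis using UB by blast
  qed
  have inner: "(\<Sum>F | peelable beneath right_of ?D U F. (\<Prod>b\<in>U. ?x (fst b)) * (\<Prod>b\<in>F. 0) * ?S (?D - U)) =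
      (if peelable beneath right_of ?D U {} then (\<Prod>b\<in>U. ?x (fst b)) * ?S (?D - U) else 0)" for U
  proof -
    have fP: "finite {F. peelable beneath right_of ?D U F}"
      by (rule finite_subset[of _ "Pow ?D"]) (use fin in \<open>auto simp: peelable_def\<close>)
    have "(\<Sum>F | peelable beneath right_of ?D U F. (\<Prod>b\<in>U. ?x (fst b)) * (\<Prod>b\<in>F. 0) * ?S (?D - U)) =
      (\<Sum>F | peelable beneath right_of ?D U F. if F = {} then (\<Prod>b\<in>U. ?x (fst b)) * ?S (?D - U) else 0)"
    proof (rule sum.cong[OF refl])
      fix F assume "F \<in> {F. peelable beneath right_of ?D U F}"
      then have "finite F" using fin finite_subset by (auto simp: peelable_def)
      then show "(\<Prod>b\<in>U. ?x (fst b)) * (\<Prod>b\<in>F. 0) * ?S (?D - U) =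
          (if F = {} then (\<Prod>b\<in>U. ?x (fst b)) * ?S (?D - U) else 0)"
      proof (cases "F = {}")
        case False
        then have "(\<Prod>b\<in>F. 0::'a) = 0" using \<open>finite F\<close> by (intro prod_zero) auto
        then show ?thesis using False by (simp del: prod_constant)
      qed simp
    qed
    also have "\<dots> = (if peelable beneath right_of ?D U {} then (\<Prod>b\<in>U. ?x (fst b)) * ?S (?D - U) else 0)"
      using fP by simp
    finally show ?thesis .
  qed
  have "below_sum (Suc k) u u' = (\<Sum>U\<in>Pow ?D.
      if peelable beneath right_of ?D U {} then (\<Prod>b\<in>U. ?x (fst b)) * ?S (?D - U) else 0)"
    using u True by (simp add: below_sum_def tab_sum_peel[OF fin] inner del: prod_constant)
  also have "\<dots> = (\<Sum>U\<in>h ` G. (\<Prod>b\<in>U. ?x (fst b)) * ?S (?D - U))"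
  proof (rule sum.mono_neutral_cong_right)
    show "finite (Pow ?D)" using fin by simp
    show "h ` G \<subseteq> Pow ?D" using hD by blast
    show "\<forall>U\<in>Pow ?D - h ` G. (if peelable beneath right_of ?D U {} then (\<Prod>b\<in>U. ?x (fst b)) * ?S (?D - U) else 0) = 0"
    proof
      fix U assume U: "U \<in> Pow ?D - h ` G"
      then have "\<not> peelable beneath right_of ?D U {} \<or> (\<Prod>b\<in>U. ?x (fst b)) = 0"
        using im[of U] by blast
      then show "(if peelable beneath right_of ?D U {} then (\<Prod>b\<in>U. ?x (fst b)) * ?S (?D - U) else 0) = 0"
        by (elim disjE) simp_all
    qed
    show "(if peelable beneath right_of ?D U {} then (\<Prod>b\<in>U. ?x (fst b)) * ?S (?D - U) else 0) =
        (\<Prod>b\<in>U. ?x (fst b)) * ?S (?D - U)" if "U \<in> h ` G" for U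
      using good that by auto
  qed
  also have "\<dots> = (\<Sum>B\<in>G. (-1) ^ card B * below_sum k (raise_rows B u) u')"
    unfolding sum.reindex[OF inj]
  proof (rule sum.cong[OF refl])
    fix B assume B: "B \<in> G"
    then have "raise_rows B u \<in> states N \<and> (\<forall>i. raise_rows B u i \<le> u' i)" by (simp add: G_def)
    then have "below_sum k (raise_rows B u) u' = ?S (?D - h B)"
      unfolding dif[OF B] below_sum_def by (rule if_P)
    then show "((\<lambda>U. (\<Prod>b\<in>U. ?x (fst b)) * ?S (?D - U)) \<circ> h) B =
        (-1) ^ card B * below_sum k (raise_rows B u) u'"
      unfolding o_def wt[OF B] by simp
  qed
  also have "\<dots> = (\<Sum>B\<in>Pow {k+2..N}. (-1) ^ card B * below_sum k (raise_rows B u) u')"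
  proof (rule sum.mono_neutral_left)
    show "G \<subseteq> Pow {k+2..N}" unfolding G_def by blast
    show "\<forall>B\<in>Pow {k+2..N} - G. (-1) ^ card B * below_sum k (raise_rows B u) u' = (0::'a)"
    proof
      fix B assume "B \<in> Pow {k+2..N} - G"
      then have "\<not> (raise_rows B u \<in> states N \<and> (\<forall>i. raise_rows B u i \<le> u' i))"
        unfolding G_def by blast
      then have "below_sum k (raise_rows B u) u' = (0::'a)" unfolding below_sum_def by (rule if_not_P)
      then show "(-1) ^ card B * below_sum k (raise_rows B u) u' = (0::'a)" by simp
    qed
  qed simp
  finally show ?thesis .
qed

lemma below_sum_0:
  assumes "u \<in> states N" "u' \<in> states N"
  shows "below_sum 0 u u' = (if u = u' then 1 else (0::'a::comm_ring_1))"
proof (cases "\<forall>i. u i \<le> u' i")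
  case True
  then show ?thesis
    using assms skew_region_empty_iff[OF assms] by (simp add: below_sum_def tab_sum_0 eq_commute[of u])
next
  case False
  then have "u \<noteq> u'" by blast
  moreover have "below_sum 0 u u' = (0::'a)" using False unfolding below_sum_def by meson
  ultimately show ?thesis by simp
qed

section \<open>Recursion for the tableaux above the shape\<close>

lemma dropsD:
  assumes "l' \<in> drops r l"
  shows "l' \<in> states N" "l' i \<le> l i" "if r \<le> i then l (Suc i) \<le> l' i else l' i = l i"
  using assms unfolding drops_def by blast+

text \<open>With weights 0 and 1 the transfer matrix is an indicator: \<open>0 ^ d\<close> is
  nonzero only for \<open>d = 0\<close>, so the rows above \<open>Suc k\<close> cannot change, while
  the other rows may carry any horizontal strip.\<close>

lemma flag_step:
  assumes "\<kappa> \<in> states N" "\<nu> \<in> states N"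
  shows "step_wt l' (flag (Suc k)) (\<lambda>_. 0) \<kappa> \<nu> = (if \<kappa> \<in> drops (Suc k) \<nu> then 1 else (0::'a::comm_ring_1))"
proof (cases "\<kappa> \<in> drops (Suc k) \<nu>")
  case True
  have dr: "\<kappa> i \<le> \<nu> i" "if Suc k \<le> i then \<nu> (Suc i) \<le> \<kappa> i else \<kappa> i = \<nu> i" for i
    using dropsD[OF True] by blast+
  have "row_wt l' (flag (Suc k)) (\<lambda>_. 0) \<kappa> \<nu> i = (1::'a)" if i: "i \<in> {1..N}" for i
  proof -
    have "\<nu> i \<le> \<kappa> (i - 1)"
      using dr(2)[of "i - 1"] i states_mono[OF assms(2), of "i-1" i] by (auto split: if_splits)
    then show ?thesis using dr[of i] by (auto simp: row_wt_def flag_def split: if_splits)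
  qed
  then have "step_wt l' (flag (Suc k)) (\<lambda>_. 0) \<kappa> \<nu> = (1::'a)"
    unfolding step_wt_def by (rule prod.neutral[OF ballI])
  then show ?thesis using True by simp
next
  case False
  have "step_wt l' (flag (Suc k)) (\<lambda>_. 0) \<kappa> \<nu> = (0::'a)"
  proof (rule ccontr)
    assume nz: "step_wt l' (flag (Suc k)) (\<lambda>_. 0) \<kappa> \<nu> \<noteq> (0::'a)"
    have le: "\<kappa> i \<le> \<nu> i" for i by (rule step_wt_mono[OF nz assms])
    moreover have "if Suc k \<le> i then \<nu> (Suc i) \<le> \<kappa> i else \<kappa> i = \<nu> i" for i
    proof (cases "Suc k \<le> i")
      case True
      have "\<nu> (Suc i) \<le> \<kappa> i"
        using step_wt_interlace(2)[OF nz, of "Suc i"] states_const[OF assms(2), of "Suc i"] states_ge[OF assms(1), of i]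
        by (cases "Suc i \<in> {1..N}") auto
      then show ?thesis using True by simp
    next
      case F: False
      have "\<kappa> i = \<nu> i"
      proof (cases "i \<in> {1..N}")
        case True
        have "row_wt l' (flag (Suc k)) (\<lambda>_. 0) \<kappa> \<nu> i \<noteq> (0::'a)"
        proof
          assume "row_wt l' (flag (Suc k)) (\<lambda>_. 0) \<kappa> \<nu> i = (0::'a)"
          then have "step_wt l' (flag (Suc k)) (\<lambda>_. 0) \<kappa> \<nu> = (0::'a)"
            unfolding step_wt_def using True by (intro prod_zero bexI[of _ i]) auto
          then show False using nz by simp
        qed
        then have "(0::'a) ^ (\<nu> i - \<kappa> i) \<noteq> (0::'a)" using F by (auto simp: row_wt_def flag_def split: if_splits)
        then show ?thesis using le[of i] by (cases "\<nu> i - \<kappa> i") auto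
      next
        case False
        then show ?thesis using assms states_const[of _ N i] states_0[of _ N] by (cases "i = 0") auto
      qed
      then show ?thesis using F by simp
    qed
    ultimately have "\<kappa> \<in> drops (Suc k) \<nu>" using assms(1) unfolding drops_def by blast
    then show False using False by simp
  qed
  then show ?thesis using False by simp
qed

lemma above_sum_Suc:
  assumes "l \<in> states N"
  shows "above_sum (Suc k) l' l = (\<Sum>\<kappa>\<in>drops (Suc k) l. above_sum k l' \<kappa>)"
proof -
  have "above_sum (Suc k) l' l = (\<Sum>\<kappa>\<in>states N. (if \<kappa> \<in> drops (Suc k) l then 1 else 0) * above_sum k l' \<kappa>)"
    using assms by (simp add: above_sum_def flag_step)
  also have "\<dots> = (\<Sum>\<kappa>\<in>drops (Suc k) l. above_sum k l' \<kappa>)"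
    by (intro sum.mono_neutral_cong_right finite_states) (auto simp: drops_def)
  finally show ?thesis .
qed

lemma drops_states:
  assumes "l \<in> states n" "l' \<in> drops r l"
  shows "l' \<in> states n"
proof -
  note l' = dropsD[OF assms(2)]
  have "l' i = c" if "n < i" for i
    using l'(2)[of i] states_const[OF assms(1) that] states_ge[OF l'(1), of i] by simp
  then show ?thesis using l'(1) by (auto simp: states_def)
qed

text \<open>Iterates \<open>uncrowd_row\<close>, where the strips split off first carry the largest
  label in both recursions. Lowering \<open>l\<close> stays within \<open>states n\<close>, which
  keeps the row count under control; raising \<open>u\<close> may leave \<open>states N\<close>, and
  then both sides are 0.\<close>

theorem chain_expansion:
  fixes X :: "nat \<Rightarrow> 'a::comm_ring_1"
  assumes "n + K \<le> N" "r \<le> N" "l \<in> states n" "u \<in> states N" "\<And>i. l i \<le> u i"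
  shows "chain (strip_wt r l X) (\<lambda>\<nu>. if \<nu> = l then 1 else 0) K u =
    (\<Sum>l0\<in>states N. \<Sum>u0\<in>states N. above_sum r l0 l * below_sum r u u0 *
       chain (strip_wt 0 l0 X) (\<lambda>\<nu>. if \<nu> = l0 then 1 else 0) K u0)"
  using assms(2-)
proof (induction r arbitrary: l u)
  case 0
  let ?c = "\<lambda>l0 u0. chain (strip_wt 0 l0 X) (\<lambda>\<nu>. if \<nu> = l0 then 1 else 0) K u0"
  have l: "l \<in> states N" using 0 assms(1) states_subset[of n N] by auto
  have "(\<Sum>l0\<in>states N. \<Sum>u0\<in>states N. above_sum 0 l0 l * below_sum 0 u u0 * ?c l0 u0) =
     (\<Sum>l0\<in>states N. if l = l0 then (\<Sum>u0\<in>states N. if u = u0 then ?c l0 u0 else 0) else 0)"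
  proof (rule sum.cong[OF refl])
    fix l0
    have "above_sum 0 l0 l = (if l = l0 then 1 else (0::'a))" using l by (simp add: above_sum_def)
    then show "(\<Sum>u0\<in>states N. above_sum 0 l0 l * below_sum 0 u u0 * ?c l0 u0) =
        (if l = l0 then (\<Sum>u0\<in>states N. if u = u0 then ?c l0 u0 else 0) else 0)"
      using below_sum_0[OF 0(3), where 'a='a] by (auto intro!: sum.cong)
  qed
  also have "\<dots> = ?c l u" using l 0(3) by (simp add: finite_states del: chain.simps)
  finally show ?case ..
next
  case (Suc r)
  let ?c = "\<lambda>r l0 u0. chain (strip_wt r l0 X) (\<lambda>\<nu>. if \<nu> = l0 then 1 else 0) K u0"
  have l: "l \<in> states N" using Suc assms(1) states_subset[of n N] by auto
  have step: "(-1) ^ card B * ?c r l' (raise_rows B u) =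
      (\<Sum>l0\<in>states N. \<Sum>u0\<in>states N. above_sum r l0 l' * ((-1) ^ card B * below_sum r (raise_rows B u) u0) * ?c 0 l0 u0)"
    if l': "l' \<in> drops (Suc r) l" for B l'
  proof (cases "raise_rows B u \<in> states N")
    case True
    have "l' i \<le> raise_rows B u i" for i
    proof -
      have "l' i \<le> l i" by (rule dropsD(2)[OF l'])
      also have "l i \<le> u i" by fact
      also have "u i \<le> raise_rows B u i" by (simp add: raise_rows_def)
      finally show ?thesis .
    qed
    then show ?thesis
      using Suc.IH[OF _ drops_states[OF Suc.prems(2) l'] True] Suc.prems(1)
      by (simp add: sum_distrib_left mult_ac)
  next
    case False
    then show ?thesis by (simp add: chain_outside below_sum_def)
  qed
  have "?c (Suc r) l u = (\<Sum>B\<in>Pow {r+2..N}. \<Sum>l'\<in>drops (Suc r) l. (-1) ^ card B * ?c r l' (raise_rows B u))"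
    using uncrowd_row[OF Suc.prems(2) _ assms(1) Suc.prems(3,4), of r X] Suc.prems(1)
    by (simp add: sum_distrib_left)
  also have "\<dots> = (\<Sum>B\<in>Pow {r+2..N}. \<Sum>l'\<in>drops (Suc r) l. \<Sum>l0\<in>states N. \<Sum>u0\<in>states N.
      above_sum r l0 l' * ((-1) ^ card B * below_sum r (raise_rows B u) u0) * ?c 0 l0 u0)"
    by (intro sum.cong refl step)
  also have "\<dots> = (\<Sum>l0\<in>states N. \<Sum>u0\<in>states N. \<Sum>B\<in>Pow {r+2..N}. \<Sum>l'\<in>drops (Suc r) l.
      above_sum r l0 l' * ((-1) ^ card B * below_sum r (raise_rows B u) u0) * ?c 0 l0 u0)"
    by (simp only: sum.swap[of _ "states N" "drops (Suc r) l"] sum.swap[of _ "states N" "Pow {r+2..N}"])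
  also have "\<dots> = (\<Sum>l0\<in>states N. \<Sum>u0\<in>states N. above_sum (Suc r) l0 l * below_sum (Suc r) u u0 * ?c 0 l0 u0)"
  proof (intro sum.cong refl)
    fix l0 u0 assume u0: "u0 \<in> states N"
    show "(\<Sum>B\<in>Pow {r+2..N}. \<Sum>l'\<in>drops (Suc r) l.
      above_sum r l0 l' * ((-1) ^ card B * below_sum r (raise_rows B u) u0) * ?c 0 l0 u0) =
      above_sum (Suc r) l0 l * below_sum (Suc r) u u0 * ?c 0 l0 u0"
      unfolding above_sum_Suc[OF l] below_sum_Suc[OF Suc.prems(3) u0]
      by (simp only: sum_distrib_left sum_distrib_right)
  qed
  finally show ?case .
qed

end

section \<open>Coefficient extraction\<close>

definition ptab :: "(box \<Rightarrow> box \<Rightarrow> bool) \<Rightarrow> (box \<Rightarrow> box \<Rightarrow> bool) \<Rightarrow> nat \<Rightarrow> box set \<Rightarrow> (box \<Rightarrow> nat) set" where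
  "ptab R Q k D = {T \<in> D \<rightarrow>\<^sub>E {1..k}.
     \<forall>b\<in>D. \<forall>b'\<in>D. (R b b' \<longrightarrow> T b \<le> T b') \<and> (Q b b' \<longrightarrow> T b < T b')}"

lemma finite_ptab: "finite D \<Longrightarrow> finite (ptab R Q k D)"
  unfolding ptab_def by (intro finite_subset[OF Collect_restrict] finite_PiE) auto

text \<open>For \<open>z = 0\<close> a box with two labels annihilates its tableau; the surviving
  ones have singleton entries only.\<close>

lemma tab_sum_single:
  assumes D: "finite D"
  shows "tab_sum R Q x (\<lambda>_ _. 0) k D = (\<Sum>T\<in>ptab R Q k D. \<Prod>b\<in>D. x (T b) b)"
proof -
  define S where "S T = restrict (\<lambda>b. {T b}) D" for T :: "box \<Rightarrow> nat"
  have SD: "S T b = {T b}" if "b \<in> D" for T b using that by (simp add: S_def)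
  have inj: "inj_on S (ptab R Q k D)"
  proof (rule inj_onI)
    fix T T' assume T: "T \<in> ptab R Q k D" "T' \<in> ptab R Q k D" and e: "S T = S T'"
    have "T b = T' b" if "b \<in> D" for b using SD[OF that] e by (metis singleton_inject)
    then show "T = T'" using T by (intro PiE_ext[of _ D]) (auto simp: ptab_def)
  qed
  have im: "S ` ptab R Q k D \<subseteq> svtab R Q k D"
  proof (rule image_subsetI)
    fix T assume T: "T \<in> ptab R Q k D"
    then have T1: "T \<in> D \<rightarrow>\<^sub>E {1..k}"
      and T2: "\<And>b b'. \<lbrakk>b \<in> D; b' \<in> D; R b b'\<rbrakk> \<Longrightarrow> T b \<le> T b'" "\<And>b b'. \<lbrakk>b \<in> D; b' \<in> D; Q b b'\<rbrakk> \<Longrightarrow> T b < T b'"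
      unfolding ptab_def by blast+
    show "S T \<in> svtab R Q k D"
      by (rule svtabI) (use T2 PiE_mem[OF T1] in \<open>auto simp: SD S_def\<close>)
  qed
  have zero: "tab_wt x (\<lambda>_ _. 0) D T = 0" if T: "T \<in> svtab R Q k D - S ` ptab R Q k D" for T
  proof -
    have sv: "T \<in> svtab R Q k D" using T by blast
    have "\<exists>b\<in>D. T b \<noteq> {Min (T b)}"
    proof (rule ccontr)
      assume "\<not> ?thesis"
      then have s: "T b = {Min (T b)}" if "b \<in> D" for b using that by blast
      define T' where "T' = restrict (\<lambda>b. Min (T b)) D"
      have T': "T b = {T' b}" if "b \<in> D" for b using s[OF that] that by (simp add: T'_def)
      have "T = S T'"
      proof
        fix b show "T b = S T' b" using T'[of b] svtabD(3)[OF sv, of b] by (cases "b \<in> D") (auto simp: S_def)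
      qed
      moreover have "T' \<in> ptab R Q k D"
        unfolding ptab_def
      proof (intro CollectI conjI ballI impI)
        show "T' \<in> D \<rightarrow>\<^sub>E {1..k}"
        proof (rule PiE_I)
          fix b assume b: "b \<in> D"
          show "T' b \<in> {1..k}" using svtabD(2)[OF sv b] T'[OF b] by auto
        qed (simp add: T'_def)
        fix b b' assume b: "b \<in> D" "b' \<in> D"
        have m: "T' b \<in> T b" "T' b' \<in> T b'" using T' b by auto
        show "T' b \<le> T' b'" if "R b b'" using svtabD(4)[OF sv b that m] .
        show "T' b < T' b'" if "Q b b'" using svtabD(5)[OF sv b that m] .
      qed
      ultimately show False using T by blast
    qed
    then obtain b where b: "b \<in> D" "T b \<noteq> {Min (T b)}" by blast
    have f: "finite (T b)" using svtabD(2)[OF sv b(1)] finite_subset by blast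
    have "T b - {Min (T b)} \<noteq> {}" using b svtabD(1)[OF sv b(1)] Min_in[OF f] by auto
    then have "(\<Prod>i\<in>T b - {Min (T b)}. (0::'a)) = 0" using f by (intro prod_zero) auto
    then show ?thesis unfolding tab_wt_def using D b(1) by (intro prod_zero bexI[of _ b]) (simp_all del: prod_constant)
  qed
  have "tab_sum R Q x (\<lambda>_ _. 0) k D = (\<Sum>T\<in>S ` ptab R Q k D. tab_wt x (\<lambda>_ _. 0) D T)"
    unfolding tab_sum_def using im zero finite_svtab[OF D] by (intro sum.mono_neutral_right) auto
  also have "\<dots> = (\<Sum>T\<in>ptab R Q k D. \<Prod>b\<in>D. x (T b) b)"
    unfolding sum.reindex[OF inj] by (rule sum.cong) (simp_all add: tab_wt_def SD)
  finally show ?thesis .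
qed

lemma tab_sum_cong:
  assumes "\<And>k b. b \<in> D \<Longrightarrow> x k b = x' k b" "\<And>k b. b \<in> D \<Longrightarrow> z k b = z' k b"
  shows "tab_sum R Q x z k D = tab_sum R Q x' z' k D"
  unfolding tab_sum_def tab_wt_def using assms by (intro sum.cong prod.cong arg_cong2[of _ _ _ _ "(*)"]) auto

lemma ptab_eq_tableaux: "ptab R Q k D = {T \<in> tableaux D. (\<forall>b\<in>D. T b \<le> k) \<and>
    (\<forall>b\<in>D. \<forall>b'\<in>D. (R b b' \<longrightarrow> T b \<le> T b') \<and> (Q b b' \<longrightarrow> T b < T b'))}"
  unfolding ptab_def tableaux_def PiE_def Pi_def by auto

lemma semistandard_iff:
  "semistandard D T \<longleftrightarrow> (\<forall>b\<in>D. \<forall>b'\<in>D. (left_of b b' \<longrightarrow> T b \<le> T b') \<and> (over b b' \<longrightarrow> T b < T b'))"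
  unfolding semistandard_def left_of_def over_def by fastforce

lemma reverse_row_strict_iff:
  "reverse_row_strict D T \<longleftrightarrow> (\<forall>b\<in>D. \<forall>b'\<in>D. (beneath b b' \<longrightarrow> T b \<le> T b') \<and> (right_of b b' \<longrightarrow> T b < T b'))"
  unfolding reverse_row_strict_def left_of_def over_def beneath_def right_of_def by fastforce

lemma ptab_semistandard:
  "ptab left_of over k D = {T \<in> tableaux D. semistandard D T \<and> (\<forall>b\<in>D. T b \<le> k)}"
  unfolding ptab_eq_tableaux semistandard_iff by blast

lemma ptab_reverse_row_strict:
  "ptab beneath right_of k D = {T \<in> tableaux D. reverse_row_strict D T \<and> (\<forall>b\<in>D. T b \<le> k)}"
  unfolding ptab_eq_tableaux reverse_row_strict_iff by blast

lemma card_filter_nonzero: "finite D \<Longrightarrow> b \<in> D \<Longrightarrow> P b \<Longrightarrow> card {b \<in> D. P b} \<noteq> 0"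
  by (auto simp: card_eq_0_iff)

section \<open>Bounded tableaux counted by indicator weights\<close>

lemma prod_indicator:
  fixes t :: "'a::comm_ring_1"
  assumes "finite D"
  shows "(\<Prod>b\<in>D. if P b then t else 0) = (if \<forall>b\<in>D. P b then t ^ card D else 0)"
  using assms by (auto intro!: prod_zero)

text \<open>The weight of a filling is the indicator of the row bound. Since no row index exceeds
  \<open>k\<close>, this bound implies that labels are at most \<open>k\<close>, so the cut-off
  loses no tableau.\<close>

lemma sum_flag:
  assumes D: "finite D" and k: "\<And>b. b \<in> D \<Longrightarrow> fst b \<le> k"
  shows "row_sum flag (\<lambda>_ _. 0) k D =
    (of_nat (card {T \<in> tableaux D. semistandard D T \<and> row_weakly_bounded D T}) :: 'a::comm_ring_1)"
proof -
  have e: "{T \<in> ptab left_of over k D. \<forall>b\<in>D. T b \<le> fst b} = {T \<in> tableaux D. semistandard D T \<and> row_weakly_bounded D T}"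
    unfolding ptab_semistandard row_weakly_bounded_def using k by (fastforce intro: order_trans)
  have "row_sum flag (\<lambda>_ _. 0) k D = (\<Sum>T\<in>ptab left_of over k D. if \<forall>b\<in>D. T b \<le> fst b then 1 else (0::'a))"
    unfolding tab_sum_single[OF D] flag_def prod_indicator[OF D] by (simp only: power_one)
  also have "\<dots> = (\<Sum>T\<in>{T \<in> ptab left_of over k D. \<forall>b\<in>D. T b \<le> fst b}. 1)"
    by (rule sum.inter_filter[OF finite_ptab[OF D], symmetric])
  finally show ?thesis unfolding e by simp
qed

lemma sum_signed_flag:
  assumes D: "finite D" and k: "\<And>b. b \<in> D \<Longrightarrow> fst b \<le> k"
  shows "column_sum signed_flag k D = (-1) ^ card D *
    (of_nat (card {T \<in> tableaux D. reverse_row_strict D T \<and> row_bounded D T}) :: 'a::comm_ring_1)"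
proof -
  have e: "{T \<in> ptab beneath right_of k D. \<forall>b\<in>D. T b < fst b} = {T \<in> tableaux D. reverse_row_strict D T \<and> row_bounded D T}"
    unfolding ptab_reverse_row_strict row_bounded_def using k by (fastforce intro: order_trans less_imp_le)
  have "column_sum signed_flag k D = (\<Sum>T\<in>ptab beneath right_of k D. if \<forall>b\<in>D. T b < fst b then (-1) ^ card D else (0::'a))"
    unfolding tab_sum_single[OF D] signed_flag_def prod_indicator[OF D] ..
  also have "\<dots> = (\<Sum>T\<in>{T \<in> ptab beneath right_of k D. \<forall>b\<in>D. T b < fst b}. (-1) ^ card D)"
    by (rule sum.inter_filter[OF finite_ptab[OF D], symmetric])
  finally show ?thesis unfolding e by (simp add: mult.commute)
qed

section \<open>Coefficients of Schur and Grothendieck polynomials in finitely many variables\<close>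

type_synonym mpoly = "(nat \<Rightarrow>\<^sub>0 nat) \<Rightarrow>\<^sub>0 int"

definition var :: "nat \<Rightarrow> mpoly" where
  "var k = Poly_Mapping.single (Poly_Mapping.single k 1) 1"

lemma prod_single: "(\<Prod>a\<in>A. Poly_Mapping.single (f a) (1::int)) = Poly_Mapping.single (\<Sum>a\<in>A. f a) 1"
  for f :: "'b \<Rightarrow> nat \<Rightarrow>\<^sub>0 nat"
  by (induction A rule: infinite_finite_induct) (simp_all add: mult_single)

lemma lookup_of_int_mult:
  "Poly_Mapping.lookup (of_int a * p) m = a * Poly_Mapping.lookup (p :: mpoly) m"
proof (induction a rule: int_induct[where k = 0])
  case (step1 i)
  then show ?case by (simp add: distrib_right lookup_add)
next
  case (step2 i)
  then show ?case by (simp add: left_diff_distrib lookup_minus)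
qed simp

lemma label_le_of_content:
  assumes D: "finite D" and m: "tab_content D T = m" "Poly_Mapping.keys m \<subseteq> {..K}" and b: "b \<in> D"
  shows "T b \<le> K"
proof -
  have "card {b' \<in> D. T b' = T b} \<noteq> 0" by (rule card_filter_nonzero[OF D b]) simp
  then have "T b \<in> Poly_Mapping.keys m" using lookup_content[OF D, of T "T b"] m(1) by (simp add: in_keys_iff)
  then show ?thesis using m(2) by auto
qed

text \<open>A single coefficient needs only the variables up to \<open>K\<close>: content
  \<open>m\<close> already forces every label to be at most \<open>K\<close>.\<close>

lemma lookup_schur:
  assumes D: "finite D" and K: "Poly_Mapping.keys m \<subseteq> {..K}"
  shows "Poly_Mapping.lookup (row_sum (\<lambda>k _. var k) (\<lambda>_ _. 0) K D) m = schur D m"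
proof -
  have e: "{T \<in> ptab left_of over K D. tab_content D T = m} = {T \<in> tableaux D. semistandard D T \<and> tab_content D T = m}"
  proof -
    have "T b \<le> K" if "tab_content D T = m" "b \<in> D" for T b
      by (rule label_le_of_content[OF D that(1) K that(2)])
    then show ?thesis unfolding ptab_semistandard by blast
  qed
  have "row_sum (\<lambda>k _. var k) (\<lambda>_ _. 0) K D = (\<Sum>T\<in>ptab left_of over K D. Poly_Mapping.single (tab_content D T) 1)"
    unfolding tab_sum_single[OF D] var_def prod_single tab_content_def ..
  then have "Poly_Mapping.lookup (row_sum (\<lambda>k _. var k) (\<lambda>_ _. 0) K D) m =
      (\<Sum>T\<in>ptab left_of over K D. if tab_content D T = m then 1 else 0)"
    by (simp add: lookup_sum_pm lookup_single when_def eq_commute[of m])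
  also have "\<dots> = int (card {T \<in> ptab left_of over K D. tab_content D T = m})"
    using finite_ptab[OF D] by (simp add: sum.If_cases Int_def)
  finally show ?thesis unfolding e schur_def .
qed

lemma sv_size_eq:
  assumes D: "finite D" and T: "\<And>b. b \<in> D \<Longrightarrow> finite (T b)"
  shows "sv_size D T = (\<Sum>b\<in>D. card (T b))"
proof -
  let ?C = "sv_content D T"
  have sub: "T b \<subseteq> Poly_Mapping.keys ?C" if "b \<in> D" for b
  proof
    fix i assume "i \<in> T b"
    then have "card {b \<in> D. i \<in> T b} \<noteq> 0" by (rule card_filter_nonzero[where P = "\<lambda>b. i \<in> T b", OF D that])
    then show "i \<in> Poly_Mapping.keys ?C" using lookup_sv_content[of D T i] D T by (simp add: in_keys_iff)
  qed
  have "sv_size D T = (\<Sum>i\<in>Poly_Mapping.keys ?C. \<Sum>b\<in>D. if i \<in> T b then 1 else 0)"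
    unfolding sv_size_def using lookup_sv_content[of D T] D T by (simp add: sum.If_cases Int_def)
  also have "\<dots> = (\<Sum>b\<in>D. \<Sum>i\<in>Poly_Mapping.keys ?C. if i \<in> T b then 1 else 0)" by (rule sum.swap)
  also have "\<dots> = (\<Sum>b\<in>D. card (T b))"
  proof (rule sum.cong[OF refl])
    fix b assume "b \<in> D"
    then have "Poly_Mapping.keys ?C \<inter> {i. i \<in> T b} = T b" using sub[of b] by blast
    then show "(\<Sum>i\<in>Poly_Mapping.keys ?C. if i \<in> T b then 1 else 0) = card (T b)" by (simp add: sum.If_cases)
  qed
  finally show ?thesis .
qed

text \<open>A box with \<open>t\<close> labels contributes \<open>t - 1\<close> signs. Entries are
  nonempty, so these truncated differences add up to the exponent of the global sign.\<close>

lemma tab_wt_var: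
  assumes D: "finite D" and T: "T \<in> svtab R Q K D"
  shows "tab_wt (\<lambda>k _. var k) (\<lambda>k _. - var k) D T =
    of_int ((-1) ^ (sv_size D T - card D)) * Poly_Mapping.single (sv_content D T) 1"
proof -
  have f: "finite (T b)" "T b \<noteq> {}" if "b \<in> D" for b
    using svtabD(1,2)[OF T that] finite_subset by blast+
  have row: "var (Min (T b)) * (\<Prod>i\<in>T b - {Min (T b)}. - var i) = (-1) ^ (card (T b) - 1) * (\<Prod>i\<in>T b. var i)"
    if "b \<in> D" for b
  proof -
    have m: "Min (T b) \<in> T b" using f that by auto
    have "(\<Prod>i\<in>T b - {Min (T b)}. - var i) = (\<Prod>i\<in>T b - {Min (T b)}. (-1) * var i)" by simp
    also have "\<dots> = (-1) ^ (card (T b) - 1) * (\<Prod>i\<in>T b - {Min (T b)}. var i)"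
      unfolding prod.distrib using m f[OF that] by simp
    finally show ?thesis using prod.remove[OF f(1)[OF that] m, of var] by (simp add: mult_ac)
  qed
  have ex: "sv_size D T - card D = (\<Sum>b\<in>D. card (T b) - 1)"
  proof -
    have "(\<Sum>b\<in>D. card (T b) - 1) = (\<Sum>b\<in>D. card (T b)) - (\<Sum>b\<in>D. 1)"
      using f by (intro sum_subtractf_nat) (simp add: Suc_le_eq card_gt_0_iff)
    then show ?thesis using sv_size_eq[OF D f(1)] by simp
  qed
  have "tab_wt (\<lambda>k _. var k) (\<lambda>k _. - var k) D T = (\<Prod>b\<in>D. (-1) ^ (card (T b) - 1) * (\<Prod>i\<in>T b. var i))"
    unfolding tab_wt_def by (rule prod.cong[OF refl row])
  also have "\<dots> = (-1) ^ (sv_size D T - card D) * (\<Prod>b\<in>D. \<Prod>i\<in>T b. var i)"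
    unfolding prod.distrib ex by (simp add: power_sum)
  also have "(\<Prod>b\<in>D. \<Prod>i\<in>T b. var i) = Poly_Mapping.single (sv_content D T) 1"
    unfolding var_def prod_single sv_content_def ..
  finally show ?thesis by simp
qed

lemma svtab_eq:
  assumes K: "Poly_Mapping.keys m \<subseteq> {..K}" and D: "finite D"
  shows "{T \<in> svtab left_of over K D. sv_content D T = m} =
         {T \<in> sv_tableaux D. sv_semistandard D T \<and> sv_content D T = m}"
proof (intro set_eqI iffI)
  fix T assume "T \<in> {T \<in> svtab left_of over K D. sv_content D T = m}"
  then have T: "T \<in> svtab left_of over K D" and m: "sv_content D T = m" by auto
  note T' = svtabD[OF T]
  have f: "finite (T b)" "T b \<noteq> {}" if "b \<in> D" for b using T'(1,2)[OF that] finite_subset by blast+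
  have "T \<in> sv_tableaux D" unfolding sv_tableaux_def
    by (rule PiE_I) (use f T'(2,3) in fastforce)+
  moreover have "sv_semistandard D T" unfolding sv_semistandard_def
  proof (intro conjI allI impI)
    fix i j j' assume a: "(i, j) \<in> D \<and> (i, j') \<in> D \<and> j < j'"
    show "Max (T (i, j)) \<le> Min (T (i, j'))"
      by (rule T'(4)[of "(i, j)" "(i, j')"]) (use a f in \<open>auto simp: left_of_def\<close>)
  next
    fix i i' j assume a: "(i, j) \<in> D \<and> (i', j) \<in> D \<and> i < i'"
    show "Max (T (i, j)) < Min (T (i', j))"
      by (rule T'(5)[of "(i, j)" "(i', j)"]) (use a f in \<open>auto simp: over_def\<close>)
  qed
  ultimately show "T \<in> {T \<in> sv_tableaux D. sv_semistandard D T \<and> sv_content D T = m}" using m by blast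
next
  fix T assume "T \<in> {T \<in> sv_tableaux D. sv_semistandard D T \<and> sv_content D T = m}"
  then have T: "T \<in> sv_tableaux D" and ss: "sv_semistandard D T" and m: "sv_content D T = m" by auto
  have T1: "finite (T b) \<and> T b \<noteq> {} \<and> T b \<subseteq> {1..}" if "b \<in> D" for b
    using PiE_mem[OF T[unfolded sv_tableaux_def] that] by blast
  have leK: "i \<le> K" if "b \<in> D" "i \<in> T b" for b i
  proof -
    have "card {b \<in> D. i \<in> T b} \<noteq> 0" by (rule card_filter_nonzero[where P = "\<lambda>b. i \<in> T b", OF D that])
    then have "i \<in> Poly_Mapping.keys m" using lookup_sv_content[of D T i] D T1 m by (simp add: in_keys_iff)
    then show ?thesis using K by auto
  qed
  have "T \<in> svtab left_of over K D"
  proof (rule svtabI)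
    fix b assume b: "b \<in> D"
    show "T b \<noteq> {}" using T1[OF b] by blast
    show "T b \<subseteq> {1..K}" using T1[OF b] leK[OF b] by fastforce
  next
    fix b assume "b \<notin> D"
    then show "T b = undefined" using T unfolding sv_tableaux_def by (rule PiE_arb[rotated])
  next
    fix b b' i j assume a: "b \<in> D" "b' \<in> D" "left_of b b'" "i \<in> T b" "j \<in> T b'"
    have "Max (T b) \<le> Min (T b')" using ss a(1-3) unfolding sv_semistandard_def left_of_def
      by (cases b; cases b') auto
    then show "i \<le> j" using a T1[of b] T1[of b'] by (meson Max_ge Min_le order_trans)
  next
    fix b b' i j assume a: "b \<in> D" "b' \<in> D" "over b b'" "i \<in> T b" "j \<in> T b'"
    have "Max (T b) < Min (T b')" using ss a(1-3) unfolding sv_semistandard_def over_def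
      by (cases b; cases b') auto
    then show "i < j" using a T1[of b] T1[of b'] by (meson Max_ge Min_le order.strict_trans1 order.strict_trans2)
  qed
  then show "T \<in> {T \<in> svtab left_of over K D. sv_content D T = m}" using m by blast
qed

lemma lookup_grothendieck:
  assumes D: "finite D" and K: "Poly_Mapping.keys m \<subseteq> {..K}"
  shows "Poly_Mapping.lookup (row_sum (\<lambda>k _. var k) (\<lambda>k _. - var k) K D) m = grothendieck D m"
proof -
  have "Poly_Mapping.lookup (row_sum (\<lambda>k _. var k) (\<lambda>k _. - var k) K D) m =
     (\<Sum>T\<in>svtab left_of over K D. if sv_content D T = m then (-1) ^ (sv_size D T - card D) else 0)"
    unfolding tab_sum_def lookup_sum_pm
    by (intro sum.cong refl, subst tab_wt_var[OF D], assumption, subst lookup_of_int_mult)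
      (simp add: lookup_single when_def)
  also have "\<dots> = (\<Sum>T\<in>{T \<in> svtab left_of over K D. sv_content D T = m}. (-1) ^ (sv_size D T - card D))"
    by (rule sum.inter_filter[OF finite_svtab[OF D], symmetric])
  finally show ?thesis unfolding svtab_eq[OF K D] grothendieck_def .
qed

section \<open>Geometry of connected skew shapes\<close>

lemma skew_shape_interval:
  "skew_shape \<mu> \<Longrightarrow> a \<in> \<mu> \<Longrightarrow> d \<in> \<mu> \<Longrightarrow> a \<le> b \<Longrightarrow> b \<le> d \<Longrightarrow> b \<in> \<mu>"
  unfolding skew_shape_def by (meson atLeastAtMost_iff subsetD)

lemma skew_shape_between:
  assumes "skew_shape \<mu>" "(i, j) \<in> \<mu>" "(i'', j'') \<in> \<mu>" "i \<le> i'" "i' \<le> i''" "j \<le> j'" "j' \<le> j''"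
  shows "(i', j') \<in> \<mu>"
  by (rule skew_shape_interval[OF assms(1-3)]) (use assms in auto)

text \<open>If rows \<open>i\<close> and \<open>i + 1\<close> share no column, no Hasse edge leads
  from the rows up to \<open>i\<close> to those below: the interval spanned by such an edge from
  \<open>x\<close> would contain \<open>(i, snd x)\<close> and \<open>(Suc i, snd x)\<close>. A path
  from \<open>a\<close> then never gets past row \<open>i\<close>.\<close>

lemma connected_rows_overlap:
  assumes sk: "skew_shape \<sigma>" and con: "connected_shape \<sigma>"
    and a: "a \<in> \<sigma>" "fst a \<le> i" and b: "b \<in> \<sigma>" "i < fst b"
  shows "\<exists>q. (i, q) \<in> \<sigma> \<and> (Suc i, q) \<in> \<sigma>"
proof (rule ccontr)
  assume no: "\<not> ?thesis"
  have up: "fst y \<le> i" if h: "(x, y) \<in> hasse \<sigma>" and x: "fst x \<le> i" for x y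
  proof (rule ccontr)
    assume y: "\<not> fst y \<le> i"
    have xy: "x \<in> \<sigma>" "y \<in> \<sigma>" "x \<le> y" using h by (auto simp: hasse_def)
    have "(i, snd x) \<in> \<sigma>" "(Suc i, snd x) \<in> \<sigma>"
      using skew_shape_between[OF sk, of "fst x" "snd x" "fst y" "snd y"] xy x y by (auto simp: less_eq_prod_def)
    then show False using no by blast
  qed
  have "(a, b) \<in> (hasse \<sigma> \<union> (hasse \<sigma>)\<inverse>)\<^sup>*" using con a b unfolding connected_shape_def by blast
  then have "fst b \<le> i"
  proof (induction rule: rtrancl_induct)
    case base then show ?case by fact
  next
    case (step y z)
    then show ?case
    proof (elim UnE)
      assume "(y, z) \<in> hasse \<sigma>" then show ?thesis using up step.IH by blast
    next
      assume "(y, z) \<in> (hasse \<sigma>)\<inverse>"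
      then have "z \<le> y" by (auto simp: hasse_def)
      then show ?thesis using step.IH by (simp add: less_eq_prod_def)
    qed
  qed
  then show False using b by simp
qed

context strips
begin

text \<open>Serves both \<sigma> (with \<open>R = n\<close>) and the shapes around it (with
  \<open>R = N\<close>). Overlapping rows make the row ends decrease down to row \<open>n\<close>.
  Below that, \<open>(n, c)\<close> is a box in the leftmost column, and convexity lets every
  nonempty row start at \<open>c\<close>; empty rows there get \<open>c\<close> for both
  ends.\<close>

lemma skew_shape_region:
  assumes sk: "skew_shape \<mu>" and n: "1 \<le> n" "n \<le> R" and corner: "(n, c) \<in> \<mu>"
    and box: "\<And>i j. (i, j) \<in> \<mu> \<Longrightarrow> i \<le> R \<and> c \<le> j \<and> j < M"
    and ov: "\<And>i. 1 \<le> i \<Longrightarrow> i < n \<Longrightarrow> \<exists>q. (i, q) \<in> \<mu> \<and> (Suc i, q) \<in> \<mu>"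
  shows "\<exists>l\<in>states n. \<exists>u\<in>states R. skew_region l u = \<mu> \<and> l n = c \<and> (\<forall>i\<in>{1..n}. l i < u i)"
proof -
  define l where "l i = (if i = 0 then M else if i \<le> n then LEAST j. (i, j) \<in> \<mu> else c)" for i
  define mx where "mx i = Max {j. (i, j) \<in> \<mu>}" for i
  define u where "u i = (if i = 0 then M else if \<exists>j. (i, j) \<in> \<mu> then Suc (mx i) else c)" for i
  have row: "\<exists>j. (i, j) \<in> \<mu>" if "i \<in> {1..n}" for i
    using ov[of i] corner that by (cases "i = n") auto
  have l: "(i, l i) \<in> \<mu>" if "i \<in> {1..n}" for i
    using LeastI_ex[OF row[OF that]] that by (simp add: l_def)
  have lle: "l i \<le> j" if "i \<in> {1..n}" "(i, j) \<in> \<mu>" for i j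
    using Least_le[of "\<lambda>j. (i, j) \<in> \<mu>", OF that(2)] that by (simp add: l_def)
  have pos: "1 \<le> i" if "(i, j) \<in> \<mu>" for i j using sk that unfolding skew_shape_def by blast
  have fin: "finite {j. (i, j) \<in> \<mu>}" for i
    by (rule finite_subset[of _ "{..M}"]) (use box in \<open>force\<close>, simp)
  have mx: "(i, mx i) \<in> \<mu>" if "(i, j) \<in> \<mu>" for i j
    using Max_in[OF fin, of i] that by (auto simp: mx_def)
  have mxge: "j \<le> mx i" if "(i, j) \<in> \<mu>" for i j
    using Max_ge[OF fin, of j i] that by (simp add: mx_def)
  have tail: "(i, j) \<in> \<mu>" if "(i', j') \<in> \<mu>" "n \<le> i" "i \<le> i'" "c \<le> j" "j \<le> j'" for i j i' j'
    using skew_shape_between[OF sk corner that(1)] that by blast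
  have mem: "(i, j) \<in> \<mu> \<longleftrightarrow> 1 \<le> i \<and> l i \<le> j \<and> j < u i" for i j
  proof
    assume ij: "(i, j) \<in> \<mu>"
    have i: "1 \<le> i" using pos ij by blast
    have "l i \<le> j" using lle[of i j] ij box[OF ij] i by (cases "i \<le> n") (auto simp: l_def)
    moreover have "j < u i" using mxge[OF ij] ij i by (auto simp: u_def)
    ultimately show "1 \<le> i \<and> l i \<le> j \<and> j < u i" using i by blast
  next
    assume a: "1 \<le> i \<and> l i \<le> j \<and> j < u i"
    show "(i, j) \<in> \<mu>"
    proof (cases "\<exists>j. (i, j) \<in> \<mu>")
      case True
      then have m: "(i, mx i) \<in> \<mu>" using mx by blast
      have j: "j \<le> mx i" 
      proof -
        have "u i = Suc (mx i)" using True a by (auto simp: u_def)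
        then show ?thesis using a by simp
      qed
      show ?thesis
      proof (cases "i \<le> n")
        case True
        then show ?thesis using skew_shape_between[OF sk l[of i] m, of i j] a j by simp
      next
        case False
        then show ?thesis using tail[OF m, of i j] a j by (simp add: l_def)
      qed
    next
      case False
      then have "i \<notin> {1..n}" using row by blast
      then show ?thesis using a False by (auto simp: l_def u_def)
    qed
  qed
  have ln: "l n = c"
  proof (rule antisym)
    show "l n \<le> c" using lle[OF _ corner] n by simp
    show "c \<le> l n" using box[OF l[of n]] n by simp
  qed
  have "l (Suc i) \<le> l i" for i
  proof -
    consider "i = 0" | "1 \<le> i" "i < n" | "n \<le> i" "i \<noteq> 0" by linarith
    then show ?thesis
    proof cases
      case 1
      then show ?thesis using box[OF l[of 1]] n by (simp add: l_def)
    next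
      case 2
      then obtain q where q: "(i, q) \<in> \<mu>" "(Suc i, q) \<in> \<mu>" using ov by blast
      have "(Suc i, l i) \<in> \<mu>"
        by (rule skew_shape_between[OF sk l[of i] q(2)]) (use 2 lle[OF _ q(1)] in auto)
      then show ?thesis using lle[of "Suc i"] 2 by simp
    next
      case 3
      then show ?thesis using ln by (cases "i = n") (auto simp: l_def)
    qed
  qed
  then have ls: "l \<in> states n" by (simp add: states_def l_def)
  have "u (Suc i) \<le> u i" for i
  proof (cases "\<exists>j. (Suc i, j) \<in> \<mu>")
    case True
    then have m: "(Suc i, mx (Suc i)) \<in> \<mu>" using mx by blast
    have us: "u (Suc i) = Suc (mx (Suc i))" using True by (simp add: u_def)
    show ?thesis
    proof (cases "i = 0")
      case True
      then show ?thesis using box[OF m] us by (simp add: u_def)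
    next
      case i: False
      have "(i, mx (Suc i)) \<in> \<mu>"
      proof (cases "i < n")
        case True
        then obtain q where q: "(i, q) \<in> \<mu>" "(Suc i, q) \<in> \<mu>" using ov[of i] i by auto
        show ?thesis by (rule skew_shape_between[OF sk q(1) m]) (use mxge[OF q(2)] in auto)
      next
        case False
        then show ?thesis using tail[OF m, of i] box[OF m] by simp
      qed
      then show ?thesis using us i mxge[of i "mx (Suc i)"] by (auto simp: u_def)
    qed
  next
    case False
    have "c \<le> u i"
    proof (cases "i = 0")
      case True
      then show ?thesis using box[OF corner] by (simp add: u_def)
    next
      case i: False
      show ?thesis
      proof (cases "\<exists>j. (i, j) \<in> \<mu>")
        case True
        then obtain j where "(i, j) \<in> \<mu>" by blast
        from box[OF mx[OF this]] show ?thesis using i True by (simp add: u_def)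
      qed (use i in \<open>simp add: u_def\<close>)
    qed
    then show ?thesis using False by (simp add: u_def)
  qed
  moreover have "u i = c" if "R < i" for i
  proof -
    have "\<not> (\<exists>j. (i, j) \<in> \<mu>)" using box that by fastforce
    then show ?thesis using that by (simp add: u_def)
  qed
  ultimately have us: "u \<in> states R" by (simp add: states_def u_def)
  have "skew_region l u = \<mu>" using mem by (auto simp: skew_region_def)
  moreover have "l i < u i" if "i \<in> {1..n}" for i using mem[of i "l i"] l[OF that] by simp
  ultimately show ?thesis using ls us ln by blast
qed

end

text \<open>By \<open>l_n\<close> and \<open>u_1\<close> the extreme columns of the shape are
  \<open>c\<close> and \<open>M - 1\<close>, so the bounds built into \<open>states\<close> express
  that a larger shape stays within the columns of \<sigma>. Connectedness enters as
  \<open>overlap\<close>.\<close>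

locale skew_frame = strips +
  fixes n :: nat and l u :: "nat \<Rightarrow> nat"
  assumes n: "1 \<le> n" "n \<le> N"
    and l: "l \<in> states n" and u: "u \<in> states n" and l_n: "l n = c"
    and row_nonempty: "i \<in> {1..n} \<Longrightarrow> l i < u i"
    and overlap: "1 \<le> i \<Longrightarrow> i < n \<Longrightarrow> l i < u (Suc i)"
    and u_1: "u 1 = M"
begin

abbreviation "\<sigma> \<equiv> skew_region l u"

definition inner_states :: "(nat \<Rightarrow> nat) set" where
  "inner_states = {l' \<in> states N. \<forall>i. l' i \<le> l i}"

definition outer_states :: "(nat \<Rightarrow> nat) set" where
  "outer_states = {u' \<in> states N. \<forall>i. u i \<le> u' i}"

lemma lN: "l \<in> states N" and uN: "u \<in> states N"
  using l u n states_subset[of n N] by auto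

lemma l_le_u: "l i \<le> u i"
proof -
  consider "i = 0" | "i \<in> {1..n}" | "n < i" by fastforce
  then show ?thesis
    using row_nonempty[of i] states_0[OF l] states_0[OF u] states_const[OF l, of i] states_const[OF u, of i]
    by cases auto
qed

text \<open>Walk down from row 1: if column \<open>j\<close> is left of row \<open>i\<close>, then
  \<open>j < l i < u (Suc i)\<close>, so it is not right of the next row. The walk ends at the
  latest in row \<open>n\<close>, which starts in column \<open>c\<close>.\<close>

lemma column_covered:
  assumes "c \<le> j" "j < M"
  shows "\<exists>i. (i, j) \<in> \<sigma>"
proof -
  have "\<exists>i'. (i', j) \<in> \<sigma>" if "i \<le> n" "1 \<le> i" "j < u i" for i
    using that
  proof (induction i rule: inc_induct)
    case base
    then show ?case using assms l_n by (auto simp: skew_region_def)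
  next
    case (step i)
    show ?case
    proof (cases "l i \<le> j")
      case True
      then show ?thesis using step by (auto simp: skew_region_def)
    next
      case False
      then show ?thesis using step overlap[of i] by auto
    qed
  qed
  from this[of 1] show ?thesis using assms u_1 n by simp
qed

lemma inner_tail:
  assumes "l' \<in> inner_states" "n \<le> i"
  shows "l' i = c"
proof (rule antisym)
  have "l' \<in> states N" "l' i \<le> l i" using assms(1) by (auto simp: inner_states_def)
  then show "c \<le> l' i" "l' i \<le> c"
    using states_ge[of l' N i] states_mono[OF l assms(2)] l_n by simp_all
qed

lemma region_row:
  assumes "l' \<in> inner_states" "u' \<in> outer_states"
  shows "l' \<in> states N" "u' \<in> states N" "l' i \<le> l i" "u i \<le> u' i" "l' i \<le> u' i"
    "i \<in> {1..n} \<Longrightarrow> l' i < u' i"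
proof -
  show *: "l' \<in> states N" "u' \<in> states N" "l' i \<le> l i" "u i \<le> u' i"
    using assms by (auto simp: inner_states_def outer_states_def)
  show "l' i \<le> u' i" using * l_le_u[of i] by simp
  show "l' i < u' i" if "i \<in> {1..n}" using * row_nonempty[OF that] by simp
qed

section \<open>The parts of a containing shape above and below the given one\<close>

context
  fixes l' u'
  assumes l': "l' \<in> inner_states" and u': "u' \<in> outer_states"
begin

lemma region_cases:
  "(i, j) \<in> skew_region l' u' \<longleftrightarrow> (i, j) \<in> \<sigma> \<or> (i, j) \<in> skew_region l' l \<or> (i, j) \<in> skew_region u u'"
  using region_row(3-5)[OF l' u', of i] l_le_u[of i] by (auto simp: skew_region_def)

lemma region_column: "(i, j) \<in> skew_region l' u' \<Longrightarrow> \<exists>i'. (i', j) \<in> \<sigma>"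
  using states_ge[OF region_row(1)[OF l' u'], of i] states_le[OF region_row(2)[OF l' u'], of i]
  by (intro column_covered) (auto simp: skew_region_def)

lemma skew_shape_skew_region: "skew_shape (skew_region l' u')"
  unfolding skew_shape_def
proof (intro conjI ballI subsetI)
  note st = region_row(1,2)[OF l' u']
  show "finite (skew_region l' u')" by (rule finite_skew_region[OF st])
  show "case b of (i, j) \<Rightarrow> 1 \<le> i \<and> 1 \<le> j" if "b \<in> skew_region l' u'" for b
    using that states_ge[OF st(1), of "fst b"] c_pos by (auto simp: skew_region_def)
  fix a d b assume a: "a \<in> skew_region l' u'" and d: "d \<in> skew_region l' u'" and b: "b \<in> {a..d}"
  have "fst a \<le> fst b" "fst b \<le> fst d" "snd a \<le> snd b" "snd b \<le> snd d"
    using b by (auto simp: less_eq_prod_def)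
  then show "b \<in> skew_region l' u'"
    using a d states_mono[OF st(1), of "fst a" "fst b"] states_mono[OF st(2), of "fst b" "fst d"]
    by (auto simp: skew_region_def)
qed

lemma contains_shape_skew_region: "contains_shape (skew_region l' u') \<sigma>"
  unfolding contains_shape_def
proof
  show "\<sigma> \<subseteq> skew_region l' u'" using region_cases by auto
  show "snd ` skew_region l' u' \<subseteq> snd ` \<sigma>" using region_column by force
qed

text \<open>Every column of the larger shape meets \<sigma>. For a box to the left of \<sigma> in
  its row, the box of \<sigma> in its column must lie lower, because \<open>l\<close>
  decreases.\<close>

lemma above_skew_region: "above (skew_region l' u') \<sigma> = skew_region l' l"
proof (rule set_eqI)
  fix b :: box
  obtain i j where b: "b = (i, j)" by (cases b)
  show "b \<in> above (skew_region l' u') \<sigma> \<longleftrightarrow> b \<in> skew_region l' l"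
  proof
    assume "b \<in> above (skew_region l' u') \<sigma>"
    then obtain i' where i': "(i, j) \<in> skew_region l' u'" "(i, j) \<notin> \<sigma>" "(i', j) \<in> \<sigma>" "i < i'"
      by (auto simp: above_def b)
    then show "b \<in> skew_region l' l"
      using states_mono[OF u, of i i'] by (auto simp: b skew_region_def)
  next
    assume bl: "b \<in> skew_region l' l"
    then obtain i' where i': "(i', j) \<in> \<sigma>" using region_column[of i j] region_cases by (auto simp: b)
    have "i < i'"
    proof (rule ccontr)
      assume "\<not> i < i'"
      then show False using bl i' states_mono[OF l, of i' i] by (auto simp: b skew_region_def)
    qed
    moreover have "b \<in> skew_region l' u'" using bl region_cases by (simp add: b)
    moreover have "b \<notin> \<sigma>" using bl by (auto simp: b skew_region_def)
    ultimately show "b \<in> above (skew_region l' u') \<sigma>" using i' unfolding above_def b by blast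
  qed
qed

lemma below_skew_region: "below (skew_region l' u') \<sigma> = skew_region u u'"
proof (rule set_eqI)
  fix b :: box
  obtain i j where b: "b = (i, j)" by (cases b)
  show "b \<in> below (skew_region l' u') \<sigma> \<longleftrightarrow> b \<in> skew_region u u'"
  proof
    assume "b \<in> below (skew_region l' u') \<sigma>"
    then obtain i' where i': "(i, j) \<in> skew_region l' u'" "(i, j) \<notin> \<sigma>" "(i', j) \<in> \<sigma>" "i' < i"
      by (auto simp: below_def b)
    then show "b \<in> skew_region u u'"
      using states_mono[OF l, of i' i] by (auto simp: b skew_region_def)
  next
    assume bl: "b \<in> skew_region u u'"
    then obtain i' where i': "(i', j) \<in> \<sigma>" using region_column[of i j] region_cases by (auto simp: b)
    have "i' < i"
    proof (rule ccontr)
      assume "\<not> i' < i"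
      then show False using bl i' states_mono[OF u, of i i'] by (auto simp: b skew_region_def)
    qed
    moreover have "b \<in> skew_region l' u'" using bl region_cases by (simp add: b)
    moreover have "b \<notin> \<sigma>" using bl by (auto simp: b skew_region_def)
    ultimately show "b \<in> below (skew_region l' u') \<sigma>" using i' unfolding below_def b by blast
  qed
qed

end

text \<open>Nonempty rows determine their ends. Empty rows occur only below row \<open>n\<close>,
  where the left end is always \<open>c\<close> and hence the right end is \<open>c\<close> as
  well.\<close>

lemma skew_region_inj: "inj_on (\<lambda>(l', u'). skew_region l' u') (inner_states \<times> outer_states)"
proof (rule inj_onI, clarify)
  fix l1 u1 l2 u2
  assume m: "l1 \<in> inner_states" "u1 \<in> outer_states" "l2 \<in> inner_states" "u2 \<in> outer_states"
    and eq: "skew_region l1 u1 = skew_region l2 u2"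
  have le: "l2 i \<le> l1 i \<and> u1 i \<le> u2 i"
    if m: "l1 \<in> inner_states" "u1 \<in> outer_states" "l2 \<in> inner_states" "u2 \<in> outer_states"
      and eq: "skew_region l1 u1 = skew_region l2 u2" for l1 u1 l2 u2 i
  proof (cases "l1 i < u1 i \<and> i \<noteq> 0")
    case True
    then have "(i, l1 i) \<in> skew_region l1 u1" "(i, u1 i - 1) \<in> skew_region l1 u1"
      by (auto simp: skew_region_def)
    then have "(i, l1 i) \<in> skew_region l2 u2" "(i, u1 i - 1) \<in> skew_region l2 u2"
      unfolding eq .
    then show ?thesis by (auto simp: skew_region_def)
  next
    case False
    then consider "i = 0" | "i \<noteq> 0" "n < i" "u1 i \<le> l1 i"
      using region_row(6)[OF m(1,2), of i] by fastforce
    then show ?thesis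
    proof cases
      case 1
      then show ?thesis
        using states_0[OF region_row(1)[OF m(1,2)]] states_0[OF region_row(1)[OF m(3,4)]]
          states_0[OF region_row(2)[OF m(1,2)]] states_0[OF region_row(2)[OF m(3,4)]] by simp
    next
      case 2
      then show ?thesis
        using inner_tail[OF m(1), of i] inner_tail[OF m(3), of i] states_ge[OF region_row(2)[OF m(3,4)], of i]
        by simp
    qed
  qed
  have "l1 i = l2 i \<and> u1 i = u2 i" for i
    using le[OF m eq, of i] le[OF m(3,4,1,2) eq[symmetric], of i] by simp
  then show "l1 = l2 \<and> u1 = u2" by blast
qed

lemma coefficient_identity:
  assumes K: "n + K \<le> N" and m: "Poly_Mapping.keys m \<subseteq> {..K}"
  shows "grothendieck \<sigma> m = (\<Sum>l'\<in>inner_states. \<Sum>u'\<in>outer_states.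
     (-1) ^ card (below (skew_region l' u') \<sigma>) * int (expansion_coeff \<sigma> (skew_region l' u')) * schur (skew_region l' u') m)"
    (is "_ = (\<Sum>l'\<in>_. \<Sum>u'\<in>_. ?f l' u')")
proof -
  let ?c = "\<lambda>r l' u'. chain (strip_wt r l' var) (\<lambda>\<nu>. if \<nu> = l' then 1 else 0) K u'"
  have rows: "fst b \<le> N \<and> 1 \<le> fst b" if "b \<in> skew_region l' u'" "l' \<in> states N" "u' \<in> states N" for b l' u'
    using that by (auto simp: skew_region_Sigma)
  \<comment> \<open>The expansion is used with \<open>r = N\<close>: then all rows of \<sigma> may
    carry several labels, and labels up to \<open>N\<close> exhaust the row-bounded tableaux because
    no row index exceeds \<open>N\<close>.\<close>
  have "row_sum (\<lambda>k _. var k) (\<lambda>k _. - var k) K \<sigma> = row_sum (\<lambda>k _. var k) (\<lambda>k. excess N (var k)) K \<sigma>"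
    using rows[OF _ lN uN] by (intro tab_sum_cong) (auto simp: excess_def)
  also have "\<dots> = ?c N l u"
    using chain_eq_row_sum[OF lN uN, of "\<lambda>k _. var k" "\<lambda>k. excess N (var k)" K] l_le_u
    by (simp add: strip_wt_def[abs_def])
  also have "\<dots> = (\<Sum>l'\<in>states N. \<Sum>u'\<in>states N. above_sum N l' l * below_sum N u u' * ?c 0 l' u')"
    by (rule chain_expansion[OF K order_refl l uN l_le_u])
  finally have "grothendieck \<sigma> m =
      (\<Sum>l'\<in>states N. \<Sum>u'\<in>states N. Poly_Mapping.lookup (above_sum N l' l * below_sum N u u' * ?c 0 l' u') m)"
    using lookup_grothendieck[OF finite_skew_region[OF lN uN] m] by (simp add: lookup_sum_pm)
  also have "\<dots> = (\<Sum>l'\<in>states N. \<Sum>u'\<in>states N. if l' \<in> inner_states \<and> u' \<in> outer_states then ?f l' u' else 0)"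
  proof (intro sum.cong refl)
    fix l' u' assume st: "l' \<in> states N" "u' \<in> states N"
    show "Poly_Mapping.lookup (above_sum N l' l * below_sum N u u' * ?c 0 l' u') m =
        (if l' \<in> inner_states \<and> u' \<in> outer_states then ?f l' u' else 0)"
    proof (cases "l' \<in> inner_states \<and> u' \<in> outer_states")
      case True
      then have i: "l' \<in> inner_states" and o: "u' \<in> outer_states" by auto
      note rr = region_row[OF i o]
      let ?A = "skew_region l' l" and ?B = "skew_region u u'" and ?\<mu> = "skew_region l' u'"
      have fA: "finite ?A" and fB: "finite ?B" and f\<mu>: "finite ?\<mu>"
        using finite_skew_region st lN uN by auto
      have "above_sum N l' l = row_sum flag (\<lambda>_ _. 0) N ?A"
        unfolding above_sum_def using chain_eq_row_sum[OF st(1) lN, of flag "\<lambda>_ _. 0" N] rr(3) by simp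
      also have "\<dots> = of_nat (card {T \<in> tableaux ?A. semistandard ?A T \<and> row_weakly_bounded ?A T})"
        by (rule sum_flag[OF fA]) (use rows[OF _ st(1) lN] in blast)
      finally have a: "above_sum N l' l = (of_nat (card {T \<in> tableaux ?A. semistandard ?A T \<and> row_weakly_bounded ?A T}) :: mpoly)" .
      have "below_sum N u u' = column_sum signed_flag N ?B"
        unfolding below_sum_def using uN rr(4) by simp
      also have "\<dots> = (-1) ^ card ?B * of_nat (card {T \<in> tableaux ?B. reverse_row_strict ?B T \<and> row_bounded ?B T})"
        by (rule sum_signed_flag[OF fB]) (use rows[OF _ uN st(2)] in blast)
      finally have b: "below_sum N u u' = ((-1) ^ card ?B *
          of_nat (card {T \<in> tableaux ?B. reverse_row_strict ?B T \<and> row_bounded ?B T}) :: mpoly)" .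
      have "?c 0 l' u' = row_sum (\<lambda>k _. var k) (\<lambda>k. excess 0 (var k)) K ?\<mu>"
        using chain_eq_row_sum[OF st, of "\<lambda>k _. var k" "\<lambda>k. excess 0 (var k)" K] rr(5)
        by (simp add: strip_wt_def[abs_def])
      also have "\<dots> = row_sum (\<lambda>k _. var k) (\<lambda>_ _. 0) K ?\<mu>"
        using rows[OF _ st] by (intro tab_sum_cong) (force simp: excess_def)+
      finally have s: "?c 0 l' u' = row_sum (\<lambda>k _. var k) (\<lambda>_ _. 0) K ?\<mu>" .
      have "above_sum N l' l * below_sum N u u' * ?c 0 l' u' =
          of_int ((-1) ^ card ?B * int (expansion_coeff \<sigma> ?\<mu>)) * row_sum (\<lambda>k _. var k) (\<lambda>_ _. 0) K ?\<mu>"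
        unfolding a b s expansion_coeff_def above_skew_region[OF i o] below_skew_region[OF i o]
        by (simp add: mult_ac)
      then have "Poly_Mapping.lookup (above_sum N l' l * below_sum N u u' * ?c 0 l' u') m = ?f l' u'"
        by (simp only: lookup_of_int_mult lookup_schur[OF f\<mu> m] below_skew_region[OF i o])
      then show ?thesis unfolding if_P[OF True] .
    next
      case False
      then consider "\<not> (\<forall>i. l' i \<le> l i)" | "\<not> (\<forall>i. u i \<le> u' i)"
        using st unfolding inner_states_def outer_states_def by blast
      then have "above_sum N l' l = (0::mpoly) \<or> below_sum N u u' = (0::mpoly)"
      proof cases
        case 1
        then have "above_sum N l' l = (0::mpoly)"
          unfolding above_sum_def chain_eq_row_sum[OF st(1) lN, of flag "\<lambda>_ _. 0" N] by (rule if_not_P)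
        then show ?thesis ..
      next
        case 2
        then show ?thesis unfolding below_sum_def by meson
      qed
      then show ?thesis using False by (elim disjE) (simp_all only: mult_zero_left mult_zero_right lookup_zero if_False)
    qed
  qed
  also have "\<dots> = (\<Sum>l'\<in>inner_states. \<Sum>u'\<in>outer_states. ?f l' u')"
  proof (rule sum.mono_neutral_cong_right)
    show "finite (states N)" by (rule finite_states)
    show "inner_states \<subseteq> states N" by (auto simp: inner_states_def)
    show "\<forall>l'\<in>states N - inner_states. (\<Sum>u'\<in>states N. if l' \<in> inner_states \<and> u' \<in> outer_states then ?f l' u' else 0) = 0"
      by simp
    fix l' assume "l' \<in> inner_states"
    then show "(\<Sum>u'\<in>states N. if l' \<in> inner_states \<and> u' \<in> outer_states then ?f l' u' else 0) = (\<Sum>u'\<in>outer_states. ?f l' u')"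
      by (intro sum.mono_neutral_cong_right finite_states) (auto simp: outer_states_def)
  qed
  finally show ?thesis .
qed

text \<open>A containing shape without boxes below row \<open>N\<close> is one of the parametrised
  regions. Any other one fills column \<open>c\<close> from row \<open>n\<close> to beyond row
  \<open>n + K\<close>, and strictness forces a label larger than \<open>K\<close> there.\<close>

lemma schur_eq_0:
  assumes sk: "skew_shape \<mu>" and con: "contains_shape \<mu> \<sigma>"
    and out: "\<mu> \<notin> (\<lambda>(l', u'). skew_region l' u') ` (inner_states \<times> outer_states)"
    and K: "n + K \<le> N" and m: "Poly_Mapping.keys m \<subseteq> {..K}"
  shows "schur \<mu> m = 0"
proof -
  have sub: "\<sigma> \<subseteq> \<mu>" using con by (simp add: contains_shape_def)
  have corner: "(n, c) \<in> \<mu>" using sub row_nonempty[of n] n l_n by (auto simp: skew_region_def)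
  have col: "c \<le> j \<and> j < M" if "(i, j) \<in> \<mu>" for i j
  proof -
    have "snd (i, j) \<in> snd ` \<mu>" using that by (rule imageI)
    then have "j \<in> snd ` \<sigma>" using con unfolding contains_shape_def by (simp only: snd_conv) blast
    then obtain i' where "l i' \<le> j" "j < u i'" by (auto simp: skew_region_def)
    then show ?thesis using states_ge[OF l, of i'] states_le[OF u, of i'] by simp
  qed
  have "\<exists>i j. (i, j) \<in> \<mu> \<and> N < i"
  proof (rule ccontr)
    assume no: "\<not> ?thesis"
    have "\<exists>l'\<in>states n. \<exists>u'\<in>states N. skew_region l' u' = \<mu> \<and> l' n = c \<and> (\<forall>i\<in>{1..n}. l' i < u' i)"
    proof (rule skew_shape_region[OF sk n corner])
      show "i \<le> N \<and> c \<le> j \<and> j < M" if "(i, j) \<in> \<mu>" for i j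
      proof -
        have "\<not> N < i" using no that by blast
        then show ?thesis using col[OF that] by simp
      qed
      show "\<exists>q. (i, q) \<in> \<mu> \<and> (Suc i, q) \<in> \<mu>" if "1 \<le> i" "i < n" for i
      proof -
        have "(i, l i) \<in> \<sigma>" "(Suc i, l i) \<in> \<sigma>"
          using that overlap[of i] row_nonempty[of i] states_mono[OF l, of i "Suc i"] by (auto simp: skew_region_def)
        then show ?thesis using sub by blast
      qed
    qed
    then obtain l' u' where l': "l' \<in> states n" and u': "u' \<in> states N" and reg: "skew_region l' u' = \<mu>"
      by blast
    have le: "l' i \<le> l i \<and> u i \<le> u' i" for i
    proof -
      consider "i = 0" | "i \<in> {1..n}" | "n < i" by fastforce
      then show ?thesis
      proof cases
        case 1
        then show ?thesis using states_0[OF l] states_0[OF u] states_0[OF l'] states_0[OF u'] by simp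
      next
        case 2
        then have "(i, l i) \<in> \<sigma>" "(i, u i - 1) \<in> \<sigma>" using row_nonempty[of i] by (auto simp: skew_region_def)
        then have "(i, l i) \<in> skew_region l' u'" "(i, u i - 1) \<in> skew_region l' u'" using sub reg by auto
        then show ?thesis by (auto simp: skew_region_def)
      next
        case 3
        then show ?thesis
          using states_const[OF l, of i] states_const[OF l', of i] states_const[OF u, of i] states_ge[OF u', of i] by simp
      qed
    qed
    then have "l' \<in> inner_states" "u' \<in> outer_states"
      using l' u' n states_subset[of n N] by (auto simp: inner_states_def outer_states_def)
    then show False using out reg by blast
  qed
  then obtain i j where ij: "(i, j) \<in> \<mu>" "N < i" by blast
  have column: "(n + d, c) \<in> \<mu>" if "n + d \<le> i" for d
    using skew_shape_between[OF sk corner ij(1)] that col[OF ij(1)] by simp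
  have "{T \<in> tableaux \<mu>. semistandard \<mu> T \<and> tab_content \<mu> T = m} = {}"
  proof (rule ccontr)
    assume "\<not> ?thesis"
    then obtain T where T: "T \<in> tableaux \<mu>" "semistandard \<mu> T" "tab_content \<mu> T = m" by blast
    have "Suc d \<le> T (n + d, c)" if "n + d \<le> i" for d
      using that
    proof (induction d)
      case 0
      have "T (n, c) \<in> {1..}" by (rule PiE_mem[OF T(1)[unfolded tableaux_def] corner])
      then show ?case by simp
    next
      case (Suc d)
      have "(n + d, c) \<in> \<mu>" "(n + Suc d, c) \<in> \<mu>" "n + d < n + Suc d"
        using column[of d] column[of "Suc d"] Suc.prems by simp_all
      then have "T (n + d, c) < T (n + Suc d, c)" using T(2) unfolding semistandard_def by blast
      then show ?case using Suc by simp
    qed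
    from this[of "Suc K"] have "K < T (n + Suc K, c)" using ij K by simp
    moreover have "T (n + Suc K, c) \<le> K"
      using sk m T(3) column[of "Suc K"] ij K by (intro label_le_of_content[of \<mu> T m]) (auto simp: skew_shape_def)
    ultimately show False by simp
  qed
  then show ?thesis unfolding schur_def by (simp only: card.empty of_nat_0)
qed

end

text \<open>Connectedness, in the form of overlapping consecutive rows, brings the leftmost column
  down to the bottom row. The rightmost column reaches row 1 since the right ends decrease
  downwards.\<close>

lemma skew_frame_exists:
  assumes sk: "skew_shape \<sigma>" and con: "connected_shape \<sigma>" and ne: "\<sigma> \<noteq> {}" and top: "Min (fst ` \<sigma>) = 1"
  shows "\<exists>M c n l u. \<sigma> = skew_region l u \<and> (\<forall>N\<ge>n. skew_frame M c N n l u)"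
proof -
  define n where "n = Max (fst ` \<sigma>)"
  define c where "c = Min (snd ` \<sigma>)"
  define M where "M = Suc (Max (snd ` \<sigma>))"
  have fin: "finite (fst ` \<sigma>)" "finite (snd ` \<sigma>)" and ne': "fst ` \<sigma> \<noteq> {}" "snd ` \<sigma> \<noteq> {}"
    using sk ne by (auto simp: skew_shape_def)
  have box: "1 \<le> i \<and> i \<le> n \<and> c \<le> j \<and> j < M \<and> 1 \<le> j" if "(i, j) \<in> \<sigma>" for i j
  proof -
    have "i \<in> fst ` \<sigma>" "j \<in> snd ` \<sigma>" using that by force+
    moreover have "1 \<le> i \<and> 1 \<le> j" using sk that unfolding skew_shape_def by blast
    ultimately show ?thesis using fin by (simp add: n_def c_def M_def less_Suc_eq_le)
  qed
  obtain jt where jt: "(1, jt) \<in> \<sigma>" using Min_in[OF fin(1) ne'(1)] top by auto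
  obtain jb where jb: "(n, jb) \<in> \<sigma>" using Max_in[OF fin(1) ne'(1)] by (auto simp: n_def)
  obtain il where il: "(il, c) \<in> \<sigma>" using Min_in[OF fin(2) ne'(2)] by (auto simp: c_def)
  obtain ir where ir: "(ir, M - 1) \<in> \<sigma>" using Max_in[OF fin(2) ne'(2)] by (auto simp: M_def)
  have n: "1 \<le> n" using box[OF jt] by simp
  have ov: "\<exists>q. (i, q) \<in> \<sigma> \<and> (Suc i, q) \<in> \<sigma>" if "1 \<le> i" "i < n" for i
    by (rule connected_rows_overlap[OF sk con jt _ jb]) (use that in auto)
  have c: "0 < c" using box[OF il] by simp
  \<comment> \<open>Only \<open>states n\<close> is wanted here, so the cut-off may be any
    number.\<close>
  interpret strips M c 0 using c by unfold_locales
  \<comment> \<open>Column \<open>c\<close> can be followed downwards: rows \<open>i\<close> and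
    \<open>i + 1\<close> share some column \<open>q \<ge> c\<close>, and \<open>(Suc i, c)\<close>
    lies between \<open>(i, c)\<close> and \<open>(Suc i, q)\<close>.\<close>
  have corner: "(n, c) \<in> \<sigma>"
  proof -
    have "(i, c) \<in> \<sigma>" if "il \<le> i" "i \<le> n" for i
      using that
    proof (induction i rule: dec_induct)
      case base show ?case by (rule il)
    next
      case (step i)
      then have ic: "(i, c) \<in> \<sigma>" by simp
      then obtain q where q: "(i, q) \<in> \<sigma>" "(Suc i, q) \<in> \<sigma>" using ov[of i] box step by auto
      show ?case by (rule skew_shape_between[OF sk ic q(2)]) (use box[OF q(1)] in auto)
    qed
    then show ?thesis using box[OF il] by blast
  qed
  have "\<exists>l\<in>states n. \<exists>u\<in>states n. skew_region l u = \<sigma> \<and> l n = c \<and> (\<forall>i\<in>{1..n}. l i < u i)"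
    by (rule skew_shape_region[OF sk n order_refl corner _ ov]) (use box in auto)
  then obtain l u where l: "l \<in> states n" and u: "u \<in> states n" and reg: "skew_region l u = \<sigma>"
    and ln: "l n = c" and lu: "\<And>i. i \<in> {1..n} \<Longrightarrow> l i < u i"
    by blast
  have mem: "(i, j) \<in> \<sigma> \<longleftrightarrow> 1 \<le> i \<and> l i \<le> j \<and> j < u i" for i j
    unfolding reg[symmetric] by (simp add: skew_region_def)
  have u1: "u 1 = M"
  proof (rule antisym)
    show "u 1 \<le> M" by (rule states_le[OF u])
    have "1 \<le> ir" "M - 1 < u ir" using ir mem by auto
    then show "M \<le> u 1" using states_mono[OF u, of 1 ir] by simp
  qed
  have "l i < u (Suc i)" if "1 \<le> i" "i < n" for i
    using ov[OF that] mem by auto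
  then have "skew_frame M c N n l u" if "n \<le> N" for N
    using that c n l u ln lu u1 by unfold_locales auto
  then show ?thesis using reg by blast
qed

theorem theorem1p1:
  fixes \<sigma> :: "box set"
  assumes "skew_shape \<sigma>"
    and "connected_shape \<sigma>"
    and "\<sigma> \<noteq> {}" and "Min (fst ` \<sigma>) = 1"
  shows "((\<lambda>\<mu>. (\<lambda>c. (-1) ^ card (below \<mu> \<sigma>) * int (expansion_coeff \<sigma> \<mu>) * schur \<mu> c))
            has_sum grothendieck \<sigma>)
         {\<mu>. skew_shape \<mu> \<and> contains_shape \<mu> \<sigma>}"
proof -
  obtain M c n l u where \<sigma>: "\<sigma> = skew_region l u" and frame: "\<And>N. n \<le> N \<Longrightarrow> skew_frame M c N n l u"
    using skew_frame_exists[OF assms] by blast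
  let ?I = "{\<mu>. skew_shape \<mu> \<and> contains_shape \<mu> \<sigma>}"
  let ?f = "\<lambda>\<mu> m. (-1) ^ card (below \<mu> \<sigma>) * int (expansion_coeff \<sigma> \<mu>) * schur \<mu> m"
  show ?thesis
    unfolding series_has_sum_iff
  proof (intro allI)
    fix m :: "nat \<Rightarrow>\<^sub>0 nat"
    \<comment> \<open>The frame is chosen for each monomial separately, with as many rows below
      \<sigma> as there are usable labels. The inserted 0 covers the constant monomial.\<close>
    define K where "K = Max (insert 0 (Poly_Mapping.keys m))"
    have K: "Poly_Mapping.keys m \<subseteq> {..K}" by (auto simp: K_def)
    interpret skew_frame M c "n + K" n l u by (rule frame) simp
    let ?P = "inner_states \<times> outer_states"
    let ?J = "(\<lambda>(l', u'). skew_region l' u') ` ?P"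
    have finP: "finite inner_states" "finite outer_states"
      using finite_states by (auto simp: inner_states_def outer_states_def)
    have J: "?J \<subseteq> ?I"
      using skew_shape_skew_region contains_shape_skew_region by (auto simp: \<sigma>)
    have zero: "?f \<mu> m = 0" if "\<mu> \<in> ?I - ?J" for \<mu>
      using schur_eq_0[OF _ _ _ order_refl K, of \<mu>] that by (auto simp: \<sigma>)
    then have sub: "{\<mu> \<in> ?I. ?f \<mu> m \<noteq> 0} \<subseteq> ?J" by blast
    moreover have finJ: "finite ?J" using finP by simp
    ultimately have fin: "finite {\<mu> \<in> ?I. ?f \<mu> m \<noteq> 0}" by (rule finite_subset)
    have "grothendieck \<sigma> m = (\<Sum>(l', u')\<in>?P. ?f (skew_region l' u') m)"
      unfolding sum.cartesian_product[symmetric] using coefficient_identity[OF order_refl K] by (simp add: \<sigma>)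
    also have "\<dots> = (\<Sum>\<mu>\<in>?J. ?f \<mu> m)"
      unfolding sum.reindex[OF skew_region_inj] by (simp add: case_prod_unfold)
    also have "\<dots> = (\<Sum>\<mu> | \<mu> \<in> ?I \<and> ?f \<mu> m \<noteq> 0. ?f \<mu> m)"
      using J sub finJ by (intro sum.mono_neutral_right) auto
    finally show "finite {\<mu> \<in> ?I. ?f \<mu> m \<noteq> 0} \<and> grothendieck \<sigma> m = (\<Sum>\<mu> | \<mu> \<in> ?I \<and> ?f \<mu> m \<noteq> 0. ?f \<mu> m)"
      using fin by blast
  qed
qed

end
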